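(* Let $s\ge1$. Let $(\alpha,\chi)$ be a smooth solution of the system $$\partial_\tau^2\alpha+\frac1\tau\partial_\tau\alpha+4q'\alpha-\frac{4}{(\tau^2+1)^2}\Delta\alpha=f_1(\tau)\tau\partial_\tau\alpha+f_2(\tau)\tau^2\alpha+f_3(\tau)\chi,\qquad \partial_\tau\chi=2\tau\alpha\tag{M}$$ on $(0,\infty)\times S^n$ with asymptotic data at $\tau=0$ given by $\chi(0),\mathcal{O},h$, and let $\mathfrak{h}:=h-(\log\nabla)\mathcal{O}:=h-\sum_{l\ge1}l\log2\cdot\mathcal{O}_l$. Then $$\|\mathfrak{h}\|_{H^s}+\|\mathcal{O}\|_{H^s}\lesssim\Big(\|\alpha\|_{H^{s+1/2}}+\|\partial_\tau\alpha\|_{H^{s-1/2}}+\|\chi\|_{H^{s-1/2}}\Big)\Big|_{\tau=1},$$ $$\|\chi(0)\|_{H^{s+1/2}}\lesssim\Big(\|\alpha\|_{H^{s+1/2}}+\|\partial_\tau\alpha\|_{H^{s-1/2}}+\|\chi\|_{H^{s+1/2}}\Big)\Big|_{\tau=1},$$ with implicit constants independent of the solution.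
   Context: $n\ge4$ is even, $q'\ge1$ is a constant, $f_1,f_2,f_3:[0,\infty)\to\mathbb{R}$ are fixed bounded smooth functions, and $\Delta$ is the Laplace–Beltrami operator of the standard metric on $S^n$. **Frequency notation.** Let $\{\varphi_i\}_{i\ge0}\subset C^\infty(S^n)$ be an orthonormal basis of $L^2(S^n)$ with $-\Delta\varphi_i=\lambda_i^2\varphi_i$, $0=\lambda_0<\lambda_1\le\cdots$. $\|f\|_{H^s}^2=\sum_i(1+\lambda_i^2)^s|\langle f,\varphi_i\rangle|^2$. $f_0=\sum_{\lambda_i\le1}\langle f,\varphi_i\rangle\varphi_i$ and, for $l\ge1$, $f_l=\sum_{2^{l-1}<\lambda_i\le2^l}\langle f,\varphi_i\rangle\varphi_i$. **Asymptotic data.** For $\chi(0),\mathcal{O},h\in C^\infty(S^n)$, a pair $\alpha,\chi\in C^\infty((0,\infty)\times S^n)$ solving (M) is a *smooth solution with asymptotic data $(\chi(0),\mathcal{O},h)$* if $\alpha-\mathcal{O}\log\tau-h$ and $\chi$ belong to $C^1_\tau([0,\infty);C^\infty(S^n))$, $\chi|_{\tau=0}=\chi(0)$, and as $\tau\to0$, $\alpha=\mathcal{O}\log\tau+h+O(\tau^2|\log\tau|^2)$, $\partial_\tau\alpha=\mathcal{O}/\tau+O(\tau|\log\tau|^2)$ in $C^\infty(S^n)$ (i.e. in every $H^k(S^n)$). *)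

theory Defs
  imports "HOL-Analysis.Analysis" "HOL-Library.Landau_Symbols"
begin

text \<open>
  The sphere \<open>S\<^sup>n\<close> is \<open>sphere 0 1\<close> in a Euclidean space \<open>'a\<close> with \<open>DIM('a) = n + 1\<close>. Functions on it
  are total functions on \<open>'a\<close> of which only the values on \<open>sphere 0 1\<close> matter.
  Note that \<open>sgn x = x /\<^sub>R norm x\<close> is the radial projection onto the sphere.
\<close>

section \<open>Smoothness\<close>

text \<open>Intended for open sets \<open>S\<close>.\<close>

primrec Ck_on :: "nat \<Rightarrow> ('b::euclidean_space \<Rightarrow> real) \<Rightarrow> 'b set \<Rightarrow> bool" where
  "Ck_on 0 f S \<longleftrightarrow> continuous_on S f"
| "Ck_on (Suc k) f S \<longleftrightarrow>
     (\<forall>x\<in>S. f differentiable (at x)) \<and>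
     (\<forall>b\<in>Basis. Ck_on k (\<lambda>x. frechet_derivative f (at x) b) S)"

definition smooth_on :: "('b::euclidean_space \<Rightarrow> real) \<Rightarrow> 'b set \<Rightarrow> bool" where
  "smooth_on f S \<longleftrightarrow> (\<forall>k. Ck_on k f S)"

text \<open>Smoothness on the closed half-line, with one-sided derivatives at \<open>0\<close>.\<close>

definition smooth_halfline :: "(real \<Rightarrow> real) \<Rightarrow> bool" where
  "smooth_halfline f \<longleftrightarrow>
     (\<exists>D :: nat \<Rightarrow> real \<Rightarrow> real. (\<forall>t\<ge>0. D 0 t = f t) \<and>
        (\<forall>k. \<forall>t\<ge>0. (D k has_real_derivative D (Suc k) t) (at t within {0..})))"

text \<open>The extension of a function on the sphere which is constant along rays. As \<open>sgn\<close> is a smooth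
  retraction of the punctured space onto the sphere, a function is smooth on the submanifold
  \<open>sphere 0 1\<close> iff this extension is smooth away from the origin.\<close>

definition radial_ext :: "('a::euclidean_space \<Rightarrow> 'c) \<Rightarrow> 'a \<Rightarrow> 'c" where
  "radial_ext f = (\<lambda>x. f (sgn x))"

definition smooth_sphere :: "('a::euclidean_space \<Rightarrow> real) \<Rightarrow> bool" where
  "smooth_sphere f \<longleftrightarrow> smooth_on (radial_ext f) (UNIV - {0})"

definition smooth_spacetime :: "(real \<Rightarrow> 'a::euclidean_space \<Rightarrow> real) \<Rightarrow> bool" where
  "smooth_spacetime u \<longleftrightarrow>
     smooth_on (\<lambda>(t, x). radial_ext (u t) x) ({0<..} \<times> (UNIV - {0}))"


section \<open>The Laplace--Beltrami operator\<close>

text \<open>The Laplacian is the divergence of the gradient for the metric induced from \<open>'a\<close>. At a point of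
  the sphere the ambient gradient of the radially constant extension is tangent to the sphere, so it is
  the Riemannian gradient. The Levi-Civita connection is the tangential part of the ambient
  derivative, so the divergence of a tangent field is the trace of that derivative over the
  tangent space; the radial direction contributes nothing to the full trace below, because the
  extension is radially constant.\<close>

definition sphere_grad :: "('a::euclidean_space \<Rightarrow> real) \<Rightarrow> 'a \<Rightarrow> 'a" where
  "sphere_grad f x = (\<Sum>b\<in>Basis. frechet_derivative (radial_ext f) (at x) b *\<^sub>R b)"

definition sphere_div :: "('a::euclidean_space \<Rightarrow> 'a) \<Rightarrow> 'a \<Rightarrow> real" where
  "sphere_div X x = (\<Sum>b\<in>Basis. frechet_derivative (radial_ext X) (at x) b \<bullet> b)"

definition sphere_laplacian :: "('a::euclidean_space \<Rightarrow> real) \<Rightarrow> 'a \<Rightarrow> real" where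
  "sphere_laplacian f = sphere_div (sphere_grad f)"


section \<open>\<open>L\<^sup>2\<close>, eigenbasis, Sobolev norms\<close>

text \<open>The Riemannian measure of the unit sphere in polar coordinates: \<open>\<sigma>(A)\<close> is \<open>DIM('a)\<close> times the
  Lebesgue measure of the cone \<open>{t x | 0 < t < 1, x \<in> A}\<close>. Its measurable space is the sphere
  itself, so that values of functions off the sphere are irrelevant.\<close>

definition sphere_measure :: "'a::euclidean_space measure" where
  "sphere_measure = scale_measure (of_nat DIM('a))
     (distr (restrict_space lborel (ball 0 1 - {0})) (restrict_space borel (sphere 0 1)) sgn)"

definition l2_inner :: "('a::euclidean_space \<Rightarrow> real) \<Rightarrow> ('a \<Rightarrow> real) \<Rightarrow> real" where
  "l2_inner f g = (LINT x|sphere_measure. f x * g x)"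

definition eigenbasis :: "(nat \<Rightarrow> 'a::euclidean_space \<Rightarrow> real) \<Rightarrow> (nat \<Rightarrow> real) \<Rightarrow> bool" where
  "eigenbasis \<phi> lam \<longleftrightarrow>
     (\<forall>i. smooth_sphere (\<phi> i)) \<and>
     (\<forall>i j. l2_inner (\<phi> i) (\<phi> j) = (if i = j then 1 else 0)) \<and>
     (\<forall>f \<in> borel_measurable sphere_measure. integrable sphere_measure (\<lambda>x. (f x)\<^sup>2) \<longrightarrow>
        (\<lambda>N. LINT x|sphere_measure. (f x - (\<Sum>i<N. l2_inner f (\<phi> i) * \<phi> i x))\<^sup>2) \<longlonglongrightarrow> 0) \<and>
     (\<forall>i. \<forall>x\<in>sphere 0 1. - sphere_laplacian (\<phi> i) x = (lam i)\<^sup>2 * \<phi> i x) \<and>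
     lam 0 = 0 \<and> 0 < lam 1 \<and> incseq lam"

definition sobolev_norm ::
  "(nat \<Rightarrow> 'a::euclidean_space \<Rightarrow> real) \<Rightarrow> (nat \<Rightarrow> real) \<Rightarrow> real \<Rightarrow> ('a \<Rightarrow> real) \<Rightarrow> real" where
  "sobolev_norm \<phi> lam s f = sqrt (\<Sum>i. (1 + (lam i)\<^sup>2) powr s * \<bar>l2_inner f (\<phi> i)\<bar>\<^sup>2)"

definition freq_block ::
  "(nat \<Rightarrow> 'a::euclidean_space \<Rightarrow> real) \<Rightarrow> (nat \<Rightarrow> real) \<Rightarrow> nat \<Rightarrow> ('a \<Rightarrow> real) \<Rightarrow> 'a \<Rightarrow> real" where
  "freq_block \<phi> lam l f x =
     (\<Sum>i\<in>{i. if l = 0 then lam i \<le> 1 else 2 ^ (l - 1) < lam i \<and> lam i \<le> 2 ^ l}.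
        l2_inner f (\<phi> i) * \<phi> i x)"

text \<open>The series over \<open>l \<ge> 1\<close>, re-indexed from \<open>0\<close> and summed pointwise.\<close>

definition log_nabla ::
  "(nat \<Rightarrow> 'a::euclidean_space \<Rightarrow> real) \<Rightarrow> (nat \<Rightarrow> real) \<Rightarrow> ('a \<Rightarrow> real) \<Rightarrow> 'a \<Rightarrow> real" where
  "log_nabla \<phi> lam f x = (\<Sum>l. real (Suc l) * ln 2 * freq_block \<phi> lam (Suc l) f x)"


section \<open>Solutions with asymptotic data\<close>

text \<open>Convergence in \<open>C\<^sup>\<infinity>(S\<^sup>n)\<close>, i.e. in every \<open>H\<^sup>k(S\<^sup>n)\<close>; used for smooth arguments only.\<close>

definition Cinf_tendsto ::
  "(nat \<Rightarrow> 'a::euclidean_space \<Rightarrow> real) \<Rightarrow> (nat \<Rightarrow> real) \<Rightarrow>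
   (real \<Rightarrow> 'a \<Rightarrow> real) \<Rightarrow> ('a \<Rightarrow> real) \<Rightarrow> real filter \<Rightarrow> bool" where
  "Cinf_tendsto \<phi> lam u g F \<longleftrightarrow>
     (\<forall>k::nat. ((\<lambda>t. sobolev_norm \<phi> lam (real k) (\<lambda>x. u t x - g x)) \<longlongrightarrow> 0) F)"

definition Cinf_bigo ::
  "(nat \<Rightarrow> 'a::euclidean_space \<Rightarrow> real) \<Rightarrow> (nat \<Rightarrow> real) \<Rightarrow>
   (real \<Rightarrow> 'a \<Rightarrow> real) \<Rightarrow> (real \<Rightarrow> real) \<Rightarrow> real filter \<Rightarrow> bool" where
  "Cinf_bigo \<phi> lam u r F \<longleftrightarrow>
     (\<forall>k::nat. (\<lambda>t. sobolev_norm \<phi> lam (real k) (u t)) \<in> O[F](r))"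

text \<open>The space \<open>C\<^sup>1\<^sub>\<tau>([0,\<infinity>); C\<^sup>\<infinity>(S\<^sup>n))\<close>; \<open>v\<close> is the \<open>\<tau>\<close>-derivative.\<close>

definition C1_time ::
  "(nat \<Rightarrow> 'a::euclidean_space \<Rightarrow> real) \<Rightarrow> (nat \<Rightarrow> real) \<Rightarrow> (real \<Rightarrow> 'a \<Rightarrow> real) \<Rightarrow> bool" where
  "C1_time \<phi> lam u \<longleftrightarrow>
     (\<forall>t\<ge>0. smooth_sphere (u t)) \<and>
     (\<exists>v. (\<forall>t\<ge>0. smooth_sphere (v t)) \<and>
        (\<forall>t\<ge>0. Cinf_tendsto \<phi> lam (\<lambda>r x. (u r x - u t x) / (r - t)) (v t) (at t within {0..})) \<and>
        (\<forall>t\<ge>0. Cinf_tendsto \<phi> lam v (v t) (at t within {0..})))"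

definition dtau :: "(real \<Rightarrow> 'a \<Rightarrow> real) \<Rightarrow> real \<Rightarrow> 'a \<Rightarrow> real" where
  "dtau u t x = deriv (\<lambda>r. u r x) t"

definition solves_M ::
  "real \<Rightarrow> (real \<Rightarrow> real) \<Rightarrow> (real \<Rightarrow> real) \<Rightarrow> (real \<Rightarrow> real) \<Rightarrow>
   (real \<Rightarrow> 'a::euclidean_space \<Rightarrow> real) \<Rightarrow> (real \<Rightarrow> 'a \<Rightarrow> real) \<Rightarrow> bool" where
  "solves_M q' f1 f2 f3 \<alpha> chi \<longleftrightarrow>
     (\<forall>\<tau>>0. \<forall>x\<in>sphere 0 1.
        dtau (dtau \<alpha>) \<tau> x + 1 / \<tau> * dtau \<alpha> \<tau> x + 4 * q' * \<alpha> \<tau> x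
            - 4 / (\<tau>\<^sup>2 + 1)\<^sup>2 * sphere_laplacian (\<alpha> \<tau>) x
          = f1 \<tau> * \<tau> * dtau \<alpha> \<tau> x + f2 \<tau> * \<tau>\<^sup>2 * \<alpha> \<tau> x + f3 \<tau> * chi \<tau> x \<and>
        dtau chi \<tau> x = 2 * \<tau> * \<alpha> \<tau> x)"

text \<open>We write \<open>chi\<close> for the second unknown, as the Greek letter is a binder in \<open>HOL-Analysis\<close>.
  The pair \<open>(\<alpha>, chi)\<close> lives on \<open>\<tau> > 0\<close> only; membership in \<open>C\<^sup>1\<^sub>\<tau>([0,\<infinity>); C\<^sup>\<infinity>(S\<^sup>n))\<close> means that there
  is an extension to \<open>\<tau> = 0\<close> in that space, and the value of the extension of \<open>chi\<close> at \<open>0\<close> is \<open>chi\<^sub>0\<close>.\<close>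

definition smooth_solution ::
  "(nat \<Rightarrow> 'a::euclidean_space \<Rightarrow> real) \<Rightarrow> (nat \<Rightarrow> real) \<Rightarrow>
   real \<Rightarrow> (real \<Rightarrow> real) \<Rightarrow> (real \<Rightarrow> real) \<Rightarrow> (real \<Rightarrow> real) \<Rightarrow>
   ('a \<Rightarrow> real) \<Rightarrow> ('a \<Rightarrow> real) \<Rightarrow> ('a \<Rightarrow> real) \<Rightarrow>
   (real \<Rightarrow> 'a \<Rightarrow> real) \<Rightarrow> (real \<Rightarrow> 'a \<Rightarrow> real) \<Rightarrow> bool" where
  "smooth_solution \<phi> lam q' f1 f2 f3 chi\<^sub>0 \<O> h \<alpha> chi \<longleftrightarrow>
     smooth_sphere chi\<^sub>0 \<and> smooth_sphere \<O> \<and> smooth_sphere h \<and>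
     smooth_spacetime \<alpha> \<and> smooth_spacetime chi \<and>
     solves_M q' f1 f2 f3 \<alpha> chi \<and>
     (\<exists>u. C1_time \<phi> lam u \<and>
        (\<forall>\<tau>>0. \<forall>x\<in>sphere 0 1. u \<tau> x = \<alpha> \<tau> x - \<O> x * ln \<tau> - h x)) \<and>
     (\<exists>w. C1_time \<phi> lam w \<and>
        (\<forall>\<tau>>0. \<forall>x\<in>sphere 0 1. w \<tau> x = chi \<tau> x) \<and> (\<forall>x\<in>sphere 0 1. w 0 x = chi\<^sub>0 x)) \<and>
     Cinf_bigo \<phi> lam (\<lambda>\<tau> x. \<alpha> \<tau> x - (\<O> x * ln \<tau> + h x))
       (\<lambda>\<tau>. \<tau>\<^sup>2 * \<bar>ln \<tau>\<bar>\<^sup>2) (at_right 0) \<and>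
     Cinf_bigo \<phi> lam (\<lambda>\<tau> x. dtau \<alpha> \<tau> x - \<O> x / \<tau>)
       (\<lambda>\<tau>. \<tau> * \<bar>ln \<tau>\<bar>\<^sup>2) (at_right 0)"

end

theory Submission
  imports Defs
begin

text \<open>
  Since \<open>f\<^sub>1, f\<^sub>2, f\<^sub>3\<close> depend on \<open>\<tau>\<close> only, projecting (M) to an eigenfunction of frequency \<open>\<kappa>\<close> gives
  an ODE for the coefficients \<open>a\<close>, \<open>c\<close> of \<open>\<alpha>\<close>, \<open>\<chi>\<close>, and the theorem follows from bounds for this ODE
  that are uniform in \<open>\<kappa>\<close>. Let \<open>T = 2\<^sup>-\<^sup>l\<close>, where \<open>l\<close> is the index of the dyadic block of \<open>\<kappa>\<close>, so that
  \<open>T\<close> is comparable to \<open>(1 + \<kappa>\<^sup>2)\<^sup>-\<^sup>1\<^sup>/\<^sup>2\<close>. On \<open>[T, 1]\<close> the energy of \<open>\<surd>\<tau> a\<close> is conserved up to a constant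
  factor. On \<open>(0, T]\<close> the equation, rescaled by \<open>T\<close>, has bounded coefficients, and
  \<open>a = \<O> ln (\<tau> / T) + (h + \<O> ln T) + o(1)\<close>, where \<open>h + \<O> ln T = h - l ln 2 \<O>\<close> is precisely the coefficient
  of \<open>h - (log \<nabla>) \<O>\<close>.

  The projection needs the symmetry of the Laplacian, which comes from a divergence theorem on the
  sphere. The latter rests on \<open>\<integral> \<partial>\<^sub>b F = 0\<close> for compactly supported \<open>F\<close> in the ambient space, a consequence of
  translation invariance.
\<close>


section \<open>Closure properties of \<open>C\<^sup>k\<close> functions\<close>

text \<open>\<open>T\<close> is where a mode stops oscillating and its logarithmic behaviour sets
  in: below it the potential of the substitution is no longer integrable uniformly, above it the
  logarithmic expansion is not uniform in the frequency. The half derivative between the two sides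
  of the first estimate is gained at \<open>T\<close>, where \<open>(a T)\<^sup>2\<close> is at most
  a multiple of \<open>T\<close> times the energy. The coefficient of chi enters both energies with
  a free weight. The weight must be large enough for the term with \<open>f3\<close> to be absorbed
  and small enough for the source of the second equation to be absorbed; two choices in the
  admissible range give the two estimates. A second obstacle is that all notions are total: a sum
  over an infinite block, a divergent series and the integral of a non-integrable function have
  default values. Hence blocks must be finite, which requires unbounded frequencies.
  \<open>eigenbasis\<close> does not assert this, so it is derived from completeness; summability of
  the Sobolev series comes from powers of \<open>1 - \<Delta>\<close>.\<close>

lemma Ck_on_has_derivative:
  "Ck_on (Suc k) f S \<Longrightarrow> x \<in> S \<Longrightarrow> (f has_derivative frechet_derivative f (at x)) (at x)"
  by (meson Ck_on.simps(2) frechet_derivative_works)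

text \<open>Invariance under a change of values off \<open>S\<close> is itself proved by induction
  through this rule. It therefore appears as the hypothesis \<open>cong\<close>, supplied first by
  the induction hypothesis of \<open>Ck_on_cong\<close> and then, in \<open>Ck_on_SucI\<close>, by
  \<open>Ck_on_cong\<close> itself.\<close>

lemma Ck_on_Suc_aux:
  assumes "open S" "\<And>x. x \<in> S \<Longrightarrow> (f has_derivative D x) (at x)"
    and "\<And>b. b \<in> Basis \<Longrightarrow> Ck_on k (\<lambda>x. D x b) S"
    and cong: "\<And>f g. (\<And>x. x \<in> S \<Longrightarrow> f x = g x) \<Longrightarrow> Ck_on k f S \<Longrightarrow> Ck_on k g S"
  shows "Ck_on (Suc k) f S"
proof -
  have "Ck_on k (\<lambda>x. frechet_derivative f (at x) b) S" if "b \<in> Basis" for b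
    by (rule cong[OF _ assms(3)[OF that]]) (metis assms(2) frechet_derivative_at)
  moreover have "f differentiable (at x)" if "x \<in> S" for x
    using assms(2)[OF that] by (rule differentiableI)
  ultimately show ?thesis
    by simp
qed

lemma Ck_on_cong:
  assumes "open S" "\<And>x. x \<in> S \<Longrightarrow> f x = g x" "Ck_on k f S"
  shows "Ck_on k g S"
  using assms(2,3)
proof (induction k arbitrary: f g)
  case 0
  then show ?case by (metis Ck_on.simps(1) continuous_on_cong)
next
  case (Suc k)
  have D: "(g has_derivative frechet_derivative f (at x)) (at x)" if "x \<in> S" for x
    by (rule has_derivative_transform_within_open[OF Ck_on_has_derivative[OF Suc.prems(2) that]
          \<open>open S\<close> that Suc.prems(1)])
  show ?case
    using Suc.prems by (intro Ck_on_Suc_aux[OF \<open>open S\<close> D]) (auto intro: Suc.IH)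
qed

lemma Ck_on_SucI:
  assumes "open S" "\<And>x. x \<in> S \<Longrightarrow> (f has_derivative D x) (at x)"
    and "\<And>b. b \<in> Basis \<Longrightarrow> Ck_on k (\<lambda>x. D x b) S"
  shows "Ck_on (Suc k) f S"
  using Ck_on_Suc_aux[OF assms] Ck_on_cong[OF assms(1)] by blast

lemma Ck_on_decrease: "Ck_on (Suc k) f S \<Longrightarrow> Ck_on k f S"
proof (induction k arbitrary: f)
  case 0
  then have "isCont f x" if "x \<in> S" for x
    using that differentiable_imp_continuous_within by auto
  then show ?case
    by (simp add: continuous_at_imp_continuous_on)
next
  case (Suc k)
  then show ?case by (metis Ck_on.simps(2))
qed

lemma Ck_on_const: "open S \<Longrightarrow> Ck_on k (\<lambda>x. c) S"
  by (induction k arbitrary: c) (auto intro!: Ck_on_SucI derivative_eq_intros)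

lemma Ck_on_add:
  assumes "open S" shows "Ck_on k f S \<Longrightarrow> Ck_on k g S \<Longrightarrow> Ck_on k (\<lambda>x. f x + g x) S"
proof (induction k arbitrary: f g)
  case (Suc k)
  show ?case
    by (rule Ck_on_SucI[OF \<open>open S\<close>,
          where D = "\<lambda>x b. frechet_derivative f (at x) b + frechet_derivative g (at x) b"])
      (use Suc assms in \<open>auto intro!: has_derivative_add Ck_on_has_derivative\<close>)
qed (auto intro: continuous_on_add)

lemma Ck_on_mult:
  assumes "open S" shows "Ck_on k f S \<Longrightarrow> Ck_on k g S \<Longrightarrow> Ck_on k (\<lambda>x. f x * g x) S"
proof (induction k arbitrary: f g)
  case (Suc k)
  have "Ck_on k f S" "Ck_on k g S"
    using Suc.prems by (blast intro: Ck_on_decrease)+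
  then show ?case
    by (intro Ck_on_SucI[OF \<open>open S\<close>,
          where D = "\<lambda>x b. f x * frechet_derivative g (at x) b + frechet_derivative f (at x) b * g x"])
      (use Suc assms in \<open>auto intro!: has_derivative_mult Ck_on_has_derivative Ck_on_add\<close>)
qed (auto intro: continuous_on_mult)

text \<open>One induction for both, since each is up to sign the derivative of the other. They
  provide the test functions of \<open>lam_unbounded\<close>.\<close>

lemma Ck_on_cos_sin:
  assumes "open S"
  shows "Ck_on k u S \<Longrightarrow> Ck_on k (\<lambda>x. cos (u x)) S \<and> Ck_on k (\<lambda>x. sin (u x)) S"
proof (induction k)
  case (Suc k)
  then have IH: "Ck_on k (\<lambda>x. cos (u x)) S" "Ck_on k (\<lambda>x. sin (u x)) S"
    using Ck_on_decrease by blast+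
  have D: "(u has_derivative frechet_derivative u (at x)) (at x)" if "x \<in> S" for x
    using Ck_on_has_derivative[OF Suc.prems that] .
  have Du: "Ck_on k (\<lambda>x. frechet_derivative u (at x) b) S" if "b \<in> Basis" for b
    using Suc.prems that by simp
  have cos: "((\<lambda>x. cos (u x)) has_derivative (\<lambda>b. ((-1) * sin (u x)) * frechet_derivative u (at x) b)) (at x)"
    and sin: "((\<lambda>x. sin (u x)) has_derivative (\<lambda>b. cos (u x) * frechet_derivative u (at x) b)) (at x)"
    if "x \<in> S" for x
    by (rule derivative_eq_intros D[OF that] refl | simp add: fun_eq_iff)+
  show ?case
  proof
    show "Ck_on (Suc k) (\<lambda>x. cos (u x)) S"
      by (intro Ck_on_SucI[OF \<open>open S\<close> cos] Ck_on_mult Ck_on_const IH Du assms)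
    show "Ck_on (Suc k) (\<lambda>x. sin (u x)) S"
      by (intro Ck_on_SucI[OF \<open>open S\<close> sin] Ck_on_mult IH Du assms)
  qed
qed (auto intro!: continuous_intros)

lemma Ck_on_inner_left:
  assumes "open S"
  shows "Ck_on k (\<lambda>x. x \<bullet> c) S"
proof (cases k)
  case (Suc k')
  show ?thesis
    unfolding Suc by (rule Ck_on_SucI[where D = "\<lambda>x b. b \<bullet> c"])
      (auto simp: assms intro!: derivative_eq_intros Ck_on_const)
qed (auto intro!: continuous_intros)

text \<open>The exponent is arbitrary because differentiation lowers it by 2; the claim for the norm
  alone would not be inductive.\<close>

lemma Ck_on_norm_powr: "Ck_on k (\<lambda>x::'a::euclidean_space. norm x powr p) (UNIV - {0})"
proof (induction k arbitrary: p)
  case 0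
  then show ?case by (auto intro!: continuous_intros)
next
  case (Suc k)
  have D: "((\<lambda>x. norm x powr p) has_derivative (\<lambda>b. p * norm x powr (p - 2) * (x \<bullet> b))) (at x)"
    if "x \<in> UNIV - {0}" for x :: 'a
  proof -
    have "((\<lambda>x. norm x powr p) has_derivative
        (\<lambda>b. norm x powr p * (0 * ln (norm x) + (sgn x \<bullet> b) * p / norm x))) (at x)"
      using that has_derivative_powr[OF has_derivative_norm has_derivative_const, of x p]
      by (auto simp: inner_commute)
    also have "(\<lambda>b. norm x powr p * (0 * ln (norm x) + (sgn x \<bullet> b) * p / norm x))
       = (\<lambda>b. p * norm x powr (p - 2) * (x \<bullet> b))"
      using that by (auto simp: powr_diff sgn_div_norm power2_eq_square divide_simps fun_eq_iff)
    finally show ?thesis .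
  qed
  have "open (UNIV - {0::'a})" by auto
  then show ?case
    using Suc by (intro Ck_on_SucI[OF _ D] Ck_on_mult Ck_on_const Ck_on_inner_left)
qed

lemma smooth_on_const: "open S \<Longrightarrow> smooth_on (\<lambda>x. c) S"
  by (simp add: smooth_on_def Ck_on_const)

lemma smooth_on_add:
  "open S \<Longrightarrow> smooth_on f S \<Longrightarrow> smooth_on g S \<Longrightarrow> smooth_on (\<lambda>x. f x + g x) S"
  by (simp add: smooth_on_def Ck_on_add)

lemma smooth_on_mult:
  "open S \<Longrightarrow> smooth_on f S \<Longrightarrow> smooth_on g S \<Longrightarrow> smooth_on (\<lambda>x. f x * g x) S"
  by (simp add: smooth_on_def Ck_on_mult)

lemma smooth_on_sum:
  "open S \<Longrightarrow> (\<And>i. i \<in> I \<Longrightarrow> smooth_on (f i) S) \<Longrightarrow> smooth_on (\<lambda>x. \<Sum>i\<in>I. f i x) S"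
  by (induction I rule: infinite_finite_induct) (auto intro: smooth_on_add smooth_on_const)

lemma smooth_on_norm: "smooth_on (norm :: 'a::euclidean_space \<Rightarrow> real) (UNIV - {0})"
  unfolding smooth_on_def
proof
  fix k
  show "Ck_on k (norm :: 'a \<Rightarrow> real) (UNIV - {0})"
    by (rule Ck_on_cong[OF _ _ Ck_on_norm_powr[of k 1]]) auto
qed

lemma smooth_on_cos: "open S \<Longrightarrow> smooth_on u S \<Longrightarrow> smooth_on (\<lambda>x. cos (u x)) S"
  and smooth_on_sin: "open S \<Longrightarrow> smooth_on u S \<Longrightarrow> smooth_on (\<lambda>x. sin (u x)) S"
  by (simp_all add: smooth_on_def Ck_on_cos_sin)

lemma smooth_on_cong:
  "open S \<Longrightarrow> smooth_on f S \<Longrightarrow> (\<And>x. x \<in> S \<Longrightarrow> f x = g x) \<Longrightarrow> smooth_on g S"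
  unfolding smooth_on_def using Ck_on_cong by blast

lemma smooth_on_imp_continuous_on: "smooth_on f S \<Longrightarrow> continuous_on S f"
  unfolding smooth_on_def by (metis Ck_on.simps(1))

lemma smooth_on_has_derivative:
  "smooth_on f S \<Longrightarrow> x \<in> S \<Longrightarrow> (f has_derivative frechet_derivative f (at x)) (at x)"
  unfolding smooth_on_def using Ck_on_has_derivative by blast

lemma smooth_on_frechet_derivative:
  "smooth_on f S \<Longrightarrow> b \<in> Basis \<Longrightarrow> smooth_on (\<lambda>x. frechet_derivative f (at x) b) S"
  unfolding smooth_on_def by (metis Ck_on.simps(2))

lemma Ck_on_slice:
  fixes U :: "real \<times> 'a::euclidean_space \<Rightarrow> real"
  assumes "open S" "t \<in> J"
  shows "Ck_on k U (J \<times> S) \<Longrightarrow> Ck_on k (\<lambda>x. U (t, x)) S"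
proof (induction k arbitrary: U)
  case 0
  then have "continuous_on (J \<times> S) U" by simp
  then have "continuous_on S (\<lambda>x. U (t, x))"
    by (rule continuous_on_compose2) (use \<open>t \<in> J\<close> in \<open>auto intro!: continuous_on_Pair\<close>)
  then show ?case by simp
next
  case (Suc k)
  have D: "((\<lambda>x. U (t, x)) has_derivative (\<lambda>b. frechet_derivative U (at (t, x)) (0, b))) (at x)"
    if "x \<in> S" for x
  proof -
    have 1: "((\<lambda>x. (t, x)) has_derivative (\<lambda>b. (0, b))) (at x)"
      by (auto intro!: has_derivative_Pair)
    have 2: "(U has_derivative frechet_derivative U (at (t, x))) (at (t, x))"
      using that \<open>t \<in> J\<close> by (intro Ck_on_has_derivative[OF Suc.prems]) auto
    show ?thesis
      using has_derivative_compose[OF 1 2] .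
  qed
  show ?case
    by (rule Ck_on_SucI[OF \<open>open S\<close> D]) (use Suc assms in \<open>auto simp: Basis_prod_def\<close>)
qed

lemma smooth_on_slice:
  fixes U :: "real \<times> 'a::euclidean_space \<Rightarrow> real"
  shows "open S \<Longrightarrow> t \<in> J \<Longrightarrow> smooth_on U (J \<times> S) \<Longrightarrow> smooth_on (\<lambda>x. U (t, x)) S"
  by (simp add: smooth_on_def Ck_on_slice)

section \<open>Integration over the sphere\<close>

lemma space_sphere_measure [simp]: "space sphere_measure = sphere 0 1"
  by (simp add: sphere_measure_def space_scale_measure space_restrict_space)

lemma sets_sphere_measure [measurable_cong]:
  "sets sphere_measure = sets (restrict_space borel (sphere 0 1))"
  by (simp add: sphere_measure_def)

lemma measurable_sgn_sphere:
  "sgn \<in> restrict_space lborel (ball 0 1 - {0}) \<rightarrow>\<^sub>M restrict_space borel (sphere (0::'a::euclidean_space) 1)"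
proof (rule measurable_restrict_space2)
  show "sgn \<in> space (restrict_space lborel (ball 0 1 - {0})) \<rightarrow> sphere (0::'a) 1"
    by (auto simp: space_restrict_space norm_sgn)
  have "continuous_on (ball 0 1 - {0}) (sgn :: 'a \<Rightarrow> 'a)"
    by (intro continuous_on_sgn continuous_on_id) auto
  then have "(sgn :: 'a \<Rightarrow> 'a) \<in> borel_measurable (restrict_space borel (ball 0 1 - {0}))"
    by (rule borel_measurable_continuous_on_restrict)
  then show "(sgn :: 'a \<Rightarrow> 'a) \<in> borel_measurable (restrict_space lborel (ball 0 1 - {0}))"
    by (simp cong: measurable_cong_sets sets_restrict_space_cong)
qed

text \<open>A constant factor is a constant density, which makes the integration rule for densities
  available for \<open>sphere_measure\<close>.\<close>

lemma scale_measure_eq_density: "scale_measure r M = density M (\<lambda>_. r)"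
  by (rule measure_eqI) (auto simp: emeasure_density nn_integral_cmult_indicator)

lemma finite_measure_sphere: "finite_measure (sphere_measure :: 'a::euclidean_space measure)"
proof
  let ?R = "restrict_space lborel (ball 0 1 - {0}) :: 'a measure"
  have fin: "emeasure lborel (ball 0 1 - {0::'a}) < \<infinity>"
    using emeasure_lborel_ball_finite[of "0::'a" 1] emeasure_mono[of "ball 0 1 - {0::'a}" "ball 0 1" lborel]
    by (auto intro: le_less_trans)
  have "emeasure (sphere_measure :: 'a measure) A \<le> of_nat DIM('a) * emeasure ?R (space ?R)" for A
    unfolding sphere_measure_def emeasure_scale_measure
  proof (rule mult_left_mono)
    show "emeasure (distr ?R (restrict_space borel (sphere 0 1)) sgn) A \<le> emeasure ?R (space ?R)"
      by (cases "A \<in> sets (restrict_space borel (sphere (0::'a) 1))")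
        (auto simp: emeasure_distr measurable_sgn_sphere emeasure_notin_sets sets_restrict_space_iff intro!: emeasure_mono)
  qed simp
  also have "of_nat DIM('a) * emeasure ?R (space ?R) = of_nat DIM('a) * emeasure lborel (ball 0 1 - {0::'a})"
    by (simp add: space_restrict_space emeasure_restrict_space)
  also have "\<dots> < \<infinity>"
    using fin by (simp add: ennreal_mult_less_top of_nat_less_top)
  finally show "emeasure (sphere_measure :: 'a measure) (space sphere_measure) \<noteq> \<infinity>" by (rule less_imp_neq)
qed

interpretation sphere: finite_measure sphere_measure
  by (rule finite_measure_sphere)

lemma continuous_measurable_sphere:
  fixes f :: "'a::euclidean_space \<Rightarrow> real"
  shows "continuous_on (sphere 0 1) f \<Longrightarrow> f \<in> borel_measurable sphere_measure"
  using borel_measurable_continuous_on_restrict measurable_cong_sets[OF sets_sphere_measure refl]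
  by blast

lemma bounded_on_sphere:
  fixes f :: "'a::euclidean_space \<Rightarrow> real"
  assumes "continuous_on (sphere 0 1) f"
  obtains B where "B > 0" "\<And>x. x \<in> sphere 0 1 \<Longrightarrow> \<bar>f x\<bar> \<le> B"
proof -
  have "bounded (f ` sphere 0 1)"
    using assms by (intro compact_imp_bounded compact_continuous_image) auto
  then show ?thesis
    using that unfolding bounded_pos by auto
qed

lemma integrable_sphere:
  fixes f :: "'a::euclidean_space \<Rightarrow> real"
  assumes "continuous_on (sphere 0 1) f"
  shows "integrable sphere_measure f"
proof -
  obtain B where "\<And>x. x \<in> sphere 0 1 \<Longrightarrow> \<bar>f x\<bar> \<le> B"
    using bounded_on_sphere[OF assms] by metis
  then show ?thesis
    by (intro sphere.integrable_const_bound[of _ B] continuous_measurable_sphere assms) auto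
qed

lemma integral_sphere:
  fixes f :: "'a::euclidean_space \<Rightarrow> real"
  assumes "f \<in> borel_measurable sphere_measure"
  shows "(LINT x|sphere_measure. f x) = DIM('a) * (LINT x|lborel. indicator (ball 0 1 - {0}) x * f (sgn x))"
proof -
  have f: "f \<in> borel_measurable (restrict_space borel (sphere 0 1))"
    using assms measurable_cong_sets[OF sets_sphere_measure refl] by blast
  let ?D = "distr (restrict_space lborel (ball 0 1 - {0})) (restrict_space borel (sphere 0 1)) (sgn :: 'a \<Rightarrow> 'a)"
  have "(sphere_measure :: 'a measure) = density ?D (\<lambda>_. ennreal (real DIM('a)))"
    by (simp add: sphere_measure_def scale_measure_eq_density ennreal_of_nat_eq_real_of_nat)
  then have "(LINT x|sphere_measure. f x) = (LINT x|density ?D (\<lambda>_. ennreal (real DIM('a))). f x)"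
    by (rule arg_cong)
  also have "\<dots> = (LINT x|?D. real DIM('a) *\<^sub>R f x)"
    using f by (intro integral_density) auto
  also have "\<dots> = DIM('a) * (LINT x|?D. f x)"
    by simp
  also have "(LINT x|?D. f x) = (LINT x|restrict_space lborel (ball 0 1 - {0}). f (sgn x))"
    by (rule integral_distr[OF measurable_sgn_sphere f])
  also have "\<dots> = (LINT x|lborel. indicator (ball 0 1 - {0}) x * f (sgn x))"
    by (subst integral_restrict_space) auto
  finally show ?thesis .
qed

section \<open>The divergence theorem on the sphere\<close>

text \<open>Each difference quotient along \<open>b\<close> has integral 0, and the mean value
  theorem bounds all of them by the maximum of the derivative, so the limit passes under the
  integral. One continuous derivative suffices, which is why the cutoff below need not be
  smooth.\<close>

lemma integral_directional_derivative_eq_0: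
  fixes F :: "'a::euclidean_space \<Rightarrow> real"
  assumes D: "\<And>x. (F has_derivative F' x) (at x)"
    and cont: "continuous_on UNIV (\<lambda>x. F' x b)"
    and supp: "\<And>x. R \<le> norm x \<Longrightarrow> F x = 0"
  shows "integrable lborel (\<lambda>x. F' x b)" "(LINT x|lborel. F' x b) = 0"
proof -
  have F'0: "F' x b = 0" if "R < norm x" for x
  proof -
    have "open {x::'a. R < norm x}"
      by (intro open_Collect_less continuous_intros)
    then have "((\<lambda>_. 0) has_derivative F' x) (at x)"
      using that supp by (intro has_derivative_transform_within_open[OF D, of "{x. R < norm x}"]) auto
    then have "F' x = (\<lambda>_. 0)"
      using has_derivative_unique has_derivative_const by blast
    then show ?thesis by simp
  qed
  have "bounded ((\<lambda>x. F' x b) ` cball 0 R)"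
    by (intro compact_imp_bounded compact_continuous_image continuous_on_subset[OF cont]) auto
  then obtain M where M: "M > 0" "\<And>x. x \<in> cball 0 R \<Longrightarrow> \<bar>F' x b\<bar> \<le> M"
    unfolding bounded_pos by auto
  have bd: "\<bar>F' x b\<bar> \<le> M" for x
    using M F'0[of x] by (cases "R < norm x") auto
  have compact_int: "integrable lborel g" if g: "continuous_on UNIV g" "\<And>x. R < norm x \<Longrightarrow> g x = 0"
    for g :: "'a \<Rightarrow> real"
  proof -
    have "integrable lborel (\<lambda>x. indicator (cball 0 R) x *\<^sub>R g x)"
      by (intro borel_integrable_compact continuous_on_subset[OF g(1)]) auto
    moreover have "(\<lambda>x. indicator (cball 0 R) x *\<^sub>R g x) = g"
      using g(2) by (auto simp: indicator_def fun_eq_iff)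
    ultimately show ?thesis by simp
  qed
  have contF: "continuous_on UNIV F"
    using D has_derivative_continuous by (blast intro: continuous_at_imp_continuous_on)
  have intF: "integrable lborel F"
    using supp by (intro compact_int contF) auto
  show int: "integrable lborel (\<lambda>x. F' x b)"
    using F'0 by (intro compact_int cont) auto
  define q where "q n x = real (Suc n) * (F (inverse (real (Suc n)) *\<^sub>R b + x) - F x)" for n x
  have line: "((\<lambda>t. F (t *\<^sub>R b + x)) has_real_derivative F' (t *\<^sub>R b + x) b) (at t)" for t x
  proof -
    have "((\<lambda>t. F (t *\<^sub>R b + x)) has_derivative (\<lambda>s. F' (t *\<^sub>R b + x) (s *\<^sub>R b))) (at t)"
      by (rule has_derivative_compose[OF _ D]) (auto intro!: derivative_eq_intros)
    moreover have "F' (t *\<^sub>R b + x) (s *\<^sub>R b) = F' (t *\<^sub>R b + x) b * s" for s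
      using linear_cmul[OF has_derivative_linear[OF D]] by simp
    ultimately show ?thesis
      by (simp add: has_field_derivative_def)
  qed
  have tr: "integrable lborel (\<lambda>x. F (c + x)) \<and> (LINT x|lborel. F (c + x)) = (LINT x|lborel. F x)" for c
  proof -
    have "integrable (distr lborel borel ((+) c)) F" "(LINT x|distr lborel borel ((+) c). F x) = (LINT x|lborel. F x)"
      using intF by (simp_all add: lborel_distr_plus)
    then show ?thesis
      using contF by (simp add: integrable_distr_eq integral_distr borel_measurable_continuous_onI)
  qed
  have q0: "(LINT x|lborel. q n x) = 0" for n
    unfolding q_def using tr intF by simp
  have lim: "(\<lambda>n. q n x) \<longlonglongrightarrow> F' x b" for x
  proof -
    have "((\<lambda>h. (F (h *\<^sub>R b + x) - F x) / h) \<longlongrightarrow> F' x b) (at 0)"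
      using line[of x 0] by (simp add: has_field_derivative_iff)
    moreover have "filterlim (\<lambda>n. inverse (real (Suc n))) (at 0) sequentially"
      using LIMSEQ_inverse_real_of_nat by (auto simp: filterlim_at)
    ultimately have "(\<lambda>n. (F (inverse (real (Suc n)) *\<^sub>R b + x) - F x) / inverse (real (Suc n))) \<longlonglongrightarrow> F' x b"
      by (rule filterlim_compose)
    then show ?thesis
      by (simp add: q_def divide_inverse mult.commute)
  qed
  have qM: "\<bar>q n x\<bar> \<le> M" for n x
  proof -
    have "\<exists>\<xi>>0. \<xi> < inverse (real (Suc n)) \<and> F (inverse (real (Suc n)) *\<^sub>R b + x) - F (0 *\<^sub>R b + x)
        = (inverse (real (Suc n)) - 0) * F' (\<xi> *\<^sub>R b + x) b"
      by (rule MVT2) (use line in auto)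
    then obtain \<xi> where "F (inverse (real (Suc n)) *\<^sub>R b + x) - F x = inverse (real (Suc n)) * F' (\<xi> *\<^sub>R b + x) b"
      by auto
    then have "q n x = F' (\<xi> *\<^sub>R b + x) b"
      by (simp add: q_def field_simps)
    then show ?thesis using bd by simp
  qed
  \<comment> \<open>The translations have length at most \<open>norm b\<close>, so all quotients
    live in one ball and share an integrable bound.\<close>
  have q_out: "q n x = 0" if "R + norm b < norm x" for n x
  proof -
    have "norm (inverse (real (Suc n)) *\<^sub>R b) \<le> 1 * norm b"
      unfolding norm_scaleR by (intro mult_right_mono) (auto simp: field_simps)
    then have "R \<le> norm (inverse (real (Suc n)) *\<^sub>R b + x)"
      using that norm_diff_ineq[of x "inverse (real (Suc n)) *\<^sub>R b"] by (simp add: add.commute)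
    moreover have "R \<le> norm x" using that norm_ge_zero[of b] by linarith
    ultimately show ?thesis using supp by (simp add: q_def)
  qed
  have "(\<lambda>n. LINT x|lborel. q n x) \<longlonglongrightarrow> (LINT x|lborel. F' x b)"
  proof (rule integral_dominated_convergence[where w = "\<lambda>x. indicator (cball 0 (R + norm b)) x *\<^sub>R M"])
    show "integrable lborel (\<lambda>x. indicator (cball 0 (R + norm b)) x *\<^sub>R M)"
      by (intro borel_integrable_compact) auto
    show "q n \<in> borel_measurable lborel" for n
      using tr intF unfolding q_def by (intro borel_measurable_times borel_measurable_diff) auto
    show "AE x in lborel. norm (q n x) \<le> indicator (cball 0 (R + norm b)) x *\<^sub>R M" for n
      using qM q_out by (intro AE_I2) (auto simp: indicator_def)
  qed (use int lim in auto)
  then show "(LINT x|lborel. F' x b) = 0"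
    unfolding q0 using LIMSEQ_unique tendsto_const by blast
qed

text \<open>A C^1 transition from 0 on the negative half-line to the limit 1 at infinity. The value
  1 is never attained, but the arguments used later are multiplied by \<open>k\<close>, and only the
  limit in \<open>k\<close> matters.\<close>

definition cutoff :: "real \<Rightarrow> real" where
  "cutoff s = (max 0 s)\<^sup>2 / (1 + (max 0 s)\<^sup>2)"

definition cutoff' :: "real \<Rightarrow> real" where
  "cutoff' s = 2 * max 0 s / (1 + (max 0 s)\<^sup>2)\<^sup>2"

lemma has_derivative_max_0_square:
  "((\<lambda>s. (max 0 s)\<^sup>2) has_real_derivative 2 * max 0 s) (at (s::real))"
proof (cases s "0::real" rule: linorder_cases)
  case less
  have "((\<lambda>s. (max 0 s)\<^sup>2) has_real_derivative 0) (at s)"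
    by (rule has_field_derivative_transform_within_open[where f = "\<lambda>_. 0" and S = "{..<0}"])
      (use less in auto)
  then show ?thesis using less by simp
next
  case greater
  have "((\<lambda>s. (max 0 s)\<^sup>2) has_real_derivative 2 * s) (at s)"
    by (rule has_field_derivative_transform_within_open[where f = "\<lambda>s. s\<^sup>2" and S = "{0<..}"])
      (use greater in \<open>auto intro!: derivative_eq_intros\<close>)
  then show ?thesis using greater by simp
next
  case equal
  have "((\<lambda>h::real. (max 0 h)\<^sup>2 / h) \<longlongrightarrow> 0) (at 0)"
  proof (rule tendsto_rabs_zero_cancel, rule tendsto_sandwich[where f = "\<lambda>_. 0" and h = abs])
    have "\<bar>(max 0 h)\<^sup>2 / h\<bar> \<le> \<bar>h\<bar>" for h :: real
      by (auto simp: max_def power2_eq_square)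
    then show "\<forall>\<^sub>F h in at (0::real). \<bar>(max 0 h)\<^sup>2 / h\<bar> \<le> \<bar>h\<bar>" by simp
    show "((abs :: real \<Rightarrow> real) \<longlongrightarrow> 0) (at 0)"
      by (rule tendsto_eq_intros refl)+ simp
  qed auto
  then show ?thesis using equal by (simp add: has_field_derivative_iff)
qed

lemma cutoff_has_derivative: "(cutoff has_real_derivative cutoff' s) (at s)"
proof -
  have nz: "1 + (max 0 s)\<^sup>2 \<noteq> 0"
    by (metis add_pos_nonneg less_irrefl zero_le_power2 zero_less_one)
  show ?thesis
    unfolding cutoff_def[abs_def] cutoff'_def
    by (rule derivative_eq_intros has_derivative_max_0_square nz refl)+
      (simp add: power2_eq_square algebra_simps)
qed

lemma continuous_on_cutoff: "continuous_on S cutoff" and continuous_on_cutoff': "continuous_on S cutoff'"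
proof -
  have nz: "1 + (max 0 s)\<^sup>2 \<noteq> 0" for s :: real
    by (metis add_pos_nonneg less_irrefl zero_le_power2 zero_less_one)
  show "continuous_on S cutoff" "continuous_on S cutoff'"
    unfolding cutoff_def[abs_def] cutoff'_def[abs_def] by (intro continuous_intros; use nz in simp)+
qed

lemma cutoff_nonpos: "s \<le> 0 \<Longrightarrow> cutoff s = 0" "s \<le> 0 \<Longrightarrow> cutoff' s = 0"
  by (simp_all add: cutoff_def cutoff'_def)

lemma cutoff_bounds: "0 \<le> cutoff s" "cutoff s \<le> 1"
  by (simp_all add: cutoff_def divide_le_eq add_pos_nonneg)

lemma cutoff_at_top: "(cutoff \<longlongrightarrow> 1) at_top"
proof -
  have "((\<lambda>s::real. 1 - 1 / (1 + s\<^sup>2)) \<longlongrightarrow> 1 - 0) at_top"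
    by (intro tendsto_intros tendsto_divide_0[OF tendsto_const] filterlim_at_top_imp_at_infinity
        filterlim_tendsto_add_at_top[OF tendsto_const] filterlim_pow_at_top filterlim_ident) auto
  moreover have "eventually (\<lambda>s::real. 1 - 1 / (1 + s\<^sup>2) = cutoff s) at_top"
    using eventually_gt_at_top[of 0]
  proof eventually_elim
    case (elim s)
    have "1 + s\<^sup>2 \<noteq> 0" by (metis add_pos_nonneg less_irrefl zero_le_power2 zero_less_one)
    then show ?case using elim by (simp add: cutoff_def field_simps)
  qed
  ultimately show ?thesis using tendsto_cong by fastforce
qed

section \<open>Calculus of functions that are constant along rays\<close>

lemma radial_ext_on_sphere: "x \<in> sphere 0 1 \<Longrightarrow> radial_ext f x = f x"
  by (simp add: radial_ext_def sgn_div_norm)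

lemma radial_ext_scaleR: "c > 0 \<Longrightarrow> radial_ext f (c *\<^sub>R x) = radial_ext f x"
  by (simp add: radial_ext_def sgn_scaleR)

lemma smooth_sphere_imp_continuous: "smooth_sphere f \<Longrightarrow> continuous_on (sphere 0 1) f"
proof -
  assume "smooth_sphere f"
  then have "continuous_on (sphere 0 1) (radial_ext f)"
    unfolding smooth_sphere_def
    by (rule continuous_on_subset[OF smooth_on_imp_continuous_on]) auto
  then show ?thesis
    by (rule continuous_on_eq) (simp add: radial_ext_on_sphere)
qed

lemma smooth_sphere_has_derivative:
  "smooth_sphere f \<Longrightarrow> x \<noteq> 0 \<Longrightarrow>
    (radial_ext f has_derivative frechet_derivative (radial_ext f) (at x)) (at x)"
  unfolding smooth_sphere_def by (rule smooth_on_has_derivative) auto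

text \<open>Homogeneity of degree 0 makes the derivative homogeneous of degree -1: apply the chain
  rule to scaling by \<open>norm x\<close>.\<close>

lemma frechet_derivative_radial_ext_sgn:
  assumes "smooth_sphere f" "x \<noteq> 0"
  shows "frechet_derivative (radial_ext f) (at (sgn x)) b
    = norm x * frechet_derivative (radial_ext f) (at x) b"
proof -
  let ?D = "frechet_derivative (radial_ext f) (at x)"
  have D: "(radial_ext f has_derivative ?D) (at (norm x *\<^sub>R sgn x))"
    using smooth_sphere_has_derivative[OF assms] assms(2) by (simp add: sgn_div_norm)
  have "((\<lambda>y. radial_ext f (norm x *\<^sub>R y)) has_derivative (\<lambda>b. ?D (norm x *\<^sub>R b))) (at (sgn x))"
    by (rule has_derivative_compose[where f = "\<lambda>y. norm x *\<^sub>R y", OF _ D])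
      (auto intro!: derivative_eq_intros)
  then have "(radial_ext f has_derivative (\<lambda>b. ?D (norm x *\<^sub>R b))) (at (sgn x))"
    using assms(2) by (simp add: radial_ext_scaleR)
  then have "frechet_derivative (radial_ext f) (at (sgn x)) = (\<lambda>b. ?D (norm x *\<^sub>R b))"
    by (rule frechet_derivative_at[symmetric])
  then show ?thesis
    using linear_cmul[OF has_derivative_linear[OF D]] by simp
qed

text \<open>Euler's identity in degree 0: the extension is constant on the ray through
  \<open>x\<close>.\<close>

lemma frechet_derivative_radial_ext_self:
  assumes "smooth_sphere f" "x \<noteq> 0"
  shows "frechet_derivative (radial_ext f) (at x) x = 0"
proof -
  let ?D = "frechet_derivative (radial_ext f) (at x)"
  have D: "(radial_ext f has_derivative ?D) (at (1 *\<^sub>R x))"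
    using smooth_sphere_has_derivative[OF assms] by simp
  have "((\<lambda>t. radial_ext f (t *\<^sub>R x)) has_derivative (\<lambda>s. ?D (s *\<^sub>R x))) (at (1::real))"
    by (rule has_derivative_compose[where f = "\<lambda>t. t *\<^sub>R x", OF _ D])
      (auto intro!: derivative_eq_intros)
  moreover have "((\<lambda>t. radial_ext f (t *\<^sub>R x)) has_derivative (\<lambda>s. 0)) (at (1::real))"
    by (rule has_derivative_transform_within_open[OF has_derivative_const[of "radial_ext f x"],
          where s = "{0<..}"]) (auto simp: radial_ext_scaleR)
  ultimately have "(\<lambda>s. ?D (s *\<^sub>R x)) = (\<lambda>s. 0)"
    using has_derivative_unique by blast
  then show ?thesis by (metis scaleR_one)
qed

lemma smooth_field_has_derivative:
  fixes V :: "'a::euclidean_space \<Rightarrow> 'a"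
  assumes "\<And>b. b \<in> Basis \<Longrightarrow> smooth_sphere (\<lambda>x. V x \<bullet> b)" "x \<noteq> 0"
  shows "(radial_ext V has_derivative frechet_derivative (radial_ext V) (at x)) (at x)"
proof -
  have "radial_ext V differentiable (at x)"
  proof (rule iffD2[OF differentiable_componentwise_within], rule ballI)
    fix b :: 'a assume "b \<in> Basis"
    then have "radial_ext (\<lambda>x. V x \<bullet> b) differentiable (at x)"
      using smooth_sphere_has_derivative[OF assms(1) assms(2)] by (blast intro: differentiableI)
    then show "(\<lambda>x. radial_ext V x \<bullet> b) differentiable (at x)"
      by (simp add: radial_ext_def)
  qed
  then show ?thesis by (rule iffD1[OF frechet_derivative_works])
qed

text \<open>\<open>sphere_div\<close> differentiates a vector-valued extension at points of the
  sphere. The present form has scalar components and an arbitrary base point, so it yields both the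
  smoothness of the divergence and its link to the ambient divergence.\<close>

lemma sphere_div_sgn:
  fixes V :: "'a::euclidean_space \<Rightarrow> 'a"
  assumes V: "\<And>b. b \<in> Basis \<Longrightarrow> smooth_sphere (\<lambda>x. V x \<bullet> b)" and "x \<noteq> 0"
  shows "sphere_div V (sgn x) =
    norm x * (\<Sum>b\<in>Basis. frechet_derivative (radial_ext (\<lambda>x. V x \<bullet> b)) (at x) b)"
proof -
  have "sgn x \<noteq> 0" using \<open>x \<noteq> 0\<close> by (simp add: sgn_zero_iff)
  have "frechet_derivative (radial_ext V) (at (sgn x)) b \<bullet> b
     = norm x * frechet_derivative (radial_ext (\<lambda>x. V x \<bullet> b)) (at x) b" if "b \<in> Basis" for b
  proof -
    have "((\<lambda>x. radial_ext V x \<bullet> b) has_derivative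
        (\<lambda>h. frechet_derivative (radial_ext V) (at (sgn x)) h \<bullet> b)) (at (sgn x))"
      by (intro has_derivative_inner_left smooth_field_has_derivative V \<open>sgn x \<noteq> 0\<close>)
    then have "(\<lambda>h. frechet_derivative (radial_ext V) (at (sgn x)) h \<bullet> b)
        = frechet_derivative (\<lambda>x. radial_ext V x \<bullet> b) (at (sgn x))"
      by (rule frechet_derivative_at)
    moreover have "(\<lambda>x. radial_ext V x \<bullet> b) = radial_ext (\<lambda>x. V x \<bullet> b)"
      by (simp add: radial_ext_def)
    ultimately have "frechet_derivative (radial_ext V) (at (sgn x)) b \<bullet> b
        = frechet_derivative (radial_ext (\<lambda>x. V x \<bullet> b)) (at (sgn x)) b"
      by metis
    then show ?thesis
      using frechet_derivative_radial_ext_sgn[OF V[OF that] \<open>x \<noteq> 0\<close>] by simp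
  qed
  then show ?thesis
    by (simp add: sphere_div_def sum_distrib_left)
qed

lemma open_punctured [simp, intro]: "open (UNIV - {0::'a::euclidean_space})"
  by auto

lemma smooth_sphere_div:
  fixes V :: "'a::euclidean_space \<Rightarrow> 'a"
  assumes V: "\<And>b. b \<in> Basis \<Longrightarrow> smooth_sphere (\<lambda>x. V x \<bullet> b)"
  shows "smooth_sphere (sphere_div V)"
  unfolding smooth_sphere_def
proof (rule smooth_on_cong)
  show "smooth_on (\<lambda>x. norm x *
      (\<Sum>b\<in>Basis. frechet_derivative (radial_ext (\<lambda>x. V x \<bullet> b)) (at x) b)) (UNIV - {0::'a})"
    using V unfolding smooth_sphere_def
    by (intro smooth_on_mult smooth_on_norm smooth_on_sum smooth_on_frechet_derivative) auto
qed (use sphere_div_sgn[OF V] in \<open>auto simp: radial_ext_def\<close>)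

text \<open>Let \<open>X\<close> be the extension of \<open>V\<close> that is constant along rays, and let \<open>\<psi>\<close> be a radial cutoff. As
  \<open>X\<close> is orthogonal to the radial direction, \<open>div (\<psi> \<bar>x\<bar> X) = \<psi> \<bar>x\<bar> div X\<close>, and \<open>\<bar>x\<bar> div X\<close> is the extension of
  the divergence of \<open>V\<close>. So no polar coordinates are needed: \<open>\<psi>\<close> only has to tend to the indicator
  of the punctured ball, which defines the measure of the sphere.\<close>

theorem sphere_divergence_theorem:
  fixes V :: "'a::euclidean_space \<Rightarrow> 'a"
  assumes V: "\<And>b. b \<in> Basis \<Longrightarrow> smooth_sphere (\<lambda>x. V x \<bullet> b)"
    and tangent: "\<And>x. x \<in> sphere 0 1 \<Longrightarrow> V x \<bullet> x = 0"
  shows "(LINT x|sphere_measure. sphere_div V x) = 0"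
proof -
  define X where "X b = radial_ext (\<lambda>x. V x \<bullet> b)" for b
  define X' where "X' b x = frechet_derivative (X b) (at x)" for b x
  have X': "(X b has_derivative X' b x) (at x)" if "b \<in> Basis" "x \<noteq> 0" for b x
    unfolding X_def X'_def using smooth_sphere_has_derivative[OF V] that by auto
  have contX: "continuous_on (UNIV - {0}) (X b)"
    and contX': "continuous_on (UNIV - {0}) (\<lambda>x. X' b x b)" if "b \<in> Basis" for b
    using V[OF that] smooth_on_frechet_derivative[OF _ that]
    unfolding smooth_sphere_def X_def X'_def by (auto intro: smooth_on_imp_continuous_on)
  \<comment> \<open>Tangency in ambient form. It removes the derivative of the cutoff in
    \<open>sumF\<close>, because that derivative is radial.\<close>
  have radial: "(\<Sum>b\<in>Basis. (x \<bullet> b) * X b x) = 0" if "x \<noteq> 0" for x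
  proof -
    have "(\<Sum>b\<in>Basis. (x \<bullet> b) * X b x) = x \<bullet> V (sgn x)"
      by (subst euclidean_inner) (simp add: X_def radial_ext_def)
    also have "\<dots> = norm x * (V (sgn x) \<bullet> sgn x)"
      using that by (simp add: sgn_div_norm inner_commute)
    finally show ?thesis
      using tangent[of "sgn x"] that by (simp add: norm_sgn)
  qed
  have div: "norm x * (\<Sum>b\<in>Basis. X' b x b) = sphere_div V (sgn x)" if "x \<noteq> 0" for x
    using sphere_div_sgn[OF V that] by (simp add: X_def X'_def)
  have cdiv: "continuous_on (UNIV - {0}) (\<lambda>x. sphere_div V (sgn x))"
    using smooth_sphere_div[OF V] smooth_on_imp_continuous_on
    unfolding smooth_sphere_def radial_ext_def by blast
  obtain B where B: "B > 0" "\<And>x. x \<in> sphere 0 1 \<Longrightarrow> \<bar>sphere_div V x\<bar> \<le> B"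
    using bounded_on_sphere[OF smooth_sphere_imp_continuous[OF smooth_sphere_div[OF V]]] by metis
  \<comment> \<open>The first factor vanishes near the origin (for
    \<open>k * (x \<bullet> x) \<le> 1\<close>), the second outside the unit ball, and both tend to
    1 in between. Using \<open>x \<bullet> x\<close> instead of the norm keeps the formulas
    differentiable at the origin.\<close>
  define \<psi> where "\<psi> k x = cutoff (real k * (x \<bullet> x) - 1) * cutoff (real k * (1 - x \<bullet> x))" for k and x :: 'a
  \<comment> \<open>The gradient of \<open>\<psi> k x * norm x\<close> is \<open>e k x\<close> times
    \<open>x\<close>.\<close>
  define e where "e k x = norm x * (2 * real k * (cutoff' (real k * (x \<bullet> x) - 1) * cutoff (real k * (1 - x \<bullet> x))
      - cutoff (real k * (x \<bullet> x) - 1) * cutoff' (real k * (1 - x \<bullet> x)))) + \<psi> k x / norm x" for k and x :: 'a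
  have \<psi>_deriv: "((\<lambda>x. \<psi> k x * norm x) has_derivative (\<lambda>h. e k x * (x \<bullet> h))) (at x)"
    if "x \<noteq> 0" for k x
  proof -
    have c1: "((\<lambda>x. cutoff (real k * (x \<bullet> x) - 1)) has_derivative
        (\<lambda>h. real k * (x \<bullet> h + h \<bullet> x) * cutoff' (real k * (x \<bullet> x) - 1))) (at x)"
      by (rule DERIV_compose_FDERIV[OF cutoff_has_derivative]) (auto intro!: derivative_eq_intros)
    have c2: "((\<lambda>x. cutoff (real k * (1 - x \<bullet> x))) has_derivative
        (\<lambda>h. real k * - (x \<bullet> h + h \<bullet> x) * cutoff' (real k * (1 - x \<bullet> x)))) (at x)"
      by (rule DERIV_compose_FDERIV[OF cutoff_has_derivative]) (auto intro!: derivative_eq_intros)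
    show ?thesis
      unfolding \<psi>_def
      by (rule has_derivative_eq_rhs[OF has_derivative_mult[OF has_derivative_mult[OF c1 c2] has_derivative_norm[OF that]]])
        (use that in \<open>simp add: fun_eq_iff e_def \<psi>_def sgn_div_norm inner_commute field_simps\<close>)
  qed
  have \<psi>_vanish: "\<psi> k x = 0" "e k x = 0" if "real k * (x \<bullet> x) < 1" for k x
    using that by (auto simp: \<psi>_def e_def cutoff_nonpos)
  have \<psi>_outside: "\<psi> k x = 0" if "1 \<le> norm x" for k x
  proof -
    have "1 \<le> x \<bullet> x"
      using that power_mono[of 1 "norm x" 2] by (simp add: power2_norm_eq_inner)
    then have "real k * (1 - x \<bullet> x) \<le> 0" by (simp add: mult_le_0_iff)
    then show ?thesis by (simp add: \<psi>_def cutoff_nonpos)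
  qed
  have \<psi>_bound: "0 \<le> \<psi> k x" "\<psi> k x \<le> 1" for k x
    using cutoff_bounds by (auto simp: \<psi>_def intro!: mult_le_one)
  define F where "F k b x = \<psi> k x * norm x * X b x" for k b x
  \<comment> \<open>At the origin the extension has no meaningful derivative, but
    \<open>\<psi> k\<close> vanishes in a neighbourhood, so 0 is the true derivative of
    \<open>F k b\<close> there.\<close>
  define F' where "F' k b x h = (if x = 0 then 0
      else \<psi> k x * norm x * X' b x h + e k x * (x \<bullet> h) * X b x)" for k b x h
  have openU: "open {x::'a. real k * (x \<bullet> x) < 1}" for k
    by (intro open_Collect_less continuous_intros)
  have F_deriv: "(F k b has_derivative F' k b x) (at x)" if "b \<in> Basis" for k b x
  proof (cases "x = 0")
    case True
    have "F' k b x = (\<lambda>h. 0)" using True by (simp add: F'_def fun_eq_iff)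
    then show ?thesis
      using True \<psi>_vanish
      by (auto simp: F_def intro!: has_derivative_transform_within_open[OF has_derivative_const openU[of k]])
  next
    case False
    show ?thesis
      unfolding F_def
      by (rule has_derivative_eq_rhs[OF has_derivative_mult[OF \<psi>_deriv[OF False] X'[OF that False]]])
        (use False in \<open>simp add: F'_def fun_eq_iff\<close>)
  qed
  have F'_cont: "continuous_on UNIV (\<lambda>x. F' k b x b)" if b: "b \<in> Basis" for k b
  proof -
    have "continuous_on {x. real k * (x \<bullet> x) < 1} (\<lambda>x. F' k b x b)"
      by (rule continuous_on_eq[OF continuous_on_const[of _ 0]]) (auto simp: F'_def \<psi>_vanish)
    moreover have "continuous_on (UNIV - {0}) (\<lambda>x. F' k b x b)"
    proof (rule continuous_on_eq)
      show "continuous_on (UNIV - {0}) (\<lambda>x. \<psi> k x * norm x * X' b x b + e k x * (x \<bullet> b) * X b x)"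
        unfolding \<psi>_def e_def
        by (intro continuous_intros contX contX' b continuous_on_compose2[OF continuous_on_cutoff]
            continuous_on_compose2[OF continuous_on_cutoff']) auto
    qed (auto simp: F'_def)
    ultimately have "continuous_on ({x. real k * (x \<bullet> x) < 1} \<union> (UNIV - {0})) (\<lambda>x. F' k b x b)"
      by (intro continuous_on_open_Un openU) auto
    moreover have "{x. real k * (x \<bullet> x) < 1} \<union> (UNIV - {0}) = (UNIV :: 'a set)" by auto
    ultimately show ?thesis by simp
  qed
  have F_supp: "F k b x = 0" if "1 \<le> norm x" for k b x
    using \<psi>_outside[OF that] by (simp add: F_def)
  have sumF: "(\<Sum>b\<in>Basis. F' k b x b) = \<psi> k x * sphere_div V (sgn x)" for k x
  proof (cases "x = 0")
    case False
    then have "(\<Sum>b\<in>Basis. F' k b x b)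
        = \<psi> k x * (norm x * (\<Sum>b\<in>Basis. X' b x b)) + e k x * (\<Sum>b\<in>Basis. (x \<bullet> b) * X b x)"
      by (simp add: F'_def sum.distrib sum_distrib_left mult_ac)
    then show ?thesis using div[OF False] radial[OF False] by simp
  qed (auto simp: F'_def \<psi>_vanish)
  have int: "integrable lborel (\<lambda>x. \<psi> k x * sphere_div V (sgn x))"
    and zero: "(LINT x|lborel. \<psi> k x * sphere_div V (sgn x)) = 0" for k
    using integral_directional_derivative_eq_0[OF F_deriv F'_cont F_supp]
    unfolding sumF[symmetric] by (auto simp: Bochner_Integration.integral_sum)
  let ?lim = "\<lambda>x::'a. indicator (ball 0 1 - {0}) x * sphere_div V (sgn x)"
  have \<psi>_lim: "(\<lambda>k. \<psi> k x) \<longlonglongrightarrow> indicator (ball 0 1 - {0}) x" for x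
  proof -
    consider "x = 0" | "1 \<le> norm x" | "x \<noteq> 0" "norm x < 1" by linarith
    then show ?thesis
    proof cases
      case 3
      have "norm x * norm x < 1 * 1" using 3 by (intro mult_strict_mono) auto
      then have lt: "x \<bullet> x < 1" by (simp add: dot_square_norm power2_eq_square)
      have "filterlim (\<lambda>k. -1 + (x \<bullet> x) * real k) at_top sequentially"
        by (intro filterlim_tendsto_add_at_top[OF tendsto_const]
            filterlim_tendsto_pos_mult_at_top[OF tendsto_const] filterlim_real_sequentially) (use 3 in auto)
      then have f1: "filterlim (\<lambda>k. real k * (x \<bullet> x) - 1) at_top sequentially"
        by (simp add: mult.commute)
      have "filterlim (\<lambda>k. (1 - x \<bullet> x) * real k) at_top sequentially"
        by (intro filterlim_tendsto_pos_mult_at_top[OF tendsto_const] filterlim_real_sequentially) (use lt in auto)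
      then have f2: "filterlim (\<lambda>k. real k * (1 - x \<bullet> x)) at_top sequentially"
        by (simp add: mult.commute)
      have "(\<lambda>k. \<psi> k x) \<longlonglongrightarrow> 1 * 1"
        unfolding \<psi>_def by (intro tendsto_mult filterlim_compose[OF cutoff_at_top] f1 f2)
      then show ?thesis using 3 by simp
    qed (auto simp: \<psi>_vanish \<psi>_outside)
  qed
  have "(\<lambda>k. LINT x|lborel. \<psi> k x * sphere_div V (sgn x)) \<longlonglongrightarrow> (LINT x|lborel. ?lim x)"
  proof (rule integral_dominated_convergence[where w = "\<lambda>x. indicator (cball 0 1) x *\<^sub>R B"])
    show "integrable lborel (\<lambda>x::'a. indicator (cball 0 1) x *\<^sub>R B)"
      by (intro borel_integrable_compact) auto
    have "(\<lambda>x. indicator (ball 0 1 - {0}) x *\<^sub>R sphere_div V (sgn x)) \<in> borel_measurable borel"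
      by (intro borel_measurable_continuous_on_indicator continuous_on_subset[OF cdiv]) auto
    then show "?lim \<in> borel_measurable lborel" by simp
    show "AE x in lborel. norm (\<psi> k x * sphere_div V (sgn x)) \<le> indicator (cball 0 1) x *\<^sub>R B" for k
    proof (intro AE_I2)
      fix x :: 'a
      consider "x = 0" | "1 < norm x" | "x \<noteq> 0" "norm x \<le> 1" by linarith
      then show "norm (\<psi> k x * sphere_div V (sgn x)) \<le> indicator (cball 0 1) x *\<^sub>R B"
      proof cases
        case 3
        have "\<bar>\<psi> k x\<bar> * \<bar>sphere_div V (sgn x)\<bar> \<le> 1 * B"
          using \<psi>_bound[of k x] B 3 by (intro mult_mono) (auto simp: norm_sgn)
        then show ?thesis using 3 by (simp add: abs_mult)
      qed (use B in \<open>auto simp: \<psi>_vanish \<psi>_outside\<close>)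
    qed
  qed (use int \<psi>_lim in \<open>auto intro!: tendsto_mult_right\<close>)
  then have "(LINT x|lborel. ?lim x) = 0"
    unfolding zero using LIMSEQ_unique tendsto_const by blast
  then show ?thesis
    by (subst integral_sphere) (auto intro!: continuous_measurable_sphere
        smooth_sphere_imp_continuous smooth_sphere_div V)
qed

section \<open>Green's formula and the symmetry of the Laplacian\<close>

lemma sphere_grad_inner: "b \<in> Basis \<Longrightarrow> sphere_grad f x \<bullet> b = frechet_derivative (radial_ext f) (at x) b"
  by (simp add: sphere_grad_def inner_sum_left_Basis)

lemma smooth_sphere_grad:
  assumes f: "smooth_sphere f" and "b \<in> Basis"
  shows "smooth_sphere (\<lambda>x. sphere_grad f x \<bullet> b)"
  unfolding smooth_sphere_def
proof (rule smooth_on_cong)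
  show "smooth_on (\<lambda>x. norm x * frechet_derivative (radial_ext f) (at x) b) (UNIV - {0})"
    using assms unfolding smooth_sphere_def
    by (intro smooth_on_mult smooth_on_norm smooth_on_frechet_derivative) auto
  show "norm x * frechet_derivative (radial_ext f) (at x) b = radial_ext (\<lambda>x. sphere_grad f x \<bullet> b) x"
    if "x \<in> UNIV - {0}" for x
    using that \<open>b \<in> Basis\<close> frechet_derivative_radial_ext_sgn[OF f, of x b]
    by (simp add: radial_ext_def[of "\<lambda>x. sphere_grad f x \<bullet> b"] sphere_grad_inner[symmetric])
qed auto

lemma sphere_grad_tangent:
  assumes f: "smooth_sphere f" and "x \<noteq> 0"
  shows "sphere_grad f x \<bullet> x = 0"
proof -
  let ?D = "frechet_derivative (radial_ext f) (at x)"
  have lin: "linear ?D"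
    using has_derivative_linear[OF smooth_sphere_has_derivative[OF assms]] .
  have "sphere_grad f x \<bullet> x = (\<Sum>b\<in>Basis. (x \<bullet> b) * ?D b)"
    by (subst euclidean_inner) (simp add: sphere_grad_inner mult.commute)
  also have "\<dots> = ?D (\<Sum>b\<in>Basis. (x \<bullet> b) *\<^sub>R b)"
    using lin by (simp add: linear_sum linear_cmul)
  also have "\<dots> = 0"
    using frechet_derivative_radial_ext_self[OF assms] by (simp add: euclidean_representation)
  finally show ?thesis .
qed

lemma smooth_sphere_laplacian: "smooth_sphere f \<Longrightarrow> smooth_sphere (sphere_laplacian f)"
  unfolding sphere_laplacian_def by (intro smooth_sphere_div smooth_sphere_grad)

lemma smooth_sphere_mult: "smooth_sphere f \<Longrightarrow> smooth_sphere g \<Longrightarrow> smooth_sphere (\<lambda>x. f x * g x)"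
  using smooth_on_mult[OF open_punctured] by (simp add: smooth_sphere_def radial_ext_def)

lemma sphere_div_scaleR_grad:
  assumes f: "smooth_sphere f" and g: "smooth_sphere g" and x: "x \<in> sphere 0 1"
  shows "sphere_div (\<lambda>x. f x *\<^sub>R sphere_grad g x) x
    = f x * sphere_laplacian g x + sphere_grad f x \<bullet> sphere_grad g x"
proof -
  have x0: "x \<noteq> 0" "sgn x = x" "norm x = 1" using x by (auto simp: sgn_div_norm)
  have V: "smooth_sphere (\<lambda>x. (f x *\<^sub>R sphere_grad g x) \<bullet> b)" if "b \<in> Basis" for b
    using smooth_sphere_mult[OF f smooth_sphere_grad[OF g that]] by simp
  have "frechet_derivative (radial_ext (\<lambda>x. (f x *\<^sub>R sphere_grad g x) \<bullet> b)) (at x) b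
     = f x * frechet_derivative (radial_ext (\<lambda>x. sphere_grad g x \<bullet> b)) (at x) b
       + (sphere_grad f x \<bullet> b) * (sphere_grad g x \<bullet> b)" if b: "b \<in> Basis" for b
  proof -
    have "((\<lambda>x. radial_ext f x * radial_ext (\<lambda>x. sphere_grad g x \<bullet> b) x) has_derivative
       (\<lambda>h. radial_ext f x * frechet_derivative (radial_ext (\<lambda>x. sphere_grad g x \<bullet> b)) (at x) h
         + frechet_derivative (radial_ext f) (at x) h * radial_ext (\<lambda>x. sphere_grad g x \<bullet> b) x)) (at x)"
      by (intro has_derivative_mult smooth_sphere_has_derivative f smooth_sphere_grad g b x0)
    then have "(radial_ext (\<lambda>x. (f x *\<^sub>R sphere_grad g x) \<bullet> b) has_derivative
       (\<lambda>h. radial_ext f x * frechet_derivative (radial_ext (\<lambda>x. sphere_grad g x \<bullet> b)) (at x) h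
         + frechet_derivative (radial_ext f) (at x) h * radial_ext (\<lambda>x. sphere_grad g x \<bullet> b) x)) (at x)"
      by (simp add: radial_ext_def)
    from frechet_derivative_at[OF this, symmetric]
    have "frechet_derivative (radial_ext (\<lambda>x. (f x *\<^sub>R sphere_grad g x) \<bullet> b)) (at x) b =
       radial_ext f x * frechet_derivative (radial_ext (\<lambda>x. sphere_grad g x \<bullet> b)) (at x) b
         + frechet_derivative (radial_ext f) (at x) b * radial_ext (\<lambda>x. sphere_grad g x \<bullet> b) x"
      by (rule fun_cong)
    then show ?thesis
      using x b by (simp add: radial_ext_on_sphere sphere_grad_inner)
  qed
  then have "sphere_div (\<lambda>x. f x *\<^sub>R sphere_grad g x) x
     = f x * (\<Sum>b\<in>Basis. frechet_derivative (radial_ext (\<lambda>x. sphere_grad g x \<bullet> b)) (at x) b)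
       + (\<Sum>b\<in>Basis. (sphere_grad f x \<bullet> b) * (sphere_grad g x \<bullet> b))"
    using sphere_div_sgn[OF V x0(1)] x0 by (simp add: sum.distrib sum_distrib_left)
  also have "\<dots> = f x * sphere_laplacian g x + sphere_grad f x \<bullet> sphere_grad g x"
    using sphere_div_sgn[of "sphere_grad g" x, OF smooth_sphere_grad[OF g] x0(1)] x0
    by (simp add: sphere_laplacian_def euclidean_inner[symmetric])
  finally show ?thesis .
qed

lemma continuous_sphere_grad_inner:
  assumes "smooth_sphere f" "smooth_sphere g"
  shows "continuous_on (sphere 0 1) (\<lambda>x. sphere_grad f x \<bullet> sphere_grad g x)"
proof -
  have "continuous_on (sphere 0 1)
      (\<lambda>x. \<Sum>b\<in>Basis. (sphere_grad f x \<bullet> b) * (sphere_grad g x \<bullet> b))"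
    by (intro continuous_on_sum continuous_on_mult smooth_sphere_imp_continuous smooth_sphere_grad assms)
  then show ?thesis
    by (simp add: euclidean_inner[symmetric])
qed

theorem green_sphere:
  fixes f g :: "'a::euclidean_space \<Rightarrow> real"
  assumes f: "smooth_sphere f" and g: "smooth_sphere g"
  shows "l2_inner f (sphere_laplacian g) = - (LINT x|sphere_measure. sphere_grad f x \<bullet> sphere_grad g x)"
proof -
  let ?V = "\<lambda>x. f x *\<^sub>R sphere_grad g x"
  have V: "smooth_sphere (\<lambda>x. ?V x \<bullet> b)" if "b \<in> Basis" for b
    using smooth_sphere_mult[OF f smooth_sphere_grad[OF g that]] by simp
  have "0 = (LINT x|sphere_measure. sphere_div ?V x)"
  proof (rule sphere_divergence_theorem[symmetric, OF V])
    fix x :: 'a assume "x \<in> sphere 0 1"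
    then have "x \<noteq> 0" by auto
    then show "f x *\<^sub>R sphere_grad g x \<bullet> x = 0"
      using sphere_grad_tangent[OF g] by simp
  qed
  also have "\<dots> = (LINT x|sphere_measure. f x * sphere_laplacian g x + sphere_grad f x \<bullet> sphere_grad g x)"
    by (intro Bochner_Integration.integral_cong refl sphere_div_scaleR_grad f g) simp
  also have "\<dots> = l2_inner f (sphere_laplacian g) + (LINT x|sphere_measure. sphere_grad f x \<bullet> sphere_grad g x)"
    unfolding l2_inner_def
    by (intro Bochner_Integration.integral_add integrable_sphere continuous_on_mult continuous_sphere_grad_inner f g
        smooth_sphere_imp_continuous smooth_sphere_laplacian)
  finally show ?thesis by simp
qed

lemma l2_inner_commute: "l2_inner f g = l2_inner g f"
  by (simp add: l2_inner_def mult.commute)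

lemma l2_inner_laplacian_commute:
  "smooth_sphere f \<Longrightarrow> smooth_sphere g \<Longrightarrow> l2_inner f (sphere_laplacian g) = l2_inner (sphere_laplacian f) g"
  by (subst (2) l2_inner_commute) (simp add: green_sphere inner_commute)

section \<open>Eigenfunction expansions\<close>

lemma integrable_sphere_mult:
  fixes f g :: "'a::euclidean_space \<Rightarrow> real"
  shows "continuous_on (sphere 0 1) f \<Longrightarrow> continuous_on (sphere 0 1) g \<Longrightarrow>
    integrable sphere_measure (\<lambda>x. f x * g x)"
  by (intro integrable_sphere continuous_on_mult)

lemma l2_inner_cong:
  "(\<And>x. x \<in> sphere 0 1 \<Longrightarrow> f x = f' x) \<Longrightarrow> (\<And>x. x \<in> sphere 0 1 \<Longrightarrow> g x = g' x) \<Longrightarrow>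
    l2_inner f g = l2_inner f' g'"
  unfolding l2_inner_def by (intro Bochner_Integration.integral_cong) auto

lemma l2_inner_add_left:
  assumes "continuous_on (sphere 0 1) f" "continuous_on (sphere 0 1) g" "continuous_on (sphere 0 1) h"
  shows "l2_inner (\<lambda>x. f x + g x) h = l2_inner f h + l2_inner g h"
  using integrable_sphere_mult[OF assms(1,3)] integrable_sphere_mult[OF assms(2,3)]
  by (simp add: l2_inner_def distrib_right)

lemma l2_inner_diff_left:
  assumes "continuous_on (sphere 0 1) f" "continuous_on (sphere 0 1) g" "continuous_on (sphere 0 1) h"
  shows "l2_inner (\<lambda>x. f x - g x) h = l2_inner f h - l2_inner g h"
  using integrable_sphere_mult[OF assms(1,3)] integrable_sphere_mult[OF assms(2,3)]
  by (simp add: l2_inner_def left_diff_distrib)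

lemma l2_inner_cmult_left: "l2_inner (\<lambda>x. c * f x) h = c * l2_inner f h"
  by (simp add: l2_inner_def mult.assoc)

lemma l2_inner_sum_left:
  assumes "\<And>i. i \<in> I \<Longrightarrow> continuous_on (sphere 0 1) (f i)" "continuous_on (sphere 0 1) h"
  shows "l2_inner (\<lambda>x. \<Sum>i\<in>I. f i x) h = (\<Sum>i\<in>I. l2_inner (f i) h)"
  using integrable_sphere_mult[OF assms(1) assms(2)]
  by (simp add: l2_inner_def sum_distrib_right Bochner_Integration.integral_sum)

lemma l2_inner_self_nonneg: "0 \<le> l2_inner f f"
  by (simp add: l2_inner_def)

lemma l2_inner_Cauchy_Schwarz:
  assumes f: "continuous_on (sphere 0 1) f" and g: "continuous_on (sphere 0 1) g"
  shows "(l2_inner f g)\<^sup>2 \<le> l2_inner f f * l2_inner g g"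
proof -
  have q: "0 \<le> l2_inner f f - 2 * t * l2_inner f g + t\<^sup>2 * l2_inner g g" for t
  proof -
    have "0 \<le> l2_inner (\<lambda>x. f x - t * g x) (\<lambda>x. f x - t * g x)"
      by (rule l2_inner_self_nonneg)
    also have "\<dots> = l2_inner f (\<lambda>x. f x - t * g x) - t * l2_inner g (\<lambda>x. f x - t * g x)"
      using f g by (subst l2_inner_diff_left) (auto intro!: continuous_intros simp: l2_inner_cmult_left)
    also have "l2_inner f (\<lambda>x. f x - t * g x) = l2_inner f f - t * l2_inner f g"
      using f g by (subst (1 2 3) l2_inner_commute, subst l2_inner_diff_left)
        (auto intro!: continuous_intros simp: l2_inner_cmult_left)
    also have "l2_inner g (\<lambda>x. f x - t * g x) = l2_inner f g - t * l2_inner g g"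
      using f g by (subst l2_inner_commute, subst l2_inner_diff_left)
        (auto intro!: continuous_intros simp: l2_inner_cmult_left)
    finally show ?thesis by (simp add: algebra_simps power2_eq_square)
  qed
  show ?thesis
  proof (cases "l2_inner g g = 0")
    case True
    have "l2_inner f g = 0"
    proof (rule ccontr)
      assume "l2_inner f g \<noteq> 0"
      \<comment> \<open>When \<open>l2_inner g g\<close> is 0 the quadratic in \<open>q\<close> is
        affine in \<open>t\<close>; the chosen \<open>t\<close> gives it the value -1.\<close>
      then show False
        using q[of "(l2_inner f f + 1) / (2 * l2_inner f g)"] True by (simp add: field_simps)
    qed
    then show ?thesis using True by simp
  next
    case False
    then have "0 < l2_inner g g" using l2_inner_self_nonneg[of g] by simp
    then show ?thesis
      using q[of "l2_inner f g / l2_inner g g"] by (simp add: field_simps power2_eq_square)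
  qed
qed

lemma l2_inner_linear_combination:
  assumes "continuous_on (sphere 0 1) f1" "continuous_on (sphere 0 1) f2" "continuous_on (sphere 0 1) f3"
    "continuous_on (sphere 0 1) f4" "continuous_on (sphere 0 1) g"
  shows "l2_inner (\<lambda>x. c1 * f1 x + c2 * f2 x + c3 * f3 x + c4 * f4 x) g
    = c1 * l2_inner f1 g + c2 * l2_inner f2 g + c3 * l2_inner f3 g + c4 * l2_inner f4 g"
  using assms
  by (simp add: l2_inner_add_left l2_inner_cmult_left continuous_on_add continuous_on_mult continuous_on_const)

lemma smooth_sphere_add: "smooth_sphere f \<Longrightarrow> smooth_sphere g \<Longrightarrow> smooth_sphere (\<lambda>x. f x + g x)"
  using smooth_on_add[OF open_punctured] by (simp add: smooth_sphere_def radial_ext_def)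

lemma smooth_sphere_const: "smooth_sphere (\<lambda>x. c)"
  using smooth_on_const[OF open_punctured] by (simp add: smooth_sphere_def radial_ext_def)

lemma smooth_sphere_cos: "smooth_sphere f \<Longrightarrow> smooth_sphere (\<lambda>x. cos (f x))"
  and smooth_sphere_sin: "smooth_sphere f \<Longrightarrow> smooth_sphere (\<lambda>x. sin (f x))"
  using smooth_on_cos[OF open_punctured] smooth_on_sin[OF open_punctured]
  by (simp_all add: smooth_sphere_def radial_ext_def)

lemma sphere_grad_compose:
  assumes u: "smooth_sphere u" and x: "x \<in> sphere 0 1"
    and F: "(F has_real_derivative c) (at (u x))"
  shows "sphere_grad (\<lambda>x. F (u x)) x = c *\<^sub>R sphere_grad u x"
proof -
  have "x \<noteq> 0" using x by auto
  have "((\<lambda>x. F (radial_ext u x)) has_derivative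
      (\<lambda>h. frechet_derivative (radial_ext u) (at x) h * c)) (at x)"
    using F by (intro DERIV_compose_FDERIV[OF _ smooth_sphere_has_derivative[OF u \<open>x \<noteq> 0\<close>]])
      (simp add: radial_ext_on_sphere[OF x])
  then have "(radial_ext (\<lambda>x. F (u x)) has_derivative
      (\<lambda>h. frechet_derivative (radial_ext u) (at x) h * c)) (at x)"
    by (simp add: radial_ext_def)
  from frechet_derivative_at[OF this, symmetric] show ?thesis
    by (simp add: sphere_grad_def scaleR_sum_right mult.commute)
qed

text \<open>Young's inequality; with \<open>w = 4 ^ l\<close> it converts an L^2 bound for a
  frequency block into an L^1 bound.\<close>

lemma abs_le_weighted_square: "\<bar>y\<bar> \<le> (w * y\<^sup>2 + 1 / w) / 2" if "0 < w" for w y :: real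
proof -
  have "0 \<le> w * (\<bar>y\<bar> - 1 / w)\<^sup>2" using that by simp
  also have "\<dots> = w * y\<^sup>2 - 2 * \<bar>y\<bar> + 1 / w"
    using that by (simp add: power2_diff field_simps power2_eq_square)
  finally show ?thesis by simp
qed

locale laplace_eigenbasis =
  fixes \<phi> :: "nat \<Rightarrow> 'a::euclidean_space \<Rightarrow> real" and lam :: "nat \<Rightarrow> real"
  assumes eigenbasis: "eigenbasis \<phi> lam"
begin

lemma smooth_phi: "smooth_sphere (\<phi> i)"
  and orthonormal: "l2_inner (\<phi> i) (\<phi> j) = (if i = j then 1 else 0)"
  and lam_0: "lam 0 = 0" and lam_1: "0 < lam 1" and lam_mono: "incseq lam"
  using eigenbasis unfolding eigenbasis_def by blast+

lemma laplacian_phi: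
  assumes "x \<in> sphere 0 1"
  shows "sphere_laplacian (\<phi> i) x = - (lam i)\<^sup>2 * \<phi> i x"
proof -
  have "- sphere_laplacian (\<phi> i) x = (lam i)\<^sup>2 * \<phi> i x"
    using eigenbasis assms unfolding eigenbasis_def by blast
  then show ?thesis by (metis minus_minus mult_minus_left)
qed

lemma lam_nonneg: "0 \<le> lam i"
  using lam_0 lam_mono by (metis incseqD le0)

lemma continuous_phi: "continuous_on (sphere 0 1) (\<phi> i)"
  by (rule smooth_sphere_imp_continuous[OF smooth_phi])

lemma l2_inner_sum_phi:
  assumes "finite I"
  shows "l2_inner (\<lambda>x. \<Sum>i\<in>I. c i * \<phi> i x) (\<phi> j) = (if j \<in> I then c j else 0)"
proof -
  have "l2_inner (\<lambda>x. \<Sum>i\<in>I. c i * \<phi> i x) (\<phi> j) = (\<Sum>i\<in>I. c i * l2_inner (\<phi> i) (\<phi> j))"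
    using continuous_phi by (subst l2_inner_sum_left) (auto intro!: continuous_intros simp: l2_inner_cmult_left)
  then show ?thesis
    using assms by (simp add: orthonormal if_distrib[of "\<lambda>x. c _ * x"] sum.delta cong: if_cong)
qed

lemma l2_inner_sum_phi_self:
  assumes "finite I"
  shows "l2_inner (\<lambda>x. \<Sum>i\<in>I. c i * \<phi> i x) (\<lambda>x. \<Sum>i\<in>I. c i * \<phi> i x) = (\<Sum>i\<in>I. (c i)\<^sup>2)"
proof -
  let ?S = "\<lambda>x. \<Sum>i\<in>I. c i * \<phi> i x"
  have cS: "continuous_on (sphere 0 1) ?S" using continuous_phi by (intro continuous_intros)
  have "l2_inner ?S ?S = (\<Sum>i\<in>I. c i * l2_inner (\<phi> i) ?S)"
    using continuous_phi cS by (subst l2_inner_sum_left) (auto intro!: continuous_intros simp: l2_inner_cmult_left)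
  also have "\<dots> = (\<Sum>i\<in>I. c i * c i)"
    using l2_inner_sum_phi[OF assms] by (simp add: l2_inner_commute[of "\<phi> _" ?S])
  finally show ?thesis by (simp add: power2_eq_square)
qed

abbreviation "resid f N \<equiv> (\<lambda>x. f x - (\<Sum>i<N. l2_inner f (\<phi> i) * \<phi> i x))"

lemma continuous_resid: "continuous_on (sphere 0 1) f \<Longrightarrow> continuous_on (sphere 0 1) (resid f N)"
  using continuous_phi by (intro continuous_intros)

lemma l2_inner_resid:
  assumes f: "continuous_on (sphere 0 1) f" and g: "continuous_on (sphere 0 1) g"
  shows "l2_inner (resid f N) g = l2_inner f g - (\<Sum>i<N. l2_inner f (\<phi> i) * l2_inner g (\<phi> i))"
proof -
  have "l2_inner (\<lambda>x. \<Sum>i<N. l2_inner f (\<phi> i) * \<phi> i x) g = (\<Sum>i<N. l2_inner f (\<phi> i) * l2_inner (\<phi> i) g)"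
    using continuous_phi g by (subst l2_inner_sum_left) (auto intro!: continuous_intros simp: l2_inner_cmult_left)
  then show ?thesis
    using f g continuous_phi
    by (subst l2_inner_diff_left) (auto intro!: continuous_intros simp: l2_inner_commute[of g])
qed

text \<open>Completeness in \<open>eigenbasis\<close> is L^2 convergence of the partial sums;
  Cauchy-Schwarz against \<open>g\<close> turns it into convergence of inner products.\<close>

lemma parseval_sums:
  assumes f: "continuous_on (sphere 0 1) f" and g: "continuous_on (sphere 0 1) g"
  shows "(\<lambda>i. l2_inner f (\<phi> i) * l2_inner g (\<phi> i)) sums l2_inner f g"
proof -
  have "integrable sphere_measure (\<lambda>x. (f x)\<^sup>2)"
    using integrable_sphere_mult[OF f f] by (simp add: power2_eq_square)
  then have "(\<lambda>N. LINT x|sphere_measure. (resid f N x)\<^sup>2) \<longlonglongrightarrow> 0"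
    using eigenbasis continuous_measurable_sphere[OF f] unfolding eigenbasis_def by blast
  then have "(\<lambda>N. l2_inner (resid f N) (resid f N)) \<longlonglongrightarrow> 0"
    by (simp add: l2_inner_def power2_eq_square)
  then have "(\<lambda>N. l2_inner (resid f N) (resid f N) * l2_inner g g) \<longlonglongrightarrow> 0"
    by (rule tendsto_mult_left_zero)
  then have "(\<lambda>N. (l2_inner (resid f N) g)\<^sup>2) \<longlonglongrightarrow> 0"
    by (rule tendsto_sandwich[OF _ _ tendsto_const, rotated 2])
      (use l2_inner_Cauchy_Schwarz[OF continuous_resid[OF f] g] in auto)
  then have "(\<lambda>N. sqrt ((l2_inner (resid f N) g)\<^sup>2)) \<longlonglongrightarrow> sqrt 0"
    by (rule tendsto_real_sqrt)
  then have "(\<lambda>N. l2_inner (resid f N) g) \<longlonglongrightarrow> 0"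
    by (simp add: tendsto_rabs_zero_iff)
  then have "(\<lambda>N. l2_inner f g - l2_inner (resid f N) g) \<longlonglongrightarrow> l2_inner f g - 0"
    by (intro tendsto_intros)
  then show ?thesis
    unfolding sums_def by (simp add: l2_inner_resid[OF f g])
qed

lemma coeff_square_summable:
  "continuous_on (sphere 0 1) f \<Longrightarrow> summable (\<lambda>i. (l2_inner f (\<phi> i))\<^sup>2)"
  using parseval_sums[of f f] by (simp add: power2_eq_square sums_iff)

lemma coeff_laplacian:
  assumes "smooth_sphere f"
  shows "l2_inner (sphere_laplacian f) (\<phi> i) = - (lam i)\<^sup>2 * l2_inner f (\<phi> i)"
proof -
  have "l2_inner (sphere_laplacian f) (\<phi> i) = l2_inner f (sphere_laplacian (\<phi> i))"
    using l2_inner_laplacian_commute[OF assms smooth_phi] by simp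
  also have "\<dots> = l2_inner f (\<lambda>x. - (lam i)\<^sup>2 * \<phi> i x)"
    by (rule l2_inner_cong) (simp_all add: laplacian_phi)
  also have "\<dots> = - (lam i)\<^sup>2 * l2_inner f (\<phi> i)"
    by (subst l2_inner_commute, subst l2_inner_cmult_left) (simp add: l2_inner_commute)
  finally show ?thesis .
qed

text \<open>By Green and Parseval the Dirichlet energy is the sum of the squared coefficients with
  weights \<open>(lam i)\<^sup>2\<close>. The hypothesis on \<open>L\<close> is the one that
  \<open>lam_unbounded\<close> refutes.\<close>

lemma dirichlet_le:
  fixes f :: "'a \<Rightarrow> real"
  assumes f: "smooth_sphere f" and L: "\<And>i. lam i \<le> L"
  shows "(LINT x|sphere_measure. sphere_grad f x \<bullet> sphere_grad f x) \<le> L\<^sup>2 * l2_inner f f"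
proof -
  note cf = smooth_sphere_imp_continuous[OF f]
  have "(\<lambda>i. l2_inner f (\<phi> i) * l2_inner (sphere_laplacian f) (\<phi> i)) sums l2_inner f (sphere_laplacian f)"
    by (intro parseval_sums cf smooth_sphere_imp_continuous smooth_sphere_laplacian f)
  then have "(\<lambda>i. - (l2_inner f (\<phi> i) * l2_inner (sphere_laplacian f) (\<phi> i)))
      sums - l2_inner f (sphere_laplacian f)"
    by (rule sums_minus)
  then have "(\<lambda>i. (lam i)\<^sup>2 * (l2_inner f (\<phi> i) * l2_inner f (\<phi> i)))
      sums (LINT x|sphere_measure. sphere_grad f x \<bullet> sphere_grad f x)"
    by (simp add: coeff_laplacian[OF f] green_sphere[OF f f] mult_ac)
  moreover have "(\<lambda>i. L\<^sup>2 * (l2_inner f (\<phi> i) * l2_inner f (\<phi> i))) sums (L\<^sup>2 * l2_inner f f)"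
    by (intro sums_mult parseval_sums cf)
  ultimately show ?thesis
    by (rule sums_le[rotated]) (auto intro!: mult_right_mono power_mono L lam_nonneg)
qed

text \<open>If the spectrum were bounded by \<open>L\<close>, the Dirichlet energy of \<open>cos (k \<phi>\<^sub>1)\<close> and \<open>sin (k \<phi>\<^sub>1)\<close>
  together, which equals \<open>k\<^sup>2 \<lambda>\<^sub>1\<^sup>2\<close>, would be at most \<open>L\<^sup>2\<close> times the volume of the sphere.\<close>

lemma lam_unbounded: "\<exists>i. L < lam i"
proof (rule ccontr)
  assume "\<not> ?thesis"
  then have L: "lam i \<le> L" for i by (meson not_less)
  define V where "V = l2_inner (\<lambda>x::'a. 1) (\<lambda>x. 1)"
  have "(lam 1)\<^sup>2 * k\<^sup>2 \<le> L\<^sup>2 * V" for k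
  proof -
    let ?G = "\<lambda>u. LINT x|sphere_measure. sphere_grad u x \<bullet> sphere_grad u x"
    let ?c = "\<lambda>x. cos (k * \<phi> 1 x)" and ?s = "\<lambda>x. sin (k * \<phi> 1 x)"
    have c: "smooth_sphere ?c" and s: "smooth_sphere ?s"
      by (intro smooth_sphere_cos smooth_sphere_sin smooth_sphere_mult smooth_sphere_const smooth_phi)+
    have gc: "sphere_grad ?c x = (- (k * sin (k * \<phi> 1 x))) *\<^sub>R sphere_grad (\<phi> 1) x"
      and gs: "sphere_grad ?s x = (k * cos (k * \<phi> 1 x)) *\<^sub>R sphere_grad (\<phi> 1) x"
      if "x \<in> sphere 0 1" for x
      by (rule sphere_grad_compose[OF smooth_phi that, of "\<lambda>t. cos (k * t)"]
               sphere_grad_compose[OF smooth_phi that, of "\<lambda>t. sin (k * t)"],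
          auto intro!: derivative_eq_intros)+
    have "(lam 1)\<^sup>2 = - l2_inner (\<phi> 1) (sphere_laplacian (\<phi> 1))"
      using coeff_laplacian[OF smooth_phi, of 1 1] by (subst l2_inner_commute) (simp add: orthonormal)
    then have "(lam 1)\<^sup>2 * k\<^sup>2 = k\<^sup>2 * ?G (\<phi> 1)"
      using green_sphere[OF smooth_phi smooth_phi, of 1 1] by simp
    also have "\<dots> = (LINT x|sphere_measure. sphere_grad ?c x \<bullet> sphere_grad ?c x + sphere_grad ?s x \<bullet> sphere_grad ?s x)"
    proof (subst Bochner_Integration.integral_mult_right_zero[symmetric], intro Bochner_Integration.integral_cong refl)
      fix x :: 'a assume "x \<in> space sphere_measure"
      then have x: "x \<in> sphere 0 1" by simp
      have "k\<^sup>2 = (k * sin (k * \<phi> 1 x))\<^sup>2 + (k * cos (k * \<phi> 1 x))\<^sup>2"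
        by (simp add: power_mult_distrib flip: distrib_left)
      then show "k\<^sup>2 * (sphere_grad (\<phi> 1) x \<bullet> sphere_grad (\<phi> 1) x)
          = sphere_grad ?c x \<bullet> sphere_grad ?c x + sphere_grad ?s x \<bullet> sphere_grad ?s x"
        unfolding gc[OF x] gs[OF x] by (simp add: power2_eq_square algebra_simps)
    qed
    also have "\<dots> = ?G ?c + ?G ?s"
      by (intro Bochner_Integration.integral_add integrable_sphere continuous_sphere_grad_inner c s)
    also have "\<dots> \<le> L\<^sup>2 * l2_inner ?c ?c + L\<^sup>2 * l2_inner ?s ?s"
      by (intro add_mono dirichlet_le c s L)
    also have "\<dots> = L\<^sup>2 * (l2_inner ?c ?c + l2_inner ?s ?s)"
      by (simp add: distrib_left)
    also have "l2_inner ?c ?c + l2_inner ?s ?s = V"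
    proof -
      have "l2_inner ?c ?c + l2_inner ?s ?s = (LINT x|sphere_measure. ?c x * ?c x + ?s x * ?s x)"
        unfolding l2_inner_def
        by (intro Bochner_Integration.integral_add[symmetric] integrable_sphere_mult
            smooth_sphere_imp_continuous c s)
      also have "\<dots> = V"
        unfolding V_def l2_inner_def
        by (intro Bochner_Integration.integral_cong refl) (simp flip: power2_eq_square)
      finally show ?thesis .
    qed
    finally show ?thesis .
  qed
  \<comment> \<open>For this \<open>k\<close> the left-hand side equals
    \<open>L\<^sup>2 * V + 1\<close>.\<close>
  from this[of "sqrt ((L\<^sup>2 * V + 1) / (lam 1)\<^sup>2)"] show False
    using lam_1 l2_inner_self_nonneg[of "\<lambda>x::'a. 1"] by (simp add: V_def)
qed

text \<open>A sum over an infinite index set is 0 by convention, so it is this finiteness that makes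
  \<open>freq_block\<close> a genuine spectral projection.\<close>

lemma finite_lam_le: "finite {i. lam i \<le> L}"
proof -
  obtain N where "L < lam N" using lam_unbounded by blast
  then have "{i. lam i \<le> L} \<subseteq> {..<N}"
    using incseqD[OF lam_mono] by (force simp: not_less[symmetric])
  then show ?thesis by (rule finite_subset) simp
qed

text \<open>Apply \<open>1 - \<Delta>\<close> to \<open>f\<close> repeatedly: by symmetry of
  \<Delta>, each application multiplies the coefficient by
  \<open>1 + (lam i)\<^sup>2\<close>.\<close>

lemma coeff_decay:
  assumes "smooth_sphere f"
  shows "\<exists>g. smooth_sphere g \<and> (\<forall>i. l2_inner g (\<phi> i) = (1 + (lam i)\<^sup>2) ^ m * l2_inner f (\<phi> i))"
proof (induction m)
  case 0
  then show ?case using assms by auto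
next
  case (Suc m)
  then obtain g where g: "smooth_sphere g" "\<And>i. l2_inner g (\<phi> i) = (1 + (lam i)\<^sup>2) ^ m * l2_inner f (\<phi> i)"
    by blast
  let ?h = "\<lambda>x. g x + (-1) * sphere_laplacian g x"
  have h: "smooth_sphere (\<lambda>x. (-1) * sphere_laplacian g x)"
    by (intro smooth_sphere_mult smooth_sphere_const smooth_sphere_laplacian g)
  have "l2_inner ?h (\<phi> i) = (1 + (lam i)\<^sup>2) ^ Suc m * l2_inner f (\<phi> i)" for i
  proof -
    have "l2_inner ?h (\<phi> i) = l2_inner g (\<phi> i) + (-1) * l2_inner (sphere_laplacian g) (\<phi> i)"
      by (subst l2_inner_add_left) (intro smooth_sphere_imp_continuous g h smooth_phi l2_inner_cmult_left
          arg_cong2[of _ _ _ _ "(+)"] refl)+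
    then show ?thesis
      using g by (simp add: coeff_laplacian algebra_simps)
  qed
  moreover have "smooth_sphere ?h" by (intro smooth_sphere_add g h)
  ultimately show ?case by blast
qed

text \<open>Compare with the Parseval sum of \<open>(1 - \<Delta>)\<close> to the power
  \<open>m\<close> applied to \<open>f\<close>, where \<open>s \<le> 2 * m\<close>. Without
  summability, \<open>sobolev_norm\<close> would be built on an arbitrary value.\<close>

lemma sobolev_summable:
  assumes "smooth_sphere f"
  shows "summable (\<lambda>i. (1 + (lam i)\<^sup>2) powr s * \<bar>l2_inner f (\<phi> i)\<bar>\<^sup>2)"
proof -
  obtain m :: nat where m: "s \<le> real (2 * m)"
    by (metis mult_2 of_nat_add real_arch_simple add_increasing2 of_nat_0_le_iff)
  obtain g where g: "smooth_sphere g" "\<And>i. l2_inner g (\<phi> i) = (1 + (lam i)\<^sup>2) ^ m * l2_inner f (\<phi> i)"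
    using coeff_decay[OF assms] by blast
  have "summable (\<lambda>i. (l2_inner g (\<phi> i))\<^sup>2)"
    by (intro coeff_square_summable smooth_sphere_imp_continuous g)
  then show ?thesis
  proof (rule summable_comparison_test')
    fix i
    have "(1 + (lam i)\<^sup>2) powr s \<le> (1 + (lam i)\<^sup>2) powr real (2 * m)"
      using m by (intro powr_mono) auto
    also have "\<dots> = ((1 + (lam i)\<^sup>2) ^ m)\<^sup>2"
      by (subst powr_realpow) (auto simp: add_pos_nonneg power_mult[symmetric] mult.commute)
    finally show "norm ((1 + (lam i)\<^sup>2) powr s * \<bar>l2_inner f (\<phi> i)\<bar>\<^sup>2) \<le> (l2_inner g (\<phi> i))\<^sup>2"
      by (simp add: g power_mult_distrib mult_right_mono)
  qed
qed

text \<open>All conditions at \<tau> = 0 reach the single modes through this norm. The exponent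
  stays written as \<open>real 0\<close> to match the instances of \<open>Cinf_bigo\<close> and
  \<open>Cinf_tendsto\<close>.\<close>

lemma abs_coeff_le_sobolev_norm:
  assumes "continuous_on (sphere 0 1) f"
  shows "\<bar>l2_inner f (\<phi> i)\<bar> \<le> sobolev_norm \<phi> lam (real 0) f"
proof -
  have nz: "1 + (lam i)\<^sup>2 \<noteq> 0" for i by (metis add_pos_nonneg less_irrefl zero_le_power2 zero_less_one)
  have "(l2_inner f (\<phi> i))\<^sup>2 \<le> (\<Sum>i. (l2_inner f (\<phi> i))\<^sup>2)"
    using sum_le_suminf[OF coeff_square_summable[OF assms], of "{i}"] by simp
  then have "sqrt ((l2_inner f (\<phi> i))\<^sup>2) \<le> sqrt (\<Sum>i. (l2_inner f (\<phi> i))\<^sup>2)"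
    by (rule real_sqrt_le_mono)
  then show ?thesis by (simp add: sobolev_norm_def nz)
qed

section \<open>Coefficients of \<open>(log \<nabla>) f\<close>\<close>

text \<open>The number of the block of \<open>freq_block\<close> that contains mode
  \<open>j\<close>: taking the least exponent puts every frequency up to 1 into block 0 and a
  frequency equal to \<open>2 ^ l\<close> into block \<open>l\<close>.\<close>

definition dyadic_index :: "nat \<Rightarrow> nat" where
  "dyadic_index j = (LEAST l. lam j \<le> 2 ^ l)"

lemma lam_le_dyadic: "lam j \<le> 2 ^ dyadic_index j"
proof -
  obtain l where "lam j < 2 ^ l" using real_arch_pow[of 2 "lam j"] by auto
  then show ?thesis
    unfolding dyadic_index_def by (intro LeastI[of "\<lambda>l. lam j \<le> 2 ^ l" l]) simp
qed

lemma lt_lam_of_lt_dyadic_index: "l < dyadic_index j \<Longrightarrow> 2 ^ l < lam j"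
  unfolding dyadic_index_def using not_less_Least[of l "\<lambda>l. lam j \<le> 2 ^ l"] by simp

lemma dyadic_index_le: "lam j \<le> 2 ^ l \<Longrightarrow> dyadic_index j \<le> l"
  unfolding dyadic_index_def by (rule Least_le)

lemma freq_block_eq:
  "freq_block \<phi> lam (Suc l) f x = (\<Sum>i | dyadic_index i = Suc l. l2_inner f (\<phi> i) * \<phi> i x)"
proof -
  have "2 ^ l < lam i \<and> lam i \<le> 2 ^ Suc l \<longleftrightarrow> dyadic_index i = Suc l" for i
  proof
    assume *: "2 ^ l < lam i \<and> lam i \<le> 2 ^ Suc l"
    have "\<not> dyadic_index i \<le> l"
    proof
      assume "dyadic_index i \<le> l"
      then have "lam i \<le> 2 ^ l"
        using lam_le_dyadic[of i] power_increasing[of "dyadic_index i" l "2::real"] by linarith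
      then show False using * by simp
    qed
    then show "dyadic_index i = Suc l" using dyadic_index_le[of i "Suc l"] * by simp
  next
    assume "dyadic_index i = Suc l"
    then show "2 ^ l < lam i \<and> lam i \<le> 2 ^ Suc l"
      using lt_lam_of_lt_dyadic_index[of l i] lam_le_dyadic[of i] by simp
  qed
  then show ?thesis by (simp add: freq_block_def)
qed

lemma finite_dyadic_block: "finite {i. dyadic_index i = l}"
  by (rule finite_subset[OF _ finite_lam_le[of "2 ^ l"]]) (use lam_le_dyadic in auto)

lemma continuous_freq_block: "continuous_on (sphere 0 1) (freq_block \<phi> lam (Suc l) f)"
  unfolding freq_block_eq[abs_def] using continuous_phi by (intro continuous_intros)

text \<open>Any rate faster than geometric ratio 1/2 would survive the factor \<open>l\<close> of
  the logarithm. The Sobolev exponent 2 has weight at least \<open>16 ^ l\<close> on a block with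
  frequencies above \<open>2 ^ l\<close>, and its square root gives the rate here.\<close>

lemma integral_abs_freq_block:
  assumes f: "smooth_sphere f"
  shows "\<exists>K. \<forall>l. (LINT x|sphere_measure. \<bar>freq_block \<phi> lam (Suc l) f x\<bar>) \<le> K * (1 / 4) ^ l"
proof -
  let ?O = "\<lambda>l. freq_block \<phi> lam (Suc l) f"
  let ?s = "\<lambda>i. (1 + (lam i)\<^sup>2) powr 2 * \<bar>l2_inner f (\<phi> i)\<bar>\<^sup>2"
  define S where "S = (\<Sum>i. ?s i)"
  define V where "V = (LINT x|(sphere_measure :: 'a measure). (1::real))"
  have S: "summable ?s" by (rule sobolev_summable[OF f])
  have "(LINT x|sphere_measure. \<bar>?O l x\<bar>) \<le> (S + V) / 2 * (1 / 4) ^ l" for l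
  proof -
    have sq: "16 ^ l * l2_inner (?O l) (?O l) \<le> S"
    proof -
      have "l2_inner (?O l) (?O l) = (\<Sum>i | dyadic_index i = Suc l. (l2_inner f (\<phi> i))\<^sup>2)"
        unfolding freq_block_eq[abs_def] by (rule l2_inner_sum_phi_self[OF finite_dyadic_block])
      then have "16 ^ l * l2_inner (?O l) (?O l) = (\<Sum>i | dyadic_index i = Suc l. 16 ^ l * (l2_inner f (\<phi> i))\<^sup>2)"
        by (simp add: sum_distrib_left)
      also have "\<dots> \<le> (\<Sum>i | dyadic_index i = Suc l. ?s i)"
      proof (rule sum_mono)
        fix i assume "i \<in> {i. dyadic_index i = Suc l}"
        then have "2 ^ l < lam i" using lt_lam_of_lt_dyadic_index[of l i] by simp
        then have "(2 ^ l)\<^sup>2 \<le> (lam i)\<^sup>2" by (intro power_mono) auto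
        then have "((2 ^ l)\<^sup>2)\<^sup>2 \<le> (1 + (lam i)\<^sup>2)\<^sup>2" by (intro power_mono) auto
        moreover have "((2 ^ l)\<^sup>2)\<^sup>2 = (16::real) ^ l"
          by (simp flip: power_mult) (simp add: power_mult mult.commute[of l])
        moreover have "(1 + (lam i)\<^sup>2) powr 2 = (1 + (lam i)\<^sup>2)\<^sup>2"
          by (intro powr_numeral) simp
        ultimately show "16 ^ l * (l2_inner f (\<phi> i))\<^sup>2 \<le> ?s i"
          by (simp add: mult_right_mono)
      qed
      also have "\<dots> \<le> S"
        unfolding S_def by (intro sum_le_suminf S finite_dyadic_block) auto
      finally show ?thesis .
    qed
    \<comment> \<open>The weight \<open>4 ^ l\<close> balances the two parts: by \<open>sq\<close>
      the quadratic part is at most \<open>S / 4 ^ l\<close>, and the constant part is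
      \<open>V / 4 ^ l\<close>.\<close>
    have "(LINT x|sphere_measure. \<bar>?O l x\<bar>)
        \<le> (LINT x|sphere_measure. (4 ^ l * (?O l x * ?O l x) + 1 / 4 ^ l * 1) / 2)"
    proof (rule integral_mono)
      show "integrable sphere_measure (\<lambda>x. \<bar>?O l x\<bar>)"
        by (intro integrable_abs integrable_sphere continuous_freq_block)
      show "integrable sphere_measure (\<lambda>x. (4 ^ l * (?O l x * ?O l x) + 1 / 4 ^ l * 1) / 2)"
        by (intro integrable_sphere continuous_intros continuous_freq_block) auto
      show "\<bar>?O l x\<bar> \<le> (4 ^ l * (?O l x * ?O l x) + 1 / 4 ^ l * 1) / 2" for x
        using abs_le_weighted_square[of "4 ^ l" "?O l x"] by (simp add: power2_eq_square)
    qed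
    also have "\<dots> = (4 ^ l * l2_inner (?O l) (?O l) + 1 / 4 ^ l * V) / 2"
    proof -
      have "integrable sphere_measure (\<lambda>x. ?O l x * ?O l x)"
        by (intro integrable_sphere_mult continuous_freq_block)
      then show ?thesis
        unfolding V_def l2_inner_def
        by (subst integral_divide_zero, subst Bochner_Integration.integral_add) auto
    qed
    also have "\<dots> \<le> (S + V) / 2 * (1 / 4) ^ l"
    proof -
      have "4 ^ l * (4 ^ l * l2_inner (?O l) (?O l)) \<le> S"
        using sq by (simp add: mult.assoc[symmetric] flip: power_mult_distrib)
      then have "4 ^ l * l2_inner (?O l) (?O l) \<le> S / 4 ^ l"
        by (simp add: field_simps)
      then show ?thesis by (simp add: field_simps power_one_over)
    qed
    finally show ?thesis .
  qed
  then show ?thesis by blast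
qed

text \<open>\<open>log_nabla\<close> is a pointwise series, with a junk value where it diverges; its absolute convergence
  in \<open>L\<^sup>1\<close> gives convergence almost everywhere, which suffices for the coefficients.\<close>

lemma log_nabla_coeff:
  assumes f: "smooth_sphere f"
  shows "integrable sphere_measure (\<lambda>x. log_nabla \<phi> lam f x * \<phi> j x)"
    and "l2_inner (log_nabla \<phi> lam f) (\<phi> j) = real (dyadic_index j) * ln 2 * l2_inner f (\<phi> j)"
proof -
  define g where "g l x = real (Suc l) * ln 2 * freq_block \<phi> lam (Suc l) f x" for l x
  have cg: "continuous_on (sphere 0 1) (g l)" for l
    unfolding g_def by (intro continuous_intros continuous_freq_block)
  obtain K where K: "\<And>l. (LINT x|sphere_measure. \<bar>freq_block \<phi> lam (Suc l) f x\<bar>) \<le> K * (1 / 4) ^ l"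
    using integral_abs_freq_block[OF f] by blast
  \<comment> \<open>The logarithmic factor is at most \<open>2 ^ l\<close>, which leaves the ratio
    1/2.\<close>
  have g_le: "(LINT x|sphere_measure. \<bar>g l x\<bar>) \<le> K * (1 / 2) ^ l" for l
  proof -
    have nn: "0 \<le> (LINT x|sphere_measure. \<bar>freq_block \<phi> lam (Suc l) f x\<bar>)" by simp
    have "real (Suc l) \<le> 2 ^ l"
    proof -
      have "Suc l \<le> 2 ^ l" by (rule Suc_leI) (rule less_exp)
      then have "real (Suc l) \<le> real (2 ^ l)" by (rule of_nat_mono)
      then show ?thesis by simp
    qed
    moreover have "ln 2 \<le> (1::real)" using ln_2_less_1 by simp
    ultimately have "real (Suc l) * ln 2 \<le> 2 ^ l * 1" by (intro mult_mono) auto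
    then have "real (Suc l) * ln 2 * (LINT x|sphere_measure. \<bar>freq_block \<phi> lam (Suc l) f x\<bar>)
        \<le> 2 ^ l * (K * (1 / 4) ^ l)"
      using nn K[of l] by (intro mult_mono) auto
    also have "\<dots> = K * (1 / 2) ^ l"
      by (simp add: power_one_over field_simps flip: power_mult_distrib)
    finally show ?thesis by (simp add: g_def abs_mult)
  qed
  have sum_g: "summable (\<lambda>l. LINT x|sphere_measure. \<bar>g l x\<bar>)"
    by (rule summable_comparison_test'[where g = "\<lambda>l. K * (1 / 2) ^ l" and N = 0])
      (use g_le in \<open>auto intro!: summable_mult summable_geometric\<close>)
  have int_g: "integrable sphere_measure (\<lambda>x. \<bar>g l x\<bar>)" for l
    by (intro integrable_abs integrable_sphere cg)
  have AE_sum: "AE x in sphere_measure. summable (\<lambda>l. \<bar>g l x\<bar>)"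
  proof -
    have "(\<integral>\<^sup>+x. (\<Sum>l. ennreal \<bar>g l x\<bar>) \<partial>sphere_measure) = (\<Sum>l. \<integral>\<^sup>+x. ennreal \<bar>g l x\<bar> \<partial>sphere_measure)"
      using int_g by (intro nn_integral_suminf) auto
    also have "\<dots> = (\<Sum>l. ennreal (LINT x|sphere_measure. \<bar>g l x\<bar>))"
      using int_g by (intro suminf_cong nn_integral_eq_integral) auto
    also have "\<dots> = ennreal (\<Sum>l. LINT x|sphere_measure. \<bar>g l x\<bar>)"
      using sum_g by (intro suminf_ennreal2) auto
    finally have "(\<integral>\<^sup>+x. (\<Sum>l. ennreal \<bar>g l x\<bar>) \<partial>sphere_measure) \<noteq> \<infinity>" by simp
    then have "AE x in sphere_measure. (\<Sum>l. ennreal \<bar>g l x\<bar>) \<noteq> \<infinity>"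
      using int_g by (intro nn_integral_PInf_AE) auto
    then show ?thesis
      by eventually_elim (auto intro: summable_suminf_not_top)
  qed
  obtain Bd where Bd: "\<And>x. x \<in> sphere 0 1 \<Longrightarrow> \<bar>\<phi> j x\<bar> \<le> Bd"
    using bounded_on_sphere[OF continuous_phi] by metis
  let ?G = "\<lambda>l x. g l x * \<phi> j x"
  have int: "integrable sphere_measure (?G l)" for l
    by (intro integrable_sphere_mult cg continuous_phi)
  have AE1: "AE x in sphere_measure. summable (\<lambda>l. norm (?G l x))"
    using AE_sum by eventually_elim (simp add: abs_mult summable_mult2)
  have sum1: "summable (\<lambda>l. LINT x|sphere_measure. norm (?G l x))"
  proof (rule summable_comparison_test'[where N = 0])
    show "summable (\<lambda>l. Bd * (LINT x|sphere_measure. \<bar>g l x\<bar>))"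
      by (intro summable_mult sum_g)
    fix l
    have "(LINT x|sphere_measure. norm (?G l x)) \<le> (LINT x|sphere_measure. Bd * \<bar>g l x\<bar>)"
    proof (rule integral_mono)
      show "integrable sphere_measure (\<lambda>x. norm (?G l x))" using int by simp
      show "integrable sphere_measure (\<lambda>x. Bd * \<bar>g l x\<bar>)" using int_g by simp
      fix x :: 'a assume "x \<in> space sphere_measure"
      then have "\<bar>\<phi> j x\<bar> \<le> Bd" using Bd by simp
      then show "norm (?G l x) \<le> Bd * \<bar>g l x\<bar>"
        by (simp add: abs_mult mult.commute mult_right_mono)
    qed
    then show "norm (LINT x|sphere_measure. norm (?G l x)) \<le> Bd * (LINT x|sphere_measure. \<bar>g l x\<bar>)"
      by simp
  qed
  have log_eq: "log_nabla \<phi> lam f x = (\<Sum>l. g l x)" for x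
    by (simp add: log_nabla_def g_def)
  have AE2: "AE x in sphere_measure. (\<Sum>l. ?G l x) = log_nabla \<phi> lam f x * \<phi> j x"
    using AE_sum unfolding log_eq
    by eventually_elim (auto intro: suminf_mult2[symmetric] summable_rabs_cancel)
  have meas: "(\<lambda>x. log_nabla \<phi> lam f x * \<phi> j x) \<in> borel_measurable sphere_measure"
    unfolding log_eq
    by (intro borel_measurable_times borel_measurable_suminf continuous_measurable_sphere cg continuous_phi)
  have int2: "integrable sphere_measure (\<lambda>x. \<Sum>l. ?G l x)"
    by (rule integrable_suminf[OF int AE1 sum1])
  show "integrable sphere_measure (\<lambda>x. log_nabla \<phi> lam f x * \<phi> j x)"
    using integrable_cong_AE_imp[OF int2 meas] AE2 by (auto simp: eq_commute)
  \<comment> \<open>At most one \<open>l\<close> contributes. For a mode in block 0 none does, in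
    agreement with the factor \<open>dyadic_index j = 0\<close>.\<close>
  have coeff: "(LINT x|sphere_measure. ?G l x) = (if dyadic_index j = Suc l then real (dyadic_index j) * ln 2 * l2_inner f (\<phi> j) else 0)" for l
  proof -
    have "(LINT x|sphere_measure. ?G l x) = real (Suc l) * ln 2 * l2_inner (freq_block \<phi> lam (Suc l) f) (\<phi> j)"
      by (simp add: g_def l2_inner_def mult.assoc)
    also have "l2_inner (freq_block \<phi> lam (Suc l) f) (\<phi> j) = (if dyadic_index j = Suc l then l2_inner f (\<phi> j) else 0)"
      unfolding freq_block_eq[abs_def] using l2_inner_sum_phi[OF finite_dyadic_block] by simp
    finally show ?thesis by simp
  qed
  have "(\<lambda>l. LINT x|sphere_measure. ?G l x) sums (LINT x|sphere_measure. (\<Sum>l. ?G l x))"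
    by (rule sums_integral[OF int AE1 sum1])
  moreover have "(\<lambda>l. LINT x|sphere_measure. ?G l x) sums (real (dyadic_index j) * ln 2 * l2_inner f (\<phi> j))"
  proof (cases "dyadic_index j")
    case 0
    then show ?thesis by (simp add: coeff)
  next
    case (Suc m)
    then have "(dyadic_index j = Suc l) = (l = m)" for l by auto
    then show ?thesis
      unfolding coeff using sums_single[of m "\<lambda>l. real (dyadic_index j) * ln 2 * l2_inner f (\<phi> j)"] by simp
  qed
  ultimately have "(LINT x|sphere_measure. (\<Sum>l. ?G l x)) = real (dyadic_index j) * ln 2 * l2_inner f (\<phi> j)"
    by (rule sums_unique2)
  moreover have "(LINT x|sphere_measure. (\<Sum>l. ?G l x)) = l2_inner (log_nabla \<phi> lam f) (\<phi> j)"
    unfolding l2_inner_def using int2 meas AE2 by (intro integral_cong_AE) auto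
  ultimately show "l2_inner (log_nabla \<phi> lam f) (\<phi> j) = real (dyadic_index j) * ln 2 * l2_inner f (\<phi> j)"
    by simp
qed

end

section \<open>Differentiation of coefficients in time\<close>

lemma smooth_spacetime_slice: "smooth_spacetime u \<Longrightarrow> 0 < t \<Longrightarrow> smooth_sphere (u t)"
  unfolding smooth_spacetime_def smooth_sphere_def
  by (drule smooth_on_slice[rotated 2]) auto

lemma smooth_spacetime_continuous:
  assumes "smooth_spacetime u"
  shows "continuous_on ({0<..} \<times> sphere 0 1) (\<lambda>(t, x). u t x)"
proof -
  have "continuous_on ({0<..} \<times> sphere 0 1) (\<lambda>(t, x). radial_ext (u t) x)"
    using assms unfolding smooth_spacetime_def
    by (rule continuous_on_subset[OF smooth_on_imp_continuous_on]) auto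
  then show ?thesis
    by (rule continuous_on_eq) (auto simp: radial_ext_on_sphere)
qed

text \<open>\<open>dtau\<close> is built on \<open>deriv\<close>, which says something only where a
  derivative exists. Both claims follow by identifying it with the partial derivative of the
  extension in the basis direction \<open>(1, 0)\<close>.\<close>

lemma spacetime_dtau:
  fixes u :: "real \<Rightarrow> 'a::euclidean_space \<Rightarrow> real"
  assumes u: "smooth_spacetime u"
  shows smooth_spacetime_dtau: "smooth_spacetime (dtau u)"
    and dtau_has_derivative: "0 < t \<Longrightarrow> x \<in> sphere 0 1 \<Longrightarrow>
      ((\<lambda>r. u r x) has_real_derivative dtau u t x) (at t)"
proof -
  define U where "U = (\<lambda>(t, x). radial_ext (u t) x)"
  define U' where "U' p = frechet_derivative U (at p) (1, 0)" for p
  let ?S = "{0<..} \<times> (UNIV - {0::'a})"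
  have U: "smooth_on U ?S" using u by (simp add: smooth_spacetime_def U_def)
  have D: "((\<lambda>r. u r (sgn x)) has_real_derivative U' (t, x)) (at t)" if "0 < t" "x \<noteq> 0" for t x
  proof -
    have 1: "((\<lambda>r. (r, x)) has_derivative (\<lambda>h. (h, 0))) (at t)"
      by (auto intro!: has_derivative_Pair)
    have 2: "(U has_derivative frechet_derivative U (at (t, x))) (at (t, x))"
      using that by (intro smooth_on_has_derivative[OF U]) auto
    have "((\<lambda>r. U (r, x)) has_derivative (\<lambda>h. frechet_derivative U (at (t, x)) (h, 0))) (at t)"
      by (rule has_derivative_compose[OF 1 2])
    moreover have "frechet_derivative U (at (t, x)) (h, 0) = U' (t, x) * h" for h
      using linear_cmul[OF has_derivative_linear[OF 2], of h "(1, 0)"] by (simp add: U'_def)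
    ultimately show ?thesis
      by (simp add: has_field_derivative_def U_def radial_ext_def)
  qed
  have U'_eq: "U' (t, x) = radial_ext (dtau u t) x" if "0 < t" "x \<noteq> 0" for t x
    using DERIV_imp_deriv[OF D[OF that]] by (simp add: radial_ext_def dtau_def)
  have "(1, 0) \<in> (Basis :: (real \<times> 'a) set)" by (simp add: Basis_prod_def)
  then have "smooth_on U' ?S"
    unfolding U'_def by (intro smooth_on_frechet_derivative U)
  then show "smooth_spacetime (dtau u)"
    unfolding smooth_spacetime_def
  proof (rule smooth_on_cong[rotated])
    show "U' p = (case p of (t, x) \<Rightarrow> radial_ext (dtau u t) x)" if "p \<in> ?S" for p
      using that U'_eq[of "fst p" "snd p"] by (cases p) simp
  qed (auto intro!: open_Times)
  show "((\<lambda>r. u r x) has_real_derivative dtau u t x) (at t)" if "0 < t" "x \<in> sphere 0 1"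
  proof -
    have "x \<noteq> 0" "sgn x = x" using that(2) by (auto simp: sgn_div_norm)
    then show ?thesis
      using D[OF that(1) \<open>x \<noteq> 0\<close>] U'_eq[OF that(1) \<open>x \<noteq> 0\<close>] by (simp add: radial_ext_def)
  qed
qed

text \<open>Differentiation under the integral: on a compact time interval around \<open>t\<close>,
  away from 0, the time derivative is bounded on the whole sphere, and by the mean value inequality
  so are the difference quotients.\<close>

lemma l2_inner_has_derivative:
  fixes u :: "real \<Rightarrow> 'a::euclidean_space \<Rightarrow> real"
  assumes u: "smooth_spacetime u" and p: "continuous_on (sphere 0 1) p" and t: "0 < t"
  shows "((\<lambda>r. l2_inner (u r) p) has_real_derivative l2_inner (dtau u t) p) (at t)"
proof -
  let ?J = "{t / 2<..<2 * t}"
  note du = smooth_spacetime_dtau[OF u]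
  have cont: "continuous_on (sphere 0 1) (u r)" "continuous_on (sphere 0 1) (dtau u r)" if "0 < r" for r
    using smooth_sphere_imp_continuous smooth_spacetime_slice[OF u that] smooth_spacetime_slice[OF du that]
    by blast+
  let ?I = "(\<lambda>(t, x). dtau u t x) ` ({t / 2..2 * t} \<times> sphere 0 1)"
  have "bounded ?I"
    using t by (intro compact_imp_bounded compact_continuous_image compact_Times
        continuous_on_subset[OF smooth_spacetime_continuous[OF du]]) auto
  then obtain K where K0: "\<forall>z\<in>?I. norm z \<le> K"
    unfolding bounded_iff ..
  have K: "norm (dtau u r x) \<le> K" if "r \<in> ?J" "x \<in> sphere 0 1" for r x
  proof (rule K0[rule_format], rule image_eqI)
    show "(r, x) \<in> {t / 2..2 * t} \<times> sphere 0 1" using that by auto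
  qed simp
  obtain P where P: "\<And>x. x \<in> sphere 0 1 \<Longrightarrow> \<bar>p x\<bar> \<le> P" "P > 0"
    using bounded_on_sphere[OF p] by metis
  have quot: "norm ((u r x - u t x) / (r - t)) \<le> K" if "r \<in> ?J" "r \<noteq> t" "x \<in> sphere 0 1" for r x
  proof -
    have "norm (u r x - u t x) \<le> K * norm (r - t)"
    proof (rule field_differentiable_bound[of ?J "\<lambda>r. u r x" "\<lambda>r. dtau u r x"])
      show "((\<lambda>r. u r x) has_field_derivative dtau u z x) (at z within ?J)" if "z \<in> ?J" for z
        using that t \<open>x \<in> sphere 0 1\<close>
        by (intro has_field_derivative_at_within[OF dtau_has_derivative[OF u]]) auto
    qed (use that t K in auto)
    then show ?thesis using that(2) by (simp add: divide_le_eq)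
  qed
  have "((\<lambda>r. (l2_inner (u r) p - l2_inner (u t) p) / (r - t)) \<longlongrightarrow> l2_inner (dtau u t) p) (at t within ?J)"
    unfolding tendsto_at_iff_sequentially comp_def
  proof (intro allI impI)
    fix X assume X: "\<forall>i. X i \<in> ?J - {t}" and lim: "X \<longlonglongrightarrow> t"
    have Xpos: "0 < X i" for i using X t by (metis DiffD1 greaterThanLessThan_iff half_gt_zero less_trans)
    let ?q = "\<lambda>i x. (u (X i) x - u t x) / (X i - t) * p x"
    have eq: "(l2_inner (u (X i)) p - l2_inner (u t) p) / (X i - t) = (LINT x|sphere_measure. ?q i x)" for i
    proof -
      have "integrable sphere_measure (\<lambda>x. u (X i) x * p x)" "integrable sphere_measure (\<lambda>x. u t x * p x)"
        using cont Xpos t p by (auto intro!: integrable_sphere_mult)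
      then have "l2_inner (u (X i)) p - l2_inner (u t) p
          = (LINT x|sphere_measure. u (X i) x * p x - u t x * p x)"
        by (simp add: l2_inner_def)
      also have "\<dots> / (X i - t) = (LINT x|sphere_measure. (u (X i) x * p x - u t x * p x) / (X i - t))"
        by (rule integral_divide_zero[symmetric])
      finally show ?thesis by (simp add: left_diff_distrib)
    qed
    have "(\<lambda>i. LINT x|sphere_measure. ?q i x) \<longlonglongrightarrow> (LINT x|sphere_measure. dtau u t x * p x)"
    proof (rule integral_dominated_convergence[where w = "\<lambda>_. K * P"])
      show "(\<lambda>x. dtau u t x * p x) \<in> borel_measurable sphere_measure"
        by (intro continuous_measurable_sphere continuous_on_mult cont t p)
      show "?q i \<in> borel_measurable sphere_measure" for i
        using Xpos t p X by (intro continuous_measurable_sphere continuous_intros cont) auto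
      show "integrable sphere_measure (\<lambda>_::'a. K * P)"
        by (intro integrable_sphere continuous_intros)
      show "AE x in sphere_measure. (\<lambda>i. ?q i x) \<longlonglongrightarrow> dtau u t x * p x"
      proof (intro AE_I2 tendsto_mult_right)
        fix x :: 'a assume "x \<in> space sphere_measure"
        then have "((\<lambda>r. (u r x - u t x) / (r - t)) \<longlongrightarrow> dtau u t x) (at t)"
          using dtau_has_derivative[OF u t, of x] by (simp add: has_field_derivative_iff)
        moreover have "filterlim X (at t) sequentially"
          using lim X by (auto simp: filterlim_at)
        ultimately show "(\<lambda>i. (u (X i) x - u t x) / (X i - t)) \<longlonglongrightarrow> dtau u t x"
          by (rule filterlim_compose)
      qed
      show "AE x in sphere_measure. norm (?q i x) \<le> K * P" for i
      proof (intro AE_I2)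
        fix x :: 'a assume "x \<in> space sphere_measure"
        then have x: "x \<in> sphere 0 1" by simp
        have "norm ((u (X i) x - u t x) / (X i - t)) \<le> K" using X x by (intro quot) auto
        moreover from this have "0 \<le> K" by (rule order_trans[OF norm_ge_zero])
        ultimately show "norm (?q i x) \<le> K * P"
          unfolding norm_mult using P x by (intro mult_mono) auto
      qed
    qed
    then show "(\<lambda>i. (l2_inner (u (X i)) p - l2_inner (u t) p) / (X i - t)) \<longlonglongrightarrow> l2_inner (dtau u t) p"
      unfolding eq by (simp add: l2_inner_def)
  qed
  then have "((\<lambda>r. l2_inner (u r) p) has_real_derivative l2_inner (dtau u t) p) (at t within ?J)"
    by (simp add: has_field_derivative_iff)
  then show ?thesis
    using t by (simp add: at_within_open[of t ?J])
qed

section \<open>Uniform estimates for a single mode\<close>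

text \<open>\<open>Z\<close> times \<open>exp\<close> of \<open>p\<close> is nondecreasing, so the
  later time controls the earlier one. The rate is given through its antiderivative
  \<open>p\<close>, since one application has a rate that depends on time.\<close>

lemma gronwall_backward:
  fixes Z Z' p p' :: "real \<Rightarrow> real"
  assumes "t \<le> T"
    and Z: "\<And>x. t \<le> x \<Longrightarrow> x \<le> T \<Longrightarrow> (Z has_real_derivative Z' x) (at x)"
    and p: "\<And>x. t \<le> x \<Longrightarrow> x \<le> T \<Longrightarrow> (p has_real_derivative p' x) (at x)"
    and ge: "\<And>x. t \<le> x \<Longrightarrow> x \<le> T \<Longrightarrow> Z' x \<ge> - (p' x * Z x)"
  shows "Z t \<le> exp (p T - p t) * Z T"
proof -
  have "Z t * exp (p t) \<le> Z T * exp (p T)"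
  proof (rule DERIV_nonneg_imp_nondecreasing[OF \<open>t \<le> T\<close>])
    fix x assume x: "t \<le> x" "x \<le> T"
    have "((\<lambda>x. Z x * exp (p x)) has_real_derivative (Z' x + p' x * Z x) * exp (p x)) (at x)"
      by (rule derivative_eq_intros Z[OF x] p[OF x] refl)+ (simp add: algebra_simps)
    moreover have "(Z' x + p' x * Z x) * exp (p x) \<ge> 0"
      using ge[OF x] by simp
    ultimately show "\<exists>y. ((\<lambda>x. Z x * exp (p x)) has_real_derivative y) (at x) \<and> 0 \<le> y"
      by blast
  qed
  then show ?thesis
    by (simp add: exp_diff field_simps)
qed

text \<open>For \<open>x = exp (- 2 * y)\<close> the product is \<open>2 * y * exp (- y)\<close>,
  whose maximum \<open>2 / exp 1\<close> is below 1.\<close>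

lemma sqrt_mult_ln_le_one:
  fixes x :: real assumes "0 < x" "x \<le> 1"
  shows "sqrt x * \<bar>ln x\<bar> \<le> 1"
proof -
  define y where "y = - ln x / 2"
  have y: "0 \<le> y" "x = (exp (- y))\<^sup>2" "\<bar>ln x\<bar> = 2 * y"
    using assms by (auto simp: y_def simp flip: exp_double)
  have "y \<le> exp (y - 1)" using exp_ge_add_one_self[of "y - 1"] by simp
  then have "y * exp (- y) \<le> exp (y - 1) * exp (- y)" by (intro mult_right_mono) auto
  also have "\<dots> = 1 / exp (1::real)" by (simp add: exp_diff exp_minus field_simps)
  also have "\<dots> \<le> 1 / 2"
    using exp_ge_add_one_self[of "1::real"] by (intro divide_left_mono) auto
  finally have "exp (- y) * (2 * y) \<le> 1" by (simp add: mult_ac)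
  moreover have "sqrt x = exp (- y)" by (subst y(2)) simp
  ultimately show ?thesis unfolding y(3) by simp
qed

lemma mult_ln_le_one:
  fixes x :: real assumes "0 < x" "x \<le> 1"
  shows "x * \<bar>ln x\<bar> \<le> 1" "x * (ln x)\<^sup>2 \<le> 1"
proof -
  note * = sqrt_mult_ln_le_one[OF assms]
  have s: "0 \<le> sqrt x" "sqrt x \<le> 1" "x = sqrt x * sqrt x" using assms by auto
  have "x * \<bar>ln x\<bar> = sqrt x * (sqrt x * \<bar>ln x\<bar>)" using s(3) by (simp flip: mult.assoc)
  also have "\<dots> \<le> 1" using mult_le_one[OF s(2) _ *] s(1) by simp
  finally show "x * \<bar>ln x\<bar> \<le> 1" .
  have "x * (ln x)\<^sup>2 = (sqrt x * \<bar>ln x\<bar>)\<^sup>2" using assms by (simp add: power_mult_distrib)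
  also have "\<dots> \<le> 1" using * s(1) by (intro power_le_one) auto
  finally show "x * (ln x)\<^sup>2 \<le> 1" .
qed

lemma square_plus_1_pos: "0 < x\<^sup>2 + 1" for x :: real
  by (simp add: add_nonneg_pos)

lemma abs_mult_le: "\<bar>x * y\<bar> \<le> (x\<^sup>2 + y\<^sup>2) / 2" for x y :: real
proof -
  have "0 \<le> (\<bar>x\<bar> - \<bar>y\<bar>)\<^sup>2" by simp
  then show ?thesis by (simp add: power2_diff abs_mult)
qed

text \<open>The assumptions on \<open>T\<close> hold for \<open>T = 2\<^sup>-\<^sup>l\<close> with \<open>l\<close> the index of the dyadic block of \<open>\<kappa>\<close>.\<close>

locale mode_ode =
  fixes q M \<kappa> T :: real and f1 f2 f3 a a' c :: "real \<Rightarrow> real" and Oc hh c0 :: real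
  assumes q: "1 \<le> q" and M: "0 \<le> M" and lam: "0 \<le> \<kappa>"
    and T: "0 < T" "T \<le> 1" "\<kappa> * T \<le> 1" "1 \<le> 2 * T * sqrt (4 + \<kappa>\<^sup>2)"
    and f1: "\<And>\<tau>. 0 < \<tau> \<Longrightarrow> \<bar>f1 \<tau>\<bar> \<le> M" and f2: "\<And>\<tau>. 0 < \<tau> \<Longrightarrow> \<bar>f2 \<tau>\<bar> \<le> M"
    and f3: "\<And>\<tau>. 0 < \<tau> \<Longrightarrow> \<bar>f3 \<tau>\<bar> \<le> M"
    and deriv_a: "\<And>\<tau>. 0 < \<tau> \<Longrightarrow> (a has_real_derivative a' \<tau>) (at \<tau>)"
    and deriv_a': "\<And>\<tau>. 0 < \<tau> \<Longrightarrow> (a' has_real_derivative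
        f1 \<tau> * \<tau> * a' \<tau> + f2 \<tau> * \<tau>\<^sup>2 * a \<tau> + f3 \<tau> * c \<tau> - a' \<tau> / \<tau>
        - (4 * q + 4 * \<kappa>\<^sup>2 / (\<tau>\<^sup>2 + 1)\<^sup>2) * a \<tau>) (at \<tau>)"
    and deriv_c: "\<And>\<tau>. 0 < \<tau> \<Longrightarrow> (c has_real_derivative 2 * \<tau> * a \<tau>) (at \<tau>)"
    and lim_a: "((\<lambda>\<tau>. a \<tau> - Oc * ln \<tau> - hh) \<longlongrightarrow> 0) (at_right 0)"
    and lim_a': "((\<lambda>\<tau>. \<tau> * a' \<tau> - Oc) \<longlongrightarrow> 0) (at_right 0)"
    and lim_a'_ln: "((\<lambda>\<tau>. (\<tau> * a' \<tau> - Oc) * ln \<tau>) \<longlongrightarrow> 0) (at_right 0)"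
    and lim_c: "(c \<longlongrightarrow> c0) (at_right 0)"
begin

definition "\<omega>2 \<tau> = 4 * q + 4 * \<kappa>\<^sup>2 / (\<tau>\<^sup>2 + 1)\<^sup>2"
definition "F \<tau> = f1 \<tau> * \<tau> * a' \<tau> + f2 \<tau> * \<tau>\<^sup>2 * a \<tau> + f3 \<tau> * c \<tau>"

lemma deriv_a'_alt:
  "0 < \<tau> \<Longrightarrow> (a' has_real_derivative F \<tau> - a' \<tau> / \<tau> - \<omega>2 \<tau> * a \<tau>) (at \<tau>)"
  using deriv_a' by (simp add: F_def \<omega>2_def)

text \<open>\<open>q \<ge> 1\<close> accounts for the 4; up to time 1 the denominator is at most 4,
  which cancels the factor 4 in front of \<open>\<kappa>\<^sup>2\<close>.\<close>

lemma \<omega>2_lower: "0 < \<tau> \<Longrightarrow> \<tau> \<le> 1 \<Longrightarrow> 4 + \<kappa>\<^sup>2 \<le> \<omega>2 \<tau>"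
proof -
  assume \<tau>: "0 < \<tau>" "\<tau> \<le> 1"
  have "\<tau>\<^sup>2 \<le> 1" using \<tau> by (intro power_le_one) auto
  then have "(\<tau>\<^sup>2 + 1)\<^sup>2 \<le> 2\<^sup>2" by (intro power_mono) auto
  moreover have "0 < (\<tau>\<^sup>2 + 1)\<^sup>2" using square_plus_1_pos by (rule zero_less_power)
  ultimately have "\<kappa>\<^sup>2 \<le> 4 * \<kappa>\<^sup>2 / (\<tau>\<^sup>2 + 1)\<^sup>2"
    using mult_left_mono[of "(\<tau>\<^sup>2 + 1)\<^sup>2" 4 "\<kappa>\<^sup>2"]
    by (simp add: pos_le_divide_eq mult.commute)
  then show ?thesis using q unfolding \<omega>2_def by linarith
qed

lemma \<omega>2_upper: "\<omega>2 \<tau> \<le> 4 * q + 4 * \<kappa>\<^sup>2"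
proof -
  have "1 \<le> (\<tau>\<^sup>2 + 1)\<^sup>2" by (intro one_le_power) auto
  then have "4 * \<kappa>\<^sup>2 / (\<tau>\<^sup>2 + 1)\<^sup>2 \<le> 4 * \<kappa>\<^sup>2 / 1"
    using zero_less_power[OF square_plus_1_pos, of \<tau> 2] by (intro divide_left_mono) auto
  then show ?thesis unfolding \<omega>2_def by linarith
qed

text \<open>For \<open>\<tau> \<ge> T\<close> the substitution \<open>v = \<surd>\<tau> a\<close> removes the damping term \<open>a' / \<tau>\<close>; the price is a
  potential \<open>1 / (4 \<tau>\<^sup>2)\<close>, whose effect on the energy is integrable on \<open>[T, 1]\<close> uniformly in \<open>\<kappa>\<close>,
  because it is of size \<open>1 / (\<kappa> \<tau>\<^sup>2) \<sim> T / \<tau>\<^sup>2\<close>.\<close>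

definition "v \<tau> = sqrt \<tau> * a \<tau>"
definition "v' \<tau> = sqrt \<tau> * a' \<tau> + a \<tau> / (2 * sqrt \<tau>)"
text \<open>The wave energy of \<open>v\<close> together with the coefficient of chi. The weight
  \<open>\<mu> = 1\<close> measures chi at time 1 in order \<open>s - 1/2\<close>, a weight
  comparable to the frequency measures it in order \<open>s + 1/2\<close>.\<close>

definition "W \<mu> \<tau> = (v' \<tau>)\<^sup>2 + \<omega>2 \<tau> * (v \<tau>)\<^sup>2 + \<mu>\<^sup>2 * (c \<tau>)\<^sup>2"

lemma deriv_v: "0 < \<tau> \<Longrightarrow> (v has_real_derivative v' \<tau>) (at \<tau>)"
  unfolding v_def[abs_def] v'_def
  by (rule DERIV_real_sqrt deriv_a derivative_eq_intros refl | assumption)+ (simp add: field_simps)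

lemma deriv_v':
  assumes \<tau>: "0 < \<tau>"
  shows "(v' has_real_derivative sqrt \<tau> * F \<tau> - \<omega>2 \<tau> * v \<tau> - v \<tau> / (4 * \<tau>\<^sup>2)) (at \<tau>)"
proof -
  define s where "s = sqrt \<tau>"
  have s: "0 < s" "\<tau> = s\<^sup>2" using \<tau> by (auto simp: s_def)
  have nz: "2 * sqrt \<tau> \<noteq> 0" using \<tau> by simp
  have "(v' has_real_derivative inverse s / 2 * a' \<tau> + s * (F \<tau> - a' \<tau> / \<tau> - \<omega>2 \<tau> * a \<tau>)
      + (a' \<tau> * (2 * s) - a \<tau> * (2 * (inverse s / 2))) / (2 * s * (2 * s))) (at \<tau>)"
    unfolding v'_def[abs_def] s_def
    by (rule DERIV_real_sqrt[OF \<tau>] deriv_a[OF \<tau>] deriv_a'_alt[OF \<tau>] nz derivative_eq_intros refl)+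
      (simp add: algebra_simps)
  moreover have "inverse s / 2 * a' \<tau> + s * (F \<tau> - a' \<tau> / \<tau> - \<omega>2 \<tau> * a \<tau>)
      + (a' \<tau> * (2 * s) - a \<tau> * (2 * (inverse s / 2))) / (2 * s * (2 * s))
      = s * F \<tau> - \<omega>2 \<tau> * v \<tau> - v \<tau> / (4 * \<tau>\<^sup>2)"
    unfolding v_def s_def[symmetric] s(2) using s(1) by (simp add: field_simps power2_eq_square)
  ultimately show ?thesis by (simp add: s_def)
qed

lemma deriv_\<omega>2: "(\<omega>2 has_real_derivative - (16 * \<kappa>\<^sup>2 * \<tau> / (\<tau>\<^sup>2 + 1) ^ 3)) (at \<tau>)"
proof -
  have nz: "\<tau>\<^sup>2 + 1 \<noteq> 0" using square_plus_1_pos[of \<tau>] by linarith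
  have "(\<omega>2 has_real_derivative
      - (4 * \<kappa>\<^sup>2 * (2 * (\<tau>\<^sup>2 + 1) * (2 * \<tau>))) / ((\<tau>\<^sup>2 + 1)\<^sup>2 * (\<tau>\<^sup>2 + 1)\<^sup>2)) (at \<tau>)"
    unfolding \<omega>2_def[abs_def]
    by (rule derivative_eq_intros refl | simp add: nz)+
  moreover have "- (4 * \<kappa>\<^sup>2 * (2 * d * (2 * \<tau>))) / (d\<^sup>2 * d\<^sup>2) = - (16 * \<kappa>\<^sup>2 * \<tau> / d ^ 3)"
    if "d \<noteq> 0" for d :: real
    using that by (simp add: field_simps eval_nat_numeral)
  note this[OF nz]
  ultimately show ?thesis by (rule DERIV_cong)
qed

text \<open>Four terms survive in the derivative of \<open>W\<close>: the forcing at rate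
  \<open>6 * M\<close>, the change of \<open>\<omega>2\<close> at rate 16, the equation for chi at
  rate 2, and the potential at rate \<open>T / \<tau>\<^sup>2\<close>, whose integral over
  \<open>[T, 1]\<close> is below 1. Hence 19. The forcing uses \<open>1 \<le> \<mu>\<close>, and the
  upper bound on \<open>\<mu>\<close> lets \<open>\<omega>2\<close> absorb the source of
  chi.\<close>

lemma high_energy_le:
  assumes \<mu>: "1 \<le> \<mu>" "\<mu>\<^sup>2 \<le> 4 + \<kappa>\<^sup>2"
  shows "W \<mu> T \<le> exp (6 * M + 19) * W \<mu> 1"
proof -
  define K where "K = 6 * M + 18"
  define W' where "W' \<tau> = 2 * (v' \<tau> * (sqrt \<tau> * F \<tau>)) - v' \<tau> * v \<tau> / (2 * \<tau>\<^sup>2)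
      - 16 * \<kappa>\<^sup>2 * \<tau> / (\<tau>\<^sup>2 + 1) ^ 3 * (v \<tau>)\<^sup>2 + 4 * \<mu>\<^sup>2 * (sqrt \<tau> * (c \<tau> * v \<tau>))" for \<tau>
  have "W \<mu> T \<le> exp ((K * 1 - T / 1) - (K * T - T / T)) * W \<mu> 1"
  proof (rule gronwall_backward[where p' = "\<lambda>\<tau>. K + T / \<tau>\<^sup>2"])
    show "T \<le> 1" by (rule T(2))
  next
    fix \<tau> assume \<tau>T: "T \<le> \<tau>" "\<tau> \<le> 1"
    then have \<tau>: "0 < \<tau>" using T by linarith
    show "((\<lambda>\<tau>. K * \<tau> - T / \<tau>) has_real_derivative K + T / \<tau>\<^sup>2) (at \<tau>)"
      using \<tau> by (auto intro!: derivative_eq_intros simp: power2_eq_square)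
    have D: "(W \<mu> has_real_derivative
        2 * v' \<tau> * (sqrt \<tau> * F \<tau> - \<omega>2 \<tau> * v \<tau> - v \<tau> / (4 * \<tau>\<^sup>2))
        + (- (16 * \<kappa>\<^sup>2 * \<tau> / (\<tau>\<^sup>2 + 1) ^ 3) * (v \<tau>)\<^sup>2 + \<omega>2 \<tau> * (2 * v \<tau> * v' \<tau>))
        + \<mu>\<^sup>2 * (2 * c \<tau> * (2 * \<tau> * a \<tau>))) (at \<tau>)"
      unfolding W_def[abs_def]
      by (rule derivative_eq_intros deriv_v'[OF \<tau>] deriv_v[OF \<tau>] deriv_\<omega>2 deriv_c[OF \<tau>] refl)+
        (simp add: algebra_simps)
    have "\<tau> * a \<tau> = sqrt \<tau> * v \<tau>"
      using \<tau> by (simp add: v_def flip: mult.assoc)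
    then have e: "2 * \<tau> * a \<tau> = 2 * (sqrt \<tau> * v \<tau>)" by simp
    show "(W \<mu> has_real_derivative W' \<tau>) (at \<tau>)"
      using D unfolding e by (simp add: W'_def algebra_simps)
    define P Q R where "P = \<bar>v' \<tau>\<bar>" and "Q = \<bar>v \<tau>\<bar>" and "R = \<bar>c \<tau>\<bar>"
    have nn: "0 \<le> P" "0 \<le> Q" "0 \<le> R" by (auto simp: P_def Q_def R_def)
    have W: "W \<mu> \<tau> = P\<^sup>2 + \<omega>2 \<tau> * Q\<^sup>2 + \<mu>\<^sup>2 * R\<^sup>2" by (simp add: W_def P_def Q_def R_def)
    have om: "4 + \<kappa>\<^sup>2 \<le> \<omega>2 \<tau>" by (rule \<omega>2_lower[OF \<tau> \<tau>T(2)])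
    have om1: "1 * Q\<^sup>2 \<le> \<omega>2 \<tau> * Q\<^sup>2" and oml: "\<kappa>\<^sup>2 * Q\<^sup>2 \<le> \<omega>2 \<tau> * Q\<^sup>2"
      and omm: "\<mu>\<^sup>2 * Q\<^sup>2 \<le> \<omega>2 \<tau> * Q\<^sup>2" and om0: "(4 + \<kappa>\<^sup>2) * Q\<^sup>2 \<le> \<omega>2 \<tau> * Q\<^sup>2"
      using om \<mu> zero_le_power2[of \<kappa>] by (intro mult_right_mono; simp; linarith)+
    have "1 \<le> \<mu>\<^sup>2" using \<mu> by (simp add: one_le_power)
    then have mu1: "1 * R\<^sup>2 \<le> \<mu>\<^sup>2 * R\<^sup>2" by (intro mult_right_mono) auto
    have Wnn: "0 \<le> W \<mu> \<tau>" using om1 mu1 zero_le_power2[of P] zero_le_power2[of Q] zero_le_power2[of R] unfolding W by linarith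
    have sq1: "sqrt \<tau> \<le> 1" using \<tau>T by simp
    have t1: "\<bar>2 * (v' \<tau> * (sqrt \<tau> * F \<tau>))\<bar> \<le> 6 * M * W \<mu> \<tau>"
    proof -
      \<comment> \<open>The forcing in terms of the energy variables;
        \<open>\<tau> * v' \<tau> - v \<tau> / 2\<close> is what
        \<open>sqrt \<tau> * \<tau> * a' \<tau>\<close> becomes.\<close>
      have "sqrt \<tau> * F \<tau> = f1 \<tau> * (\<tau> * v' \<tau> - v \<tau> / 2) + f2 \<tau> * (\<tau>\<^sup>2 * v \<tau>) + f3 \<tau> * (sqrt \<tau> * c \<tau>)"
        using \<tau> by (simp add: F_def v'_def v_def field_simps)
      moreover have "\<bar>f1 \<tau> * (\<tau> * v' \<tau> - v \<tau> / 2)\<bar> \<le> M * (P + Q / 2)"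
      proof -
        have "\<bar>\<tau> * v' \<tau>\<bar> \<le> 1 * P" unfolding abs_mult P_def using \<tau> \<tau>T by (intro mult_right_mono) auto
        then have "\<bar>\<tau> * v' \<tau> - v \<tau> / 2\<bar> \<le> P + Q / 2" unfolding Q_def by linarith
        then show ?thesis unfolding abs_mult using f1[OF \<tau>] M by (intro mult_mono) auto
      qed
      moreover have "\<bar>f2 \<tau> * (\<tau>\<^sup>2 * v \<tau>)\<bar> \<le> M * Q"
      proof -
        have "\<tau>\<^sup>2 \<le> 1" using \<tau> \<tau>T by (intro power_le_one) auto
        then have "\<bar>\<tau>\<^sup>2 * v \<tau>\<bar> \<le> 1 * Q" unfolding abs_mult Q_def by (intro mult_right_mono) auto
        then show ?thesis unfolding abs_mult[of "f2 \<tau>"] using f2[OF \<tau>] M by (intro mult_mono) auto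
      qed
      moreover have "\<bar>f3 \<tau> * (sqrt \<tau> * c \<tau>)\<bar> \<le> M * R"
      proof -
        have "\<bar>sqrt \<tau> * c \<tau>\<bar> \<le> 1 * R" unfolding abs_mult R_def using sq1 \<tau> by (intro mult_right_mono) auto
        then show ?thesis unfolding abs_mult[of "f3 \<tau>"] using f3[OF \<tau>] M by (intro mult_mono) auto
      qed
      ultimately have "\<bar>sqrt \<tau> * F \<tau>\<bar> \<le> M * (P + Q / 2) + M * Q + M * R" by linarith
      then have "\<bar>2 * (v' \<tau> * (sqrt \<tau> * F \<tau>))\<bar> \<le> 2 * (P * (M * (P + Q / 2) + M * Q + M * R))"
        unfolding abs_mult[of 2] abs_mult[of "v' \<tau>"] P_def[symmetric] using nn by (simp add: mult_left_mono)
      also have "\<dots> = M * (2 * P\<^sup>2 + 3 * (P * Q) + 2 * (P * R))"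
        by (simp add: algebra_simps power2_eq_square)
      also have "\<dots> \<le> M * (6 * W \<mu> \<tau>)"
      proof (rule mult_left_mono[OF _ M])
        have "2 * (P * Q) \<le> P\<^sup>2 + Q\<^sup>2" "2 * (P * R) \<le> P\<^sup>2 + R\<^sup>2"
          using abs_mult_le[of P Q] abs_mult_le[of P R] by simp_all
        moreover from this(1) have "3 * (P * Q) \<le> 2 * P\<^sup>2 + 2 * Q\<^sup>2"
          using zero_le_power2[of P] zero_le_power2[of Q] by linarith
        moreover have "P\<^sup>2 + Q\<^sup>2 + R\<^sup>2 \<le> W \<mu> \<tau>" using om1 mu1 unfolding W by simp
        ultimately show "2 * P\<^sup>2 + 3 * (P * Q) + 2 * (P * R) \<le> 6 * W \<mu> \<tau>"
          using zero_le_power2[of P] zero_le_power2[of Q] zero_le_power2[of R] by linarith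
      qed
      finally show ?thesis by simp
    qed
    \<comment> \<open>The lower bound on \<open>T\<close> is spent here: it inserts the factor
      \<open>2 * T * w\<close>, and \<open>w\<close> turns \<open>Q\<close> into a quantity
      controlled by the energy.\<close>
    have t2: "\<bar>v' \<tau> * v \<tau> / (2 * \<tau>\<^sup>2)\<bar> \<le> T / \<tau>\<^sup>2 * W \<mu> \<tau>"
    proof -
      define w where "w = sqrt (4 + \<kappa>\<^sup>2)"
      have w: "0 < w" "w\<^sup>2 = 4 + \<kappa>\<^sup>2" by (auto simp: w_def add_pos_nonneg)
      have "P * Q \<le> (2 * T * w) * (P * Q)"
        using mult_right_mono[OF T(4), of "P * Q"] nn by (simp add: w_def)
      also have "\<dots> = 2 * T * (P * (w * Q))" by simp
      also have "\<dots> \<le> 2 * T * ((P\<^sup>2 + (w * Q)\<^sup>2) / 2)"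
        using abs_mult_le[of P "w * Q"] T(1) nn by (intro mult_left_mono) auto
      also have "\<dots> \<le> 2 * T * (W \<mu> \<tau> / 2)"
      proof -
        have "0 \<le> \<mu>\<^sup>2 * R\<^sup>2" by simp
        then have "P\<^sup>2 + (w * Q)\<^sup>2 \<le> W \<mu> \<tau>"
          using om0 unfolding W power_mult_distrib w by linarith
        then show ?thesis using T(1) by simp
      qed
      finally have "P * Q \<le> T * W \<mu> \<tau>" by simp
      then have "P * Q / (2 * \<tau>\<^sup>2) \<le> T * W \<mu> \<tau> / (2 * \<tau>\<^sup>2)" by (intro divide_right_mono) auto
      also have "\<dots> \<le> T * W \<mu> \<tau> / \<tau>\<^sup>2"
        using Wnn T \<tau> by (intro divide_left_mono) auto
      finally show ?thesis by (simp add: P_def Q_def abs_mult)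
    qed
    have t3: "\<bar>16 * \<kappa>\<^sup>2 * \<tau> / (\<tau>\<^sup>2 + 1) ^ 3 * (v \<tau>)\<^sup>2\<bar> \<le> 16 * W \<mu> \<tau>"
    proof -
      have "\<tau> / (\<tau>\<^sup>2 + 1) ^ 3 \<le> 1 / 1"
        using \<tau> \<tau>T by (intro frac_le) (auto intro!: one_le_power)
      have "\<bar>16 * \<kappa>\<^sup>2 * \<tau> / (\<tau>\<^sup>2 + 1) ^ 3 * (v \<tau>)\<^sup>2\<bar> = 16 * (\<kappa>\<^sup>2 * Q\<^sup>2) * (\<tau> / (\<tau>\<^sup>2 + 1) ^ 3)"
        using \<tau> by (simp add: abs_mult Q_def)
      also have "\<dots> \<le> 16 * (\<kappa>\<^sup>2 * Q\<^sup>2) * 1"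
        using \<open>\<tau> / (\<tau>\<^sup>2 + 1) ^ 3 \<le> 1 / 1\<close> by (intro mult_left_mono) auto
      also have "\<dots> \<le> 16 * W \<mu> \<tau>"
      proof -
        have "0 \<le> \<mu>\<^sup>2 * R\<^sup>2" "0 \<le> P\<^sup>2" by auto
        then have "\<kappa>\<^sup>2 * Q\<^sup>2 \<le> W \<mu> \<tau>" using oml unfolding W by linarith
        then show ?thesis by simp
      qed
      finally show ?thesis .
    qed
    have t4: "\<bar>4 * \<mu>\<^sup>2 * (sqrt \<tau> * (c \<tau> * v \<tau>))\<bar> \<le> 2 * W \<mu> \<tau>"
    proof -
      have "\<bar>4 * \<mu>\<^sup>2 * (sqrt \<tau> * (c \<tau> * v \<tau>))\<bar> = (4 * \<mu>\<^sup>2 * (R * Q)) * sqrt \<tau>"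
        using \<tau> by (simp add: abs_mult R_def Q_def)
      also have "\<dots> \<le> (4 * \<mu>\<^sup>2 * (R * Q)) * 1"
        using nn sq1 by (intro mult_left_mono) auto
      also have "\<dots> \<le> 4 * \<mu>\<^sup>2 * ((R\<^sup>2 + Q\<^sup>2) / 2)"
        using abs_mult_le[of R Q] nn mult_left_mono[of "2 * (R * Q)" "R\<^sup>2 + Q\<^sup>2" "\<mu>\<^sup>2"]
        by (simp add: mult_ac)
      also have "\<dots> = 2 * (\<mu>\<^sup>2 * R\<^sup>2) + 2 * (\<mu>\<^sup>2 * Q\<^sup>2)" by (simp add: algebra_simps)
      also have "\<dots> \<le> 2 * W \<mu> \<tau>"
      proof -
        have "\<mu>\<^sup>2 * R\<^sup>2 + \<mu>\<^sup>2 * Q\<^sup>2 \<le> W \<mu> \<tau>" using omm zero_le_power2[of P] unfolding W by linarith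
        then show ?thesis by linarith
      qed
      finally show ?thesis .
    qed
    have "(K + T / \<tau>\<^sup>2) * W \<mu> \<tau> = 6 * M * W \<mu> \<tau> + 16 * W \<mu> \<tau> + 2 * W \<mu> \<tau> + T / \<tau>\<^sup>2 * W \<mu> \<tau>"
      by (simp add: K_def algebra_simps)
    then show "- ((K + T / \<tau>\<^sup>2) * W \<mu> \<tau>) \<le> W' \<tau>"
      using t1 t2 t3 t4 unfolding W'_def by linarith
  qed
  also have "\<dots> \<le> exp (6 * M + 19) * W \<mu> 1"
  proof (rule mult_right_mono)
    have "0 \<le> K * T" using T M by (simp add: K_def)
    then show "exp ((K * 1 - T / 1) - (K * T - T / T)) \<le> exp (6 * M + 19)"
      using T by (simp add: K_def)
    show "0 \<le> W \<mu> 1" using q by (simp add: W_def \<omega>2_def)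
  qed
  finally show ?thesis .
qed

lemma high_energy_at_1: "W \<mu> 1 \<le> 2 * (a' 1)\<^sup>2 + (4 * q + 1) * (1 + \<kappa>\<^sup>2) * (a 1)\<^sup>2 + \<mu>\<^sup>2 * (c 1)\<^sup>2"
proof -
  have "W \<mu> 1 = (a' 1 + a 1 / 2)\<^sup>2 + (4 * q + \<kappa>\<^sup>2) * (a 1)\<^sup>2 + \<mu>\<^sup>2 * (c 1)\<^sup>2"
    by (simp add: W_def v'_def v_def \<omega>2_def)
  moreover have "(a' 1 + a 1 / 2)\<^sup>2 \<le> 2 * (a' 1)\<^sup>2 + 1 / 2 * (a 1)\<^sup>2"
  proof -
    have "0 \<le> (a' 1 - a 1 / 2)\<^sup>2" by simp
    then show ?thesis by (simp add: power2_eq_square algebra_simps)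
  qed
  moreover have "(1 / 2 + 4 * q + \<kappa>\<^sup>2) * (a 1)\<^sup>2 \<le> (4 * q + 1) * (1 + \<kappa>\<^sup>2) * (a 1)\<^sup>2"
    using q by (intro mult_right_mono) (auto simp: algebra_simps)
  ultimately show ?thesis by (simp add: distrib_right)
qed

text \<open>The factor \<open>T\<close>, comparable to the inverse frequency, is the source of the
  gained half derivative. It appears because \<open>T * (a T)\<^sup>2\<close> is
  \<open>(v T)\<^sup>2\<close>, which the lower bound on \<open>T\<close> places below a multiple of
  \<open>T\<^sup>2\<close> times the energy.\<close>

lemma data_le_high_energy:
  assumes "1 \<le> \<mu>"
  shows "(a T)\<^sup>2 + (T * a' T)\<^sup>2 \<le> 6 * T * W \<mu> T" "\<mu>\<^sup>2 * (c T)\<^sup>2 \<le> W \<mu> T"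
proof -
  have om: "4 + \<kappa>\<^sup>2 \<le> \<omega>2 T" by (rule \<omega>2_lower[OF T(1,2)])
  have om0: "(4 + \<kappa>\<^sup>2) * (v T)\<^sup>2 \<le> \<omega>2 T * (v T)\<^sup>2" using om by (rule mult_right_mono) auto
  then have om1: "0 \<le> \<omega>2 T * (v T)\<^sup>2" using zero_le_power2[of \<kappa>] by (smt (verit) mult_nonneg_nonneg zero_le_power2)
  show "\<mu>\<^sup>2 * (c T)\<^sup>2 \<le> W \<mu> T" using om1 by (simp add: W_def)
  have W: "(v' T)\<^sup>2 + (4 + \<kappa>\<^sup>2) * (v T)\<^sup>2 \<le> W \<mu> T" using om0 by (simp add: W_def add_increasing2)
  have "1 \<le> (2 * T * sqrt (4 + \<kappa>\<^sup>2))\<^sup>2" using T(4) by (simp add: one_le_power)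
  also have "\<dots> = 4 * T\<^sup>2 * (4 + \<kappa>\<^sup>2)" by (simp add: power_mult_distrib add_nonneg_nonneg)
  finally have *: "1 * (v T)\<^sup>2 \<le> 4 * T\<^sup>2 * (4 + \<kappa>\<^sup>2) * (v T)\<^sup>2" by (rule mult_right_mono) auto
  have s: "sqrt T * sqrt T = T" "0 < sqrt T" using T by auto
  have "T * (a T)\<^sup>2 = (v T)\<^sup>2" using s by (simp add: v_def power_mult_distrib)
  also have "\<dots> \<le> 4 * T\<^sup>2 * ((4 + \<kappa>\<^sup>2) * (v T)\<^sup>2)" using * by (simp only: mult_1 mult.assoc)
  finally have "T * (a T)\<^sup>2 \<le> T * (4 * T * ((4 + \<kappa>\<^sup>2) * (v T)\<^sup>2))"
    by (simp add: power2_eq_square mult_ac)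
  then have 1: "(a T)\<^sup>2 \<le> 4 * T * ((4 + \<kappa>\<^sup>2) * (v T)\<^sup>2)" using T(1) by simp
  have "T * (2 * T * (a' T))\<^sup>2 = (2 * T * v' T - v T)\<^sup>2"
  proof -
    have "2 * T * v' T - v T = sqrt T * (2 * T * a' T)"
      using s by (simp add: v'_def v_def field_simps)
    then show ?thesis using T by (simp add: power_mult_distrib)
  qed
  also have "\<dots> \<le> 2 * (2 * T * v' T)\<^sup>2 + 2 * (v T)\<^sup>2"
  proof -
    have "0 \<le> (2 * T * v' T + v T)\<^sup>2" by simp
    then show ?thesis by (simp add: power2_eq_square algebra_simps)
  qed
  also have "\<dots> \<le> 8 * T\<^sup>2 * (v' T)\<^sup>2 + 2 * (4 * T\<^sup>2 * (4 + \<kappa>\<^sup>2) * (v T)\<^sup>2)"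
  proof -
    have "(2 * T * v' T)\<^sup>2 = 4 * T\<^sup>2 * (v' T)\<^sup>2" by (simp add: power_mult_distrib)
    then show ?thesis using * by linarith
  qed
  also have "\<dots> = T * (4 * (2 * T * ((v' T)\<^sup>2 + (4 + \<kappa>\<^sup>2) * (v T)\<^sup>2)))"
    by (simp add: power2_eq_square algebra_simps)
  finally have "(2 * T * a' T)\<^sup>2 \<le> 4 * (2 * T * ((v' T)\<^sup>2 + (4 + \<kappa>\<^sup>2) * (v T)\<^sup>2))" using T(1) by simp
  then have 2: "(T * a' T)\<^sup>2 \<le> 2 * T * ((v' T)\<^sup>2 + (4 + \<kappa>\<^sup>2) * (v T)\<^sup>2)"
    by (simp add: power_mult_distrib)
  have "4 * T * ((4 + \<kappa>\<^sup>2) * (v T)\<^sup>2) \<le> 4 * T * W \<mu> T"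
    using W T(1) by (intro mult_left_mono) (auto intro: order_trans[rotated])
  moreover have "2 * T * ((v' T)\<^sup>2 + (4 + \<kappa>\<^sup>2) * (v T)\<^sup>2) \<le> 2 * T * W \<mu> T"
    using W T(1) by (intro mult_left_mono) auto
  ultimately show "(a T)\<^sup>2 + (T * a' T)\<^sup>2 \<le> 6 * T * W \<mu> T"
    using 1 2 by linarith
qed

text \<open>For \<open>\<tau> \<le> T\<close> the pair \<open>B = \<tau> a'\<close>, \<open>D = a - B ln (\<tau> / T)\<close> has a limit \<open>(\<O>, h + \<O> ln T)\<close> at
  \<open>\<tau> = 0\<close>, and in terms of \<open>x = \<tau> / T\<close> it solves a linear system whose coefficients are bounded by
  multiples of \<open>x\<close>, \<open>x \<bar>ln x\<bar>\<close> and \<open>x (ln x)\<^sup>2\<close>, uniformly in \<open>\<kappa>\<close>.\<close>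

definition "B \<tau> = \<tau> * a' \<tau>"
definition "D \<tau> = a \<tau> - B \<tau> * ln (\<tau> / T)"
text \<open>The weight is admissible for \<open>T\<^sup>2 \<le> \<nu> \<le> 1 / T\<^sup>2\<close>:
  the lower bound absorbs the term with \<open>f3\<close> in the equation for \<open>B\<close>, the
  upper one the source in the equation for chi. The values used are \<open>T\<close> and
  \<open>1 / T\<close>.\<close>

definition "Z \<nu> \<tau> = (B \<tau>)\<^sup>2 + (D \<tau>)\<^sup>2 + \<nu>\<^sup>2 * (c \<tau>)\<^sup>2"
definition "B' \<tau> = \<tau> * (F \<tau> - \<omega>2 \<tau> * a \<tau>)"

lemma deriv_B: "0 < \<tau> \<Longrightarrow> (B has_real_derivative B' \<tau>) (at \<tau>)"
  unfolding B_def[abs_def] B'_def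
  by (rule deriv_a'_alt derivative_eq_intros refl | assumption)+ (simp add: field_simps)

lemma deriv_D:
  assumes \<tau>: "0 < \<tau>"
  shows "(D has_real_derivative - (B' \<tau> * ln (\<tau> / T))) (at \<tau>)"
proof -
  have "((\<lambda>\<tau>. ln (\<tau> / T)) has_real_derivative 1 / \<tau>) (at \<tau>)"
    using \<tau> T(1) by (auto intro!: derivative_eq_intros)
  from DERIV_mult[OF deriv_B[OF \<tau>] this]
  have "(D has_real_derivative a' \<tau> - (B' \<tau> * ln (\<tau> / T) + 1 / \<tau> * B \<tau>)) (at \<tau>)"
    unfolding D_def[abs_def] by (intro DERIV_diff deriv_a \<tau>)
  then show ?thesis using \<tau> by (simp add: B_def)
qed

text \<open>The quadratic form bounding the derivative is at most \<open>6 * Z\<close>;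
  differentiating squares doubles this, the coefficients contribute \<open>4 * q + 4 + M\<close>,
  and the equation for chi adds the last 4.\<close>

definition "low_rate = 12 * (4 * q + 4 + M) + 4"

text \<open>The rate is \<open>low_rate / T\<close> on an interval of length at most
  \<open>T\<close>, so the Gronwall factor does not depend on the frequency. The asymptotic data
  appear when the lower endpoint tends to 0.\<close>

lemma low_energy_le:
  assumes \<nu>: "T\<^sup>2 \<le> \<nu>" "\<nu> * T\<^sup>2 \<le> 1"
  shows "Oc\<^sup>2 + (hh + Oc * ln T)\<^sup>2 + \<nu>\<^sup>2 * c0\<^sup>2 \<le> exp low_rate * Z \<nu> T"
proof -
  define L where "L = 4 * q + 4 + M"
  have L: "0 \<le> L" "M \<le> L" using q M by (auto simp: L_def)
  have low_rate: "0 \<le> low_rate" using q M by (simp add: low_rate_def)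
  have \<nu>0: "0 < \<nu>" using \<nu>(1) zero_less_power[OF T(1), of 2] by linarith
  define Z' where "Z' \<tau> = 2 * (B \<tau> * B' \<tau>) - 2 * (D \<tau> * (B' \<tau> * ln (\<tau> / T)))
      + \<nu>\<^sup>2 * (4 * (c \<tau> * (\<tau> * a \<tau>)))" for \<tau>
  have Znn: "0 \<le> Z \<nu> \<tau>" for \<tau> by (simp add: Z_def)
  have low: "Z \<nu> t \<le> exp low_rate * Z \<nu> T" if t: "0 < t" "t < T" for t
  proof -
    have "Z \<nu> t \<le> exp (low_rate / T * T - low_rate / T * t) * Z \<nu> T"
    proof (rule gronwall_backward[where p' = "\<lambda>_. low_rate / T"])
      show "t \<le> T" using t by simp
    next
      fix \<tau> assume "t \<le> \<tau>" and \<tau>T: "\<tau> \<le> T"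
      then have \<tau>: "0 < \<tau>" using t by linarith
      show "((\<lambda>\<tau>. low_rate / T * \<tau>) has_real_derivative low_rate / T) (at \<tau>)"
        using T(1) by (auto intro!: derivative_eq_intros)
      have "(Z \<nu> has_real_derivative 2 * B \<tau> * B' \<tau> + 2 * D \<tau> * - (B' \<tau> * ln (\<tau> / T))
          + \<nu>\<^sup>2 * (2 * c \<tau> * (2 * \<tau> * a \<tau>))) (at \<tau>)"
        unfolding Z_def[abs_def]
        by (rule deriv_B[OF \<tau>] deriv_D[OF \<tau>] deriv_c[OF \<tau>] derivative_eq_intros refl)+
          (simp add: algebra_simps)
      then show "(Z \<nu> has_real_derivative Z' \<tau>) (at \<tau>)"
        by (simp add: Z'_def algebra_simps)
      define x y b d g where "x = \<tau> / T" and "y = \<bar>ln x\<bar>" and "b = \<bar>B \<tau>\<bar>" and "d = \<bar>D \<tau>\<bar>"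
        and "g = \<nu> * \<bar>c \<tau>\<bar>"
      have nn: "0 \<le> y" "0 \<le> b" "0 \<le> d" "0 \<le> g"
        using \<nu>0 by (auto simp: y_def b_def d_def g_def)
      have x: "0 < x" "x \<le> 1" "\<tau> = T * x" using \<tau> \<tau>T T by (auto simp: x_def)
      have xy: "x * y \<le> 1" "x * y\<^sup>2 \<le> 1"
        using mult_ln_le_one[OF x(1,2)] by (auto simp: y_def)
      have Z: "Z \<nu> \<tau> = b\<^sup>2 + d\<^sup>2 + g\<^sup>2"
        by (simp add: Z_def b_def d_def g_def power_mult_distrib)
      have A: "\<bar>a \<tau>\<bar> \<le> d + y * b"
      proof -
        have "a \<tau> = D \<tau> + B \<tau> * ln x" by (simp add: D_def x_def)
        then show ?thesis
          using abs_triangle_ineq[of "D \<tau>" "B \<tau> * ln x"] by (simp add: d_def b_def y_def abs_mult mult.commute)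
      qed
      define e where "e = d + y * b"
      have e: "0 \<le> e" using nn by (simp add: e_def)
      have T2: "0 < T\<^sup>2" "T\<^sup>2 \<le> 1" using T by (auto intro!: power_le_one)
      \<comment> \<open>The condition \<open>T\<^sup>2 \<le> \<nu>\<close> enters only for the chi
        term, which becomes \<open>M * g\<close>.\<close>
      have TF: "T\<^sup>2 * \<bar>F \<tau>\<bar> \<le> M * (b + e + g)"
      proof -
        have "\<bar>F \<tau>\<bar> \<le> \<bar>f1 \<tau> * B \<tau>\<bar> + \<bar>f2 \<tau> * (\<tau>\<^sup>2 * a \<tau>)\<bar> + \<bar>f3 \<tau> * c \<tau>\<bar>"
          unfolding F_def B_def by (simp add: mult.assoc)
        also have "\<dots> \<le> M * b + M * e + M * \<bar>c \<tau>\<bar>"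
        proof (intro add_mono)
          show "\<bar>f1 \<tau> * B \<tau>\<bar> \<le> M * b"
            using f1[OF \<tau>] unfolding abs_mult b_def by (intro mult_right_mono) auto
          have "\<tau>\<^sup>2 \<le> 1" using \<tau> \<tau>T T by (intro power_le_one) auto
          then have "\<bar>\<tau>\<^sup>2 * a \<tau>\<bar> \<le> 1 * e" unfolding abs_mult e_def using A by (intro mult_mono) auto
          then show "\<bar>f2 \<tau> * (\<tau>\<^sup>2 * a \<tau>)\<bar> \<le> M * e"
            using f2[OF \<tau>] M unfolding abs_mult[of "f2 \<tau>"] by (intro mult_mono) auto
          show "\<bar>f3 \<tau> * c \<tau>\<bar> \<le> M * \<bar>c \<tau>\<bar>"
            using f3[OF \<tau>] unfolding abs_mult by (intro mult_right_mono) auto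
        qed
        finally have "T\<^sup>2 * \<bar>F \<tau>\<bar> \<le> T\<^sup>2 * (M * b + M * e + M * \<bar>c \<tau>\<bar>)" using T2 by simp
        also have "\<dots> = T\<^sup>2 * (M * (b + e)) + M * (T\<^sup>2 * \<bar>c \<tau>\<bar>)" by (simp add: algebra_simps)
        also have "\<dots> \<le> 1 * (M * (b + e)) + M * g"
          using T2 M nn e \<nu>(1) unfolding g_def by (intro add_mono mult_mono mult_right_mono mult_left_mono) auto
        finally show ?thesis by (simp add: algebra_simps)
      qed
      have T\<omega>: "T\<^sup>2 * \<bar>\<omega>2 \<tau> * a \<tau>\<bar> \<le> (4 * q + 4) * e"
      proof -
        have "0 \<le> \<omega>2 \<tau>" using q by (simp add: \<omega>2_def)
        have "(\<kappa> * T)\<^sup>2 \<le> 1" using T lam by (intro power_le_one) auto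
        then have "4 * (T\<^sup>2 * \<kappa>\<^sup>2) \<le> 4" by (simp add: power_mult_distrib mult.commute)
        moreover have "T\<^sup>2 * (4 * q) \<le> 1 * (4 * q)" using T2 q by (intro mult_right_mono) auto
        moreover have "T\<^sup>2 * (4 * q + 4 * \<kappa>\<^sup>2) = T\<^sup>2 * (4 * q) + 4 * (T\<^sup>2 * \<kappa>\<^sup>2)"
          by (simp add: algebra_simps)
        ultimately have "T\<^sup>2 * (4 * q + 4 * \<kappa>\<^sup>2) \<le> 4 * q + 4" by linarith
        moreover have "T\<^sup>2 * \<omega>2 \<tau> \<le> T\<^sup>2 * (4 * q + 4 * \<kappa>\<^sup>2)" using \<omega>2_upper T2 by simp
        ultimately have "T\<^sup>2 * \<omega>2 \<tau> \<le> 4 * q + 4" by linarith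
        then have "(T\<^sup>2 * \<omega>2 \<tau>) * \<bar>a \<tau>\<bar> \<le> (4 * q + 4) * e"
          using A q e unfolding e_def by (intro mult_mono) auto
        then show ?thesis using \<open>0 \<le> \<omega>2 \<tau>\<close> by (simp add: abs_mult mult.assoc)
      qed
      have TB: "T * \<bar>B' \<tau>\<bar> \<le> x * (L * (b + e + g))"
      proof -
        have "T * \<bar>B' \<tau>\<bar> = x * (T\<^sup>2 * \<bar>F \<tau> - \<omega>2 \<tau> * a \<tau>\<bar>)"
          using x T by (simp add: B'_def abs_mult power2_eq_square)
        also have "\<dots> \<le> x * (T\<^sup>2 * (\<bar>F \<tau>\<bar> + \<bar>\<omega>2 \<tau> * a \<tau>\<bar>))"
          using x T2 by (intro mult_left_mono abs_triangle_ineq4) auto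
        also have "\<dots> \<le> x * (L * (b + e + g))"
        proof (intro mult_left_mono)
          have "(4 * q + 4) * e \<le> (4 * q + 4) * (b + e + g)"
            using q nn by (intro mult_left_mono) auto
          then show "T\<^sup>2 * (\<bar>F \<tau>\<bar> + \<bar>\<omega>2 \<tau> * a \<tau>\<bar>) \<le> L * (b + e + g)"
            using TF T\<omega> unfolding L_def distrib_left distrib_right by linarith
        qed (use x in auto)
        finally show ?thesis .
      qed
      have "T * \<bar>Z' \<tau>\<bar> \<le> T * (2 * (b * \<bar>B' \<tau>\<bar>) + 2 * (d * (\<bar>B' \<tau>\<bar> * y)) + 4 * (\<nu>\<^sup>2 * (\<bar>c \<tau>\<bar> * (\<tau> * \<bar>a \<tau>\<bar>))))"
      proof (rule mult_left_mono)
        have "\<bar>2 * (B \<tau> * B' \<tau>)\<bar> = 2 * (b * \<bar>B' \<tau>\<bar>)" by (simp add: abs_mult b_def)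
        moreover have "\<bar>2 * (D \<tau> * (B' \<tau> * ln (\<tau> / T)))\<bar> = 2 * (d * (\<bar>B' \<tau>\<bar> * y))"
          by (simp add: abs_mult d_def y_def x_def)
        moreover have "\<bar>\<nu>\<^sup>2 * (4 * (c \<tau> * (\<tau> * a \<tau>)))\<bar> = 4 * (\<nu>\<^sup>2 * (\<bar>c \<tau>\<bar> * (\<tau> * \<bar>a \<tau>\<bar>)))"
          using \<tau> by (simp add: abs_mult)
        ultimately show "\<bar>Z' \<tau>\<bar> \<le> 2 * (b * \<bar>B' \<tau>\<bar>) + 2 * (d * (\<bar>B' \<tau>\<bar> * y)) + 4 * (\<nu>\<^sup>2 * (\<bar>c \<tau>\<bar> * (\<tau> * \<bar>a \<tau>\<bar>)))"
          unfolding Z'_def by linarith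
      qed (use T in simp)
      also have "\<dots> = 2 * (b + y * d) * (T * \<bar>B' \<tau>\<bar>) + 4 * ((x * g) * ((\<nu> * T\<^sup>2) * \<bar>a \<tau>\<bar>))"
        unfolding g_def x(3) by (simp add: algebra_simps power2_eq_square)
      also have "\<dots> \<le> 2 * (b + y * d) * (x * (L * (b + e + g))) + 4 * ((x * g) * (1 * e))"
      proof (intro add_mono)
        show "2 * (b + y * d) * (T * \<bar>B' \<tau>\<bar>) \<le> 2 * (b + y * d) * (x * (L * (b + e + g)))"
          using TB nn by (intro mult_left_mono) auto
        have "(\<nu> * T\<^sup>2) * \<bar>a \<tau>\<bar> \<le> 1 * e"
          using \<nu>(2) A \<nu>0 T2 e by (intro mult_mono) (auto simp: e_def)
        then show "4 * ((x * g) * ((\<nu> * T\<^sup>2) * \<bar>a \<tau>\<bar>)) \<le> 4 * ((x * g) * (1 * e))"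
          using x(1) nn by (intro mult_left_mono) auto
      qed
      also have "\<dots> \<le> low_rate * Z \<nu> \<tau>"
      proof -
        \<comment> \<open>Every monomial carries a factor \<open>x\<close>. At worst it meets two
          logarithms, one from the derivative of \<open>D\<close> and one from writing
          \<open>a\<close> as \<open>D + B * ln x\<close>.\<close>
        have P: "x * (p * r) \<le> p * r" "x * y * (p * r) \<le> p * r" "x * y\<^sup>2 * (p * r) \<le> p * r"
          if "0 \<le> p" "0 \<le> r" for p r
          using that x xy mult_right_mono[of _ 1 "p * r"] by force+
        have "(b + y * d) * (x * (b + e + g)) = x * (b * b) + x * (b * d) + x * y * (b * b) + x * (b * g)
            + x * y * (b * d) + x * y * (d * d) + x * y\<^sup>2 * (b * d) + x * y * (d * g)"
          by (simp add: e_def algebra_simps power2_eq_square)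
        also have "\<dots> \<le> b * b + b * d + b * b + b * g + b * d + d * d + b * d + d * g"
          using nn by (intro add_mono P)
        also have "\<dots> \<le> 6 * Z \<nu> \<tau>"
        proof -
          have "b * d \<le> b * b + d * d" "b * g \<le> b * b + g * g" "d * g \<le> d * d + g * g"
            using abs_mult_le[of b d] abs_mult_le[of b g] abs_mult_le[of d g] zero_le_square[of b]
              zero_le_square[of d] zero_le_square[of g] by (auto simp: power2_eq_square)
          then show ?thesis
            using zero_le_square[of d] zero_le_square[of g] unfolding Z power2_eq_square by (smt (verit))
        qed
        finally have "2 * L * ((b + y * d) * (x * (b + e + g))) \<le> 2 * L * (6 * Z \<nu> \<tau>)"
          using L by (intro mult_left_mono) auto
        moreover have "(x * g) * (1 * e) \<le> Z \<nu> \<tau>"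
        proof -
          have "(x * g) * (1 * e) = x * (g * d) + x * y * (g * b)" by (simp add: e_def algebra_simps)
          also have "\<dots> \<le> g * d + g * b" using nn by (intro add_mono P)
          also have "\<dots> \<le> Z \<nu> \<tau>"
          proof -
            have "0 \<le> (g - d)\<^sup>2 + (g - b)\<^sup>2 + b\<^sup>2 + d\<^sup>2" by simp
            then show ?thesis unfolding Z by (simp add: power2_eq_square algebra_simps)
          qed
          finally show ?thesis .
        qed
        ultimately have "2 * L * ((b + y * d) * (x * (b + e + g))) + 4 * ((x * g) * (1 * e))
            \<le> 2 * L * (6 * Z \<nu> \<tau>) + 4 * Z \<nu> \<tau>" by linarith
        then show ?thesis
          by (simp add: low_rate_def L_def algebra_simps)
      qed
      finally have "T * \<bar>Z' \<tau>\<bar> \<le> low_rate * Z \<nu> \<tau>" .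
      then have "\<bar>Z' \<tau>\<bar> \<le> low_rate / T * Z \<nu> \<tau>" using T(1) by (simp add: field_simps)
      then show "- (low_rate / T * Z \<nu> \<tau>) \<le> Z' \<tau>" by linarith
    qed
    also have "\<dots> \<le> exp low_rate * Z \<nu> T"
      using low_rate t T(1) Znn by (intro mult_right_mono) auto
    finally show ?thesis .
  qed
  have BO: "(B \<longlongrightarrow> Oc) (at_right 0)"
    using tendsto_add[OF lim_a' tendsto_const[of Oc]] by (simp add: B_def[abs_def])
  \<comment> \<open>\<open>D\<close> regrouped so that \<open>B - Oc\<close>, and not
    \<open>B\<close>, multiplies \<open>ln \<tau>\<close>. Convergence of \<open>B\<close> alone
    would not suffice; \<open>lim_a'_ln\<close> is required.\<close>
  have "((\<lambda>\<tau>. (a \<tau> - Oc * ln \<tau> - hh) - (\<tau> * a' \<tau> - Oc) * ln \<tau> + B \<tau> * ln T + hh)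
      \<longlongrightarrow> 0 - 0 + Oc * ln T + hh) (at_right 0)"
    by (intro tendsto_intros lim_a lim_a'_ln BO)
  moreover have "eventually (\<lambda>\<tau>. (a \<tau> - Oc * ln \<tau> - hh) - (\<tau> * a' \<tau> - Oc) * ln \<tau> + B \<tau> * ln T + hh = D \<tau>)
      (at_right 0)"
    using eventually_at_right_less[of 0]
    by eventually_elim (use T(1) in \<open>simp add: D_def B_def ln_div algebra_simps\<close>)
  ultimately have "(D \<longlongrightarrow> hh + Oc * ln T) (at_right 0)"
    by (simp add: tendsto_cong add.commute)
  then have "(Z \<nu> \<longlongrightarrow> Oc\<^sup>2 + (hh + Oc * ln T)\<^sup>2 + \<nu>\<^sup>2 * c0\<^sup>2) (at_right 0)"
    unfolding Z_def[abs_def] by (intro tendsto_intros BO lim_c)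
  moreover have "eventually (\<lambda>t. Z \<nu> t \<le> exp low_rate * Z \<nu> T) (at_right 0)"
    using eventually_at_right_less[of 0] eventually_at_rightI[of 0 T "\<lambda>t. t < T"] T(1)
    by (auto elim!: eventually_elim2 intro: low)
  ultimately show ?thesis
    by (rule tendsto_upperbound) simp
qed

section \<open>Asymptotic data of one mode in terms of its data at time 1\<close>

definition "mode_const = exp low_rate * exp (6 * M + 19) * (4 * q + 1) * 100"

lemma T_mult_frequency_le: "T * sqrt (1 + \<kappa>\<^sup>2) \<le> 2" "T\<^sup>2 * (1 + \<kappa>\<^sup>2) \<le> 2"
proof -
  have "T\<^sup>2 \<le> 1" "(\<kappa> * T)\<^sup>2 \<le> 1" using T lam by (auto intro!: power_le_one)
  then show *: "T\<^sup>2 * (1 + \<kappa>\<^sup>2) \<le> 2" by (simp add: power_mult_distrib algebra_simps)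
  have "T * sqrt (1 + \<kappa>\<^sup>2) = sqrt (T\<^sup>2 * (1 + \<kappa>\<^sup>2))" using T by (simp add: real_sqrt_mult)
  also have "\<dots> \<le> sqrt 4" using * by (intro real_sqrt_le_mono) simp
  finally show "T * sqrt (1 + \<kappa>\<^sup>2) \<le> 2" by simp
qed

text \<open>The weights are \<open>\<mu> = 1\<close> and \<open>\<nu> = T\<close>. With this
  \<open>\<nu>\<close>, chi at time \<open>T\<close> also contributes with a factor
  \<open>T\<close>, which pays for \<open>sqrt (1 + \<kappa>\<^sup>2)\<close> although
  \<open>c 1\<close> carries no frequency weight.\<close>

lemma mode_estimate_1:
  "sqrt (1 + \<kappa>\<^sup>2) * (Oc\<^sup>2 + (hh + Oc * ln T)\<^sup>2) \<le> mode_const * ((1 + \<kappa>\<^sup>2) * (a 1)\<^sup>2 + (a' 1)\<^sup>2 + (c 1)\<^sup>2)"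
proof -
  let ?S = "(1 + \<kappa>\<^sup>2) * (a 1)\<^sup>2 + (a' 1)\<^sup>2 + (c 1)\<^sup>2"
  define W1 where "W1 = W 1 T"
  have "W1 \<le> exp (6 * M + 19) * W 1 1" unfolding W1_def by (rule high_energy_le) auto
  also have "W 1 1 \<le> (4 * q + 1) * ?S"
  proof -
    have "2 * (a' 1)\<^sup>2 \<le> (4 * q + 1) * (a' 1)\<^sup>2" "1 * (c 1)\<^sup>2 \<le> (4 * q + 1) * (c 1)\<^sup>2"
      using q by (intro mult_right_mono; simp)+
    moreover define A where "A = (1 + \<kappa>\<^sup>2) * (a 1)\<^sup>2"
    have "W 1 1 \<le> 2 * (a' 1)\<^sup>2 + (4 * q + 1) * A + 1 * (c 1)\<^sup>2"
      using high_energy_at_1[of 1] by (simp add: A_def mult.assoc)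
    ultimately show ?thesis unfolding A_def[symmetric] distrib_left by linarith
  qed
  finally have W: "W1 \<le> exp (6 * M + 19) * ((4 * q + 1) * ?S)" by simp
  have T2: "T * T \<le> T" using T by (simp add: mult_left_le)
  have "Oc\<^sup>2 + (hh + Oc * ln T)\<^sup>2 \<le> Oc\<^sup>2 + (hh + Oc * ln T)\<^sup>2 + T\<^sup>2 * c0\<^sup>2" by simp
  also have "\<dots> \<le> exp low_rate * Z T T"
  proof (rule low_energy_le)
    show "T\<^sup>2 \<le> T" using T2 by (simp add: power2_eq_square)
    have "T * T\<^sup>2 \<le> 1 * 1" using T by (intro mult_mono power_le_one) auto
    then show "T * T\<^sup>2 \<le> 1" by simp
  qed
  also have "\<dots> \<le> exp low_rate * (7 * T * W1)"
  proof (rule mult_left_mono)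
    have "T\<^sup>2 * (c T)\<^sup>2 \<le> T * W1"
      using data_le_high_energy(2)[of 1] T2 T(1) unfolding W1_def by (intro mult_mono) (auto simp: power2_eq_square)
    then show "Z T T \<le> 7 * T * W1"
      using data_le_high_energy(1)[of 1] T(1) by (simp add: Z_def B_def D_def W1_def)
  qed simp
  finally have "sqrt (1 + \<kappa>\<^sup>2) * (Oc\<^sup>2 + (hh + Oc * ln T)\<^sup>2) \<le> sqrt (1 + \<kappa>\<^sup>2) * (exp low_rate * (7 * T * W1))"
    by (intro mult_left_mono) auto
  also have "\<dots> = exp low_rate * 7 * W1 * (T * sqrt (1 + \<kappa>\<^sup>2))" by simp
  also have "\<dots> \<le> exp low_rate * 7 * W1 * 2"
  proof -
    have "0 \<le> W1" using q by (simp add: W1_def W_def \<omega>2_def)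
    then show ?thesis using T_mult_frequency_le(1) by (intro mult_left_mono) auto
  qed
  \<comment> \<open>The constant needed is 14; the 100 in \<open>mode_const\<close> also covers the
    13 of the second estimate.\<close>
  also have "\<dots> \<le> exp low_rate * 100 * (exp (6 * M + 19) * ((4 * q + 1) * ?S))"
  proof -
    have "0 \<le> W1" using q by (simp add: W1_def W_def \<omega>2_def)
    then have "exp low_rate * 7 * W1 * 2 \<le> exp low_rate * 100 * W1" by simp
    also have "\<dots> \<le> exp low_rate * 100 * (exp (6 * M + 19) * ((4 * q + 1) * ?S))"
      using W by (intro mult_left_mono) auto
    finally show ?thesis .
  qed
  also have "\<dots> = mode_const * ?S" by (simp add: mode_const_def)
  finally show ?thesis .
qed

text \<open>The weights are \<open>\<mu> = w\<close> and \<open>\<nu> = 1 / T\<close>. Then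
  \<open>T\<^sup>2 * Z (1 / T) T\<close> contains \<open>(c T)\<^sup>2\<close> at full strength; the
  factor \<open>1 + \<kappa>\<^sup>2\<close> is paid by \<open>T\<^sup>2\<close> on the terms in
  \<open>a\<close> and by \<open>\<mu>\<^sup>2\<close> on the term in \<open>c\<close>.\<close>

lemma mode_estimate_2:
  "(1 + \<kappa>\<^sup>2) * c0\<^sup>2 \<le> mode_const * ((1 + \<kappa>\<^sup>2) * (a 1)\<^sup>2 + (a' 1)\<^sup>2 + (1 + \<kappa>\<^sup>2) * (c 1)\<^sup>2)"
proof -
  let ?S = "(1 + \<kappa>\<^sup>2) * (a 1)\<^sup>2 + (a' 1)\<^sup>2 + (1 + \<kappa>\<^sup>2) * (c 1)\<^sup>2"
  define w where "w = sqrt (4 + \<kappa>\<^sup>2)"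
  have w2: "w\<^sup>2 = 4 + \<kappa>\<^sup>2" by (simp add: w_def add_nonneg_nonneg)
  have w1: "1 \<le> w" by (simp add: w_def)
  define W1 where "W1 = W w T"
  have W10: "0 \<le> W1" using q by (simp add: W1_def W_def \<omega>2_def)
  have "W1 \<le> exp (6 * M + 19) * W w 1" unfolding W1_def by (rule high_energy_le) (use w1 w2 in auto)
  also have "W w 1 \<le> (4 * q + 1) * ?S"
  proof -
    have "2 * (a' 1)\<^sup>2 \<le> (4 * q + 1) * (a' 1)\<^sup>2" using q by (auto intro!: mult_right_mono)
    moreover define A C where "A = (1 + \<kappa>\<^sup>2) * (a 1)\<^sup>2" and "C = (1 + \<kappa>\<^sup>2) * (c 1)\<^sup>2"
    have "(4 + \<kappa>\<^sup>2) * (c 1)\<^sup>2 \<le> (4 * q + 1) * C"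
      unfolding C_def mult.assoc[symmetric]
    proof (rule mult_right_mono)
      have "0 \<le> q * (4 * \<kappa>\<^sup>2)" using q by simp
      moreover have "(4 * q + 1) * (1 + \<kappa>\<^sup>2) = 4 * q + 1 + \<kappa>\<^sup>2 + q * (4 * \<kappa>\<^sup>2)"
        by (simp add: algebra_simps)
      ultimately show "4 + \<kappa>\<^sup>2 \<le> (4 * q + 1) * (1 + \<kappa>\<^sup>2)"
        using q by linarith
    qed simp
    moreover have "W w 1 \<le> 2 * (a' 1)\<^sup>2 + (4 * q + 1) * A + (4 + \<kappa>\<^sup>2) * (c 1)\<^sup>2"
      using high_energy_at_1[of w] by (simp add: A_def mult.assoc w2)
    ultimately show ?thesis
      unfolding A_def[symmetric] C_def[symmetric] distrib_left[of "4 * q + 1"] mult.assoc by linarith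
  qed
  finally have W: "W1 \<le> exp (6 * M + 19) * ((4 * q + 1) * ?S)" by simp
  have "c0\<^sup>2 = T\<^sup>2 * ((1 / T)\<^sup>2 * c0\<^sup>2)" using T(1) by (simp add: power2_eq_square)
  also have "\<dots> \<le> T\<^sup>2 * (exp low_rate * Z (1 / T) T)"
  proof (rule mult_left_mono)
    have "Oc\<^sup>2 + (hh + Oc * ln T)\<^sup>2 + (1 / T)\<^sup>2 * c0\<^sup>2 \<le> exp low_rate * Z (1 / T) T"
    proof (rule low_energy_le)
      have "T\<^sup>2 \<le> 1" "1 \<le> 1 / T" using T by (auto intro!: power_le_one)
      then show "T\<^sup>2 \<le> 1 / T" by linarith
      show "1 / T * T\<^sup>2 \<le> 1" using T by (simp add: power2_eq_square)
    qed
    then show "(1 / T)\<^sup>2 * c0\<^sup>2 \<le> exp low_rate * Z (1 / T) T"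
      using zero_le_power2[of Oc] zero_le_power2[of "hh + Oc * ln T"] by linarith
  qed simp
  also have "T\<^sup>2 * (exp low_rate * Z (1 / T) T) = exp low_rate * (T\<^sup>2 * ((a T)\<^sup>2 + (T * a' T)\<^sup>2) + (c T)\<^sup>2)"
    using T(1) by (simp add: Z_def B_def D_def field_simps)
  finally have "(1 + \<kappa>\<^sup>2) * c0\<^sup>2 \<le> (1 + \<kappa>\<^sup>2) * (exp low_rate * (T\<^sup>2 * ((a T)\<^sup>2 + (T * a' T)\<^sup>2) + (c T)\<^sup>2))"
    by (intro mult_left_mono) (auto simp: add_nonneg_nonneg)
  also have "\<dots> = exp low_rate * ((T\<^sup>2 * (1 + \<kappa>\<^sup>2)) * ((a T)\<^sup>2 + (T * a' T)\<^sup>2) + (1 + \<kappa>\<^sup>2) * (c T)\<^sup>2)"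
  proof -
    have "m * (e * (t * p + r)) = e * ((t * m) * p + m * r)" for m e t p r :: real
      by (simp add: algebra_simps)
    then show ?thesis .
  qed
  also have "\<dots> \<le> exp low_rate * (2 * (6 * W1) + W1)"
  proof (intro mult_left_mono add_mono mult_mono T_mult_frequency_le(2))
    have "6 * T * W1 \<le> 6 * 1 * W1" using T W10 by (intro mult_right_mono) auto
    then show "(a T)\<^sup>2 + (T * a' T)\<^sup>2 \<le> 6 * W1" using data_le_high_energy(1)[OF w1] by (simp add: W1_def)
    have "(1 + \<kappa>\<^sup>2) * (c T)\<^sup>2 \<le> w\<^sup>2 * (c T)\<^sup>2" unfolding w2 by (intro mult_right_mono) auto
    then show "(1 + \<kappa>\<^sup>2) * (c T)\<^sup>2 \<le> W1" using data_le_high_energy(2)[OF w1] by (simp add: W1_def)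
  qed auto
  also have "\<dots> \<le> exp low_rate * 100 * W1" using W10 by simp
  also have "\<dots> \<le> exp low_rate * 100 * (exp (6 * M + 19) * ((4 * q + 1) * ?S))"
    using W by (intro mult_left_mono) auto
  also have "\<dots> = mode_const * ?S" by (simp add: mode_const_def)
  finally show ?thesis .
qed

end

section \<open>Summation over the modes\<close>

text \<open>Passes from squared coefficients to norms; subadditivity of the square root separates
  the three norms.\<close>

lemma sqrt_suminf_le:
  fixes X P Q R :: "nat \<Rightarrow> real"
  assumes X: "\<And>i. 0 \<le> X i" "\<And>i. X i \<le> C * (P i + Q i + R i)"
    and nn: "0 \<le> C" "\<And>i. 0 \<le> P i" "\<And>i. 0 \<le> Q i" "\<And>i. 0 \<le> R i"
    and s: "summable P" "summable Q" "summable R"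
  shows "sqrt (suminf X) \<le> sqrt C * (sqrt (suminf P) + sqrt (suminf Q) + sqrt (suminf R))"
proof -
  have sPQR: "summable (\<lambda>i. C * (P i + Q i + R i))"
    by (intro summable_mult summable_add s)
  have "summable X"
    by (rule summable_comparison_test'[OF sPQR, of 0]) (use X in auto)
  then have "suminf X \<le> (\<Sum>i. C * (P i + Q i + R i))"
    by (intro suminf_le X sPQR)
  also have "\<dots> = C * (suminf P + suminf Q + suminf R)"
    using s by (simp add: suminf_mult suminf_add summable_add)
  finally have "sqrt (suminf X) \<le> sqrt C * sqrt (suminf P + suminf Q + suminf R)"
    by (metis real_sqrt_le_mono real_sqrt_mult)
  also have "\<dots> \<le> sqrt C * (sqrt (suminf P) + sqrt (suminf Q) + sqrt (suminf R))"
  proof (rule mult_left_mono)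
    have "0 \<le> suminf P" "0 \<le> suminf Q" "0 \<le> suminf R" using nn s by (auto intro: suminf_nonneg)
    then show "sqrt (suminf P + suminf Q + suminf R) \<le> sqrt (suminf P) + sqrt (suminf Q) + sqrt (suminf R)"
      using sqrt_add_le_add_sqrt[of "suminf P + suminf Q" "suminf R"] sqrt_add_le_add_sqrt[of "suminf P" "suminf Q"]
      by simp
  qed (use nn in simp)
  finally show ?thesis .
qed

lemma tendsto_0_at_right_le_sqrt:
  fixes g :: "real \<Rightarrow> real"
  assumes "eventually (\<lambda>\<tau>. \<bar>g \<tau>\<bar> \<le> C * sqrt \<tau>) (at_right 0)"
  shows "(g \<longlongrightarrow> 0) (at_right 0)"
proof -
  have "((\<lambda>\<tau>::real. C * sqrt \<tau>) \<longlongrightarrow> C * sqrt 0) (at_right 0)"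
    by (intro tendsto_intros)
  then have "((\<lambda>\<tau>. \<bar>g \<tau>\<bar>) \<longlongrightarrow> 0) (at_right 0)"
    by (intro tendsto_sandwich[OF _ assms tendsto_const]) auto
  then show ?thesis by (rule tendsto_rabs_zero_cancel)
qed

context laplace_eigenbasis
begin

lemma coeff_bigo:
  assumes "Cinf_bigo \<phi> lam u r F" "eventually (\<lambda>t. continuous_on (sphere 0 1) (u t)) F"
  obtains C where "0 < C" "eventually (\<lambda>t. \<bar>l2_inner (u t) (\<phi> i)\<bar> \<le> C * \<bar>r t\<bar>) F"
proof -
  have "(\<lambda>t. sobolev_norm \<phi> lam (real 0) (u t)) \<in> O[F](r)"
    using assms(1) unfolding Cinf_bigo_def by blast
  then obtain C where C: "0 < C" "eventually (\<lambda>t. norm (sobolev_norm \<phi> lam (real 0) (u t)) \<le> C * norm (r t)) F"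
    by (rule landau_o.bigE)
  have "eventually (\<lambda>t. \<bar>l2_inner (u t) (\<phi> i)\<bar> \<le> C * \<bar>r t\<bar>) F"
    using C(2) assms(2)
  proof eventually_elim
    case (elim t)
    then show ?case using abs_coeff_le_sobolev_norm[OF elim(2), of i] by simp
  qed
  then show ?thesis using that C(1) by blast
qed

text \<open>Only differentiability at time 0 is used: \<open>w r\<close> is \<open>w 0\<close> plus
  \<open>r\<close> times a difference quotient whose coefficient converges.\<close>

lemma coeff_limit_of_C1_time:
  assumes "C1_time \<phi> lam w"
  shows "((\<lambda>t. l2_inner (w t) (\<phi> i)) \<longlongrightarrow> l2_inner (w 0) (\<phi> i)) (at_right 0)"
proof -
  obtain v where v: "\<forall>t\<ge>0. smooth_sphere (v t)"
    and lim: "\<forall>t\<ge>0. Cinf_tendsto \<phi> lam (\<lambda>r x. (w r x - w t x) / (r - t)) (v t) (at t within {0..})"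
    using assms unfolding C1_time_def by (elim conjE exE) (rule that)
  have cw: "continuous_on (sphere 0 1) (w t)" if "0 \<le> t" for t
    using assms that unfolding C1_time_def by (intro smooth_sphere_imp_continuous) simp
  have cv: "continuous_on (sphere 0 1) (v 0)" using v by (intro smooth_sphere_imp_continuous) auto
  let ?d = "\<lambda>r x. (w r x - w 0 x) / (r - 0) - v 0 x"
  have "((\<lambda>r. sobolev_norm \<phi> lam (real 0) (?d r)) \<longlongrightarrow> 0) (at 0 within {0..})"
    using lim[rule_format, of 0, unfolded Cinf_tendsto_def, rule_format, of 0] by simp
  then have lim0: "((\<lambda>r. sobolev_norm \<phi> lam (real 0) (?d r)) \<longlongrightarrow> 0) (at_right 0)"
    by (rule tendsto_within_subset) auto
  have "((\<lambda>r. l2_inner (?d r) (\<phi> i)) \<longlongrightarrow> 0) (at_right 0)"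
  proof (rule tendsto_rabs_zero_cancel, rule tendsto_sandwich[OF _ _ tendsto_const lim0])
    show "eventually (\<lambda>r. \<bar>l2_inner (?d r) (\<phi> i)\<bar> \<le> sobolev_norm \<phi> lam (real 0) (?d r)) (at_right 0)"
      using eventually_at_right_less[of 0]
    proof eventually_elim
      case (elim r)
      then show ?case
        by (intro abs_coeff_le_sobolev_norm continuous_intros cw cv) auto
    qed
  qed auto
  then have "((\<lambda>r. r * (l2_inner (?d r) (\<phi> i) + l2_inner (v 0) (\<phi> i)) + l2_inner (w 0) (\<phi> i))
      \<longlongrightarrow> 0 * (0 + l2_inner (v 0) (\<phi> i)) + l2_inner (w 0) (\<phi> i)) (at_right 0)"
    by (intro tendsto_intros)
  moreover have "eventually (\<lambda>r. r * (l2_inner (?d r) (\<phi> i) + l2_inner (v 0) (\<phi> i)) + l2_inner (w 0) (\<phi> i)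
      = l2_inner (w r) (\<phi> i)) (at_right 0)"
    using eventually_at_right_less[of 0]
  proof eventually_elim
    case (elim r)
    have "l2_inner (?d r) (\<phi> i) = l2_inner (\<lambda>x. (w r x - w 0 x) / (r - 0)) (\<phi> i) - l2_inner (v 0) (\<phi> i)"
      using elim by (intro l2_inner_diff_left continuous_intros cw cv continuous_phi) auto
    also have "l2_inner (\<lambda>x. (w r x - w 0 x) / (r - 0)) (\<phi> i) = 1 / r * l2_inner (\<lambda>x. w r x - w 0 x) (\<phi> i)"
      by (subst l2_inner_cmult_left[symmetric]) simp
    also have "l2_inner (\<lambda>x. w r x - w 0 x) (\<phi> i) = l2_inner (w r) (\<phi> i) - l2_inner (w 0) (\<phi> i)"
      using elim by (intro l2_inner_diff_left cw continuous_phi) auto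
    finally show ?case using elim by simp
  qed
  ultimately show ?thesis by (simp add: tendsto_cong)
qed

lemma coeff_log_expansion:
  assumes "continuous_on (sphere 0 1) f" "continuous_on (sphere 0 1) g" "continuous_on (sphere 0 1) h"
  shows "l2_inner (\<lambda>x. f x - (g x * c + h x)) (\<phi> i)
    = l2_inner f (\<phi> i) - l2_inner g (\<phi> i) * c - l2_inner h (\<phi> i)"
proof -
  have "l2_inner (\<lambda>x. f x - (g x * c + h x)) (\<phi> i) = l2_inner f (\<phi> i) - l2_inner (\<lambda>x. c * g x + h x) (\<phi> i)"
    using assms by (subst l2_inner_diff_left) (auto intro!: continuous_intros continuous_phi simp: mult.commute)
  also have "l2_inner (\<lambda>x. c * g x + h x) (\<phi> i) = c * l2_inner g (\<phi> i) + l2_inner h (\<phi> i)"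
    using assms by (subst l2_inner_add_left) (auto intro!: continuous_intros continuous_phi simp: l2_inner_cmult_left)
  finally show ?thesis by simp
qed

lemma mode_ode_coeff:
  assumes sol: "smooth_solution \<phi> lam q f1 f2 f3 chi0 Oc h \<alpha> chi"
    and q: "1 \<le> q" and M: "0 \<le> M"
    and f: "\<And>\<tau>. 0 < \<tau> \<Longrightarrow> \<bar>f1 \<tau>\<bar> \<le> M" "\<And>\<tau>. 0 < \<tau> \<Longrightarrow> \<bar>f2 \<tau>\<bar> \<le> M" "\<And>\<tau>. 0 < \<tau> \<Longrightarrow> \<bar>f3 \<tau>\<bar> \<le> M"
  shows "mode_ode q M (lam i) (1 / 2 ^ dyadic_index i) f1 f2 f3 (\<lambda>t. l2_inner (\<alpha> t) (\<phi> i))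
    (\<lambda>t. l2_inner (dtau \<alpha> t) (\<phi> i)) (\<lambda>t. l2_inner (chi t) (\<phi> i))
    (l2_inner Oc (\<phi> i)) (l2_inner h (\<phi> i)) (l2_inner chi0 (\<phi> i))"
proof -
  have sm: "smooth_sphere chi0" "smooth_sphere Oc" "smooth_sphere h"
    and st: "smooth_spacetime \<alpha>" "smooth_spacetime chi"
    and eqs: "solves_M q f1 f2 f3 \<alpha> chi"
    and big: "Cinf_bigo \<phi> lam (\<lambda>\<tau> x. \<alpha> \<tau> x - (Oc x * ln \<tau> + h x)) (\<lambda>\<tau>. \<tau>\<^sup>2 * \<bar>ln \<tau>\<bar>\<^sup>2) (at_right 0)"
      "Cinf_bigo \<phi> lam (\<lambda>\<tau> x. dtau \<alpha> \<tau> x - Oc x / \<tau>) (\<lambda>\<tau>. \<tau> * \<bar>ln \<tau>\<bar>\<^sup>2) (at_right 0)"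
    using sol unfolding smooth_solution_def by blast+
  obtain w where w: "C1_time \<phi> lam w" "\<And>\<tau> x. 0 < \<tau> \<Longrightarrow> x \<in> sphere 0 1 \<Longrightarrow> w \<tau> x = chi \<tau> x"
    "\<And>x. x \<in> sphere 0 1 \<Longrightarrow> w 0 x = chi0 x"
    using sol unfolding smooth_solution_def by blast
  note st' = smooth_spacetime_dtau[OF st(1)]
  have c0: "continuous_on (sphere 0 1) Oc" "continuous_on (sphere 0 1) h"
    using sm smooth_sphere_imp_continuous by blast+
  have c: "continuous_on (sphere 0 1) (\<alpha> \<tau>)" "continuous_on (sphere 0 1) (dtau \<alpha> \<tau>)"
    "continuous_on (sphere 0 1) (chi \<tau>)" "continuous_on (sphere 0 1) (sphere_laplacian (\<alpha> \<tau>))" if "0 < \<tau>" for \<tau>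
    using that st st' by (auto intro!: smooth_sphere_imp_continuous smooth_sphere_laplacian intro: smooth_spacetime_slice)
  show ?thesis
  proof
    show "1 \<le> q" "0 \<le> M" "0 \<le> lam i" by (rule q M lam_nonneg)+
    show "0 < 1 / (2::real) ^ dyadic_index i" "1 / (2::real) ^ dyadic_index i \<le> 1" by auto
    show "lam i * (1 / 2 ^ dyadic_index i) \<le> 1" using lam_le_dyadic[of i] by simp
    \<comment> \<open>In block 0, \<open>T = 1\<close> and the square root is at least 2. In block
      \<open>l + 1\<close>, \<open>2 * T\<close> is the inverse of \<open>2 ^ l\<close>, and the
      frequency exceeds \<open>2 ^ l\<close>.\<close>
    show "1 \<le> 2 * (1 / 2 ^ dyadic_index i) * sqrt (4 + (lam i)\<^sup>2)"
    proof (cases "dyadic_index i")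
      case 0
      have "sqrt 4 \<le> sqrt (4 + (lam i)\<^sup>2)" by (intro real_sqrt_le_mono) simp
      then show ?thesis using 0 by simp
    next
      case (Suc l)
      have "2 ^ l < lam i" using lt_lam_of_lt_dyadic_index[of l i] Suc by simp
      also have "lam i = sqrt ((lam i)\<^sup>2)" using lam_nonneg by simp
      also have "\<dots> \<le> sqrt (4 + (lam i)\<^sup>2)" by (intro real_sqrt_le_mono) simp
      finally show ?thesis using Suc by (simp add: field_simps)
    qed
    fix \<tau> :: real assume \<tau>: "0 < \<tau>"
    show "\<bar>f1 \<tau>\<bar> \<le> M" "\<bar>f2 \<tau>\<bar> \<le> M" "\<bar>f3 \<tau>\<bar> \<le> M" by (rule f[OF \<tau>])+
    show "((\<lambda>t. l2_inner (\<alpha> t) (\<phi> i)) has_real_derivative l2_inner (dtau \<alpha> \<tau>) (\<phi> i)) (at \<tau>)"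
      by (rule l2_inner_has_derivative[OF st(1) continuous_phi \<tau>])
    have "l2_inner (dtau chi \<tau>) (\<phi> i) = l2_inner (\<lambda>x. 2 * \<tau> * \<alpha> \<tau> x) (\<phi> i)"
      using eqs \<tau> unfolding solves_M_def by (intro l2_inner_cong) auto
    then show "((\<lambda>t. l2_inner (chi t) (\<phi> i)) has_real_derivative 2 * \<tau> * l2_inner (\<alpha> \<tau>) (\<phi> i)) (at \<tau>)"
      using l2_inner_has_derivative[OF st(2) continuous_phi \<tau>, of i] by (simp only: l2_inner_cmult_left)
    have "l2_inner (dtau (dtau \<alpha>) \<tau>) (\<phi> i) = l2_inner (\<lambda>x. (f1 \<tau> * \<tau> - 1 / \<tau>) * dtau \<alpha> \<tau> x
        + (f2 \<tau> * \<tau>\<^sup>2 - 4 * q) * \<alpha> \<tau> x + f3 \<tau> * chi \<tau> x + 4 / (\<tau>\<^sup>2 + 1)\<^sup>2 * sphere_laplacian (\<alpha> \<tau>) x) (\<phi> i)"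
    proof (rule l2_inner_cong)
      fix x :: 'a assume "x \<in> sphere 0 1"
      then have "dtau (dtau \<alpha>) \<tau> x + 1 / \<tau> * dtau \<alpha> \<tau> x + 4 * q * \<alpha> \<tau> x
            - 4 / (\<tau>\<^sup>2 + 1)\<^sup>2 * sphere_laplacian (\<alpha> \<tau>) x
          = f1 \<tau> * \<tau> * dtau \<alpha> \<tau> x + f2 \<tau> * \<tau>\<^sup>2 * \<alpha> \<tau> x + f3 \<tau> * chi \<tau> x"
        using eqs \<tau> unfolding solves_M_def by blast
      then show "dtau (dtau \<alpha>) \<tau> x = (f1 \<tau> * \<tau> - 1 / \<tau>) * dtau \<alpha> \<tau> x
        + (f2 \<tau> * \<tau>\<^sup>2 - 4 * q) * \<alpha> \<tau> x + f3 \<tau> * chi \<tau> x + 4 / (\<tau>\<^sup>2 + 1)\<^sup>2 * sphere_laplacian (\<alpha> \<tau>) x"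
        unfolding left_diff_distrib by linarith
    qed auto
    also have "\<dots> = (f1 \<tau> * \<tau> - 1 / \<tau>) * l2_inner (dtau \<alpha> \<tau>) (\<phi> i)
        + (f2 \<tau> * \<tau>\<^sup>2 - 4 * q) * l2_inner (\<alpha> \<tau>) (\<phi> i) + f3 \<tau> * l2_inner (chi \<tau>) (\<phi> i)
        + 4 / (\<tau>\<^sup>2 + 1)\<^sup>2 * l2_inner (sphere_laplacian (\<alpha> \<tau>)) (\<phi> i)"
      by (intro l2_inner_linear_combination c[OF \<tau>] continuous_phi)
    also have "\<dots> = f1 \<tau> * \<tau> * l2_inner (dtau \<alpha> \<tau>) (\<phi> i) + f2 \<tau> * \<tau>\<^sup>2 * l2_inner (\<alpha> \<tau>) (\<phi> i)
        + f3 \<tau> * l2_inner (chi \<tau>) (\<phi> i) - l2_inner (dtau \<alpha> \<tau>) (\<phi> i) / \<tau>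
        - (4 * q + 4 * (lam i)\<^sup>2 / (\<tau>\<^sup>2 + 1)\<^sup>2) * l2_inner (\<alpha> \<tau>) (\<phi> i)"
      using coeff_laplacian[OF smooth_spacetime_slice[OF st(1) \<tau>], of i] by (simp add: algebra_simps)
    finally show "((\<lambda>t. l2_inner (dtau \<alpha> t) (\<phi> i)) has_real_derivative
        f1 \<tau> * \<tau> * l2_inner (dtau \<alpha> \<tau>) (\<phi> i) + f2 \<tau> * \<tau>\<^sup>2 * l2_inner (\<alpha> \<tau>) (\<phi> i)
        + f3 \<tau> * l2_inner (chi \<tau>) (\<phi> i) - l2_inner (dtau \<alpha> \<tau>) (\<phi> i) / \<tau>
        - (4 * q + 4 * (lam i)\<^sup>2 / (\<tau>\<^sup>2 + 1)\<^sup>2) * l2_inner (\<alpha> \<tau>) (\<phi> i)) (at \<tau>)"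
      using l2_inner_has_derivative[OF st' continuous_phi \<tau>, of i] by simp
  next
    have small: "eventually (\<lambda>\<tau>::real. 0 < \<tau> \<and> \<tau> < 1) (at_right 0)"
      by (rule eventually_at_rightI[of 0 1]) auto
    \<comment> \<open>Four factors \<open>sqrt \<tau>\<close> absorb up to three logarithms and
      leave one factor over. The third logarithm occurs in \<open>lim_a'_ln\<close>.\<close>
    have log: "\<tau>\<^sup>2 * \<bar>ln \<tau>\<bar>\<^sup>2 \<le> sqrt \<tau>" "\<tau>\<^sup>2 * \<bar>ln \<tau>\<bar>\<^sup>2 * \<bar>ln \<tau>\<bar> \<le> sqrt \<tau>" if "0 < \<tau>" "\<tau> < 1" for \<tau> :: real
    proof -
      define r m where "r = sqrt \<tau>" and "m = r * \<bar>ln \<tau>\<bar>"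
      have r: "0 \<le> r" "r \<le> 1" "\<tau> = r * r" using that by (auto simp: r_def)
      have m: "0 \<le> m" using r(1) by (simp add: m_def)
      have m1: "m \<le> 1" using sqrt_mult_ln_le_one[of \<tau>] that by (simp add: m_def r_def)
      have "\<tau>\<^sup>2 * \<bar>ln \<tau>\<bar>\<^sup>2 = r * (r * m\<^sup>2)" by (subst r(3)) (simp add: m_def power2_eq_square)
      also have "\<dots> \<le> r * 1" using r(1,2) m m1 by (intro mult_left_mono mult_le_one power_le_one) auto
      finally show "\<tau>\<^sup>2 * \<bar>ln \<tau>\<bar>\<^sup>2 \<le> sqrt \<tau>" by (simp add: r_def)
      have "\<tau>\<^sup>2 * \<bar>ln \<tau>\<bar>\<^sup>2 * \<bar>ln \<tau>\<bar> = r * m ^ 3" by (subst r(3)) (simp add: m_def power2_eq_square power3_eq_cube)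
      also have "\<dots> \<le> r * 1" using r(1) m m1 by (intro mult_left_mono power_le_one) auto
      finally show "\<tau>\<^sup>2 * \<bar>ln \<tau>\<bar>\<^sup>2 * \<bar>ln \<tau>\<bar> \<le> sqrt \<tau>" by (simp add: r_def)
    qed
    obtain C where C: "0 < C" "eventually (\<lambda>\<tau>. \<bar>l2_inner (\<lambda>x. \<alpha> \<tau> x - (Oc x * ln \<tau> + h x)) (\<phi> i)\<bar>
        \<le> C * \<bar>\<tau>\<^sup>2 * \<bar>ln \<tau>\<bar>\<^sup>2\<bar>) (at_right 0)"
    proof (rule coeff_bigo[OF big(1)])
      show "eventually (\<lambda>\<tau>. continuous_on (sphere 0 1) (\<lambda>x. \<alpha> \<tau> x - (Oc x * ln \<tau> + h x))) (at_right 0)"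
        using small by eventually_elim (auto intro!: continuous_on_diff continuous_on_add continuous_on_mult
            continuous_on_const c c0)
    qed
    show "((\<lambda>\<tau>. l2_inner (\<alpha> \<tau>) (\<phi> i) - l2_inner Oc (\<phi> i) * ln \<tau> - l2_inner h (\<phi> i)) \<longlongrightarrow> 0) (at_right 0)"
    proof (rule tendsto_0_at_right_le_sqrt)
      show "eventually (\<lambda>\<tau>. \<bar>l2_inner (\<alpha> \<tau>) (\<phi> i) - l2_inner Oc (\<phi> i) * ln \<tau> - l2_inner h (\<phi> i)\<bar>
          \<le> C * sqrt \<tau>) (at_right 0)"
        using C(2) small
      proof eventually_elim
        case (elim \<tau>)
        then have "C * \<bar>\<tau>\<^sup>2 * \<bar>ln \<tau>\<bar>\<^sup>2\<bar> \<le> C * sqrt \<tau>"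
          using C(1) log(1)[of \<tau>] by simp
        then show ?case using elim by (simp add: coeff_log_expansion c c0)
      qed
    qed
    obtain C' where C': "0 < C'" "eventually (\<lambda>\<tau>. \<bar>l2_inner (\<lambda>x. dtau \<alpha> \<tau> x - Oc x / \<tau>) (\<phi> i)\<bar>
        \<le> C' * \<bar>\<tau> * \<bar>ln \<tau>\<bar>\<^sup>2\<bar>) (at_right 0)"
    proof (rule coeff_bigo[OF big(2)])
      show "eventually (\<lambda>\<tau>. continuous_on (sphere 0 1) (\<lambda>x. dtau \<alpha> \<tau> x - Oc x / \<tau>)) (at_right 0)"
        using small by eventually_elim (auto intro!: continuous_on_diff continuous_on_divide
            continuous_on_const c c0)
    qed
    have ev: "eventually (\<lambda>\<tau>. \<bar>\<tau> * l2_inner (dtau \<alpha> \<tau>) (\<phi> i) - l2_inner Oc (\<phi> i)\<bar>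
        \<le> C' * (\<tau>\<^sup>2 * \<bar>ln \<tau>\<bar>\<^sup>2)) (at_right 0)"
      using C'(2) small
    proof eventually_elim
      case (elim \<tau>)
      have "l2_inner (\<lambda>x. dtau \<alpha> \<tau> x - Oc x / \<tau>) (\<phi> i) = l2_inner (\<lambda>x. dtau \<alpha> \<tau> x - (Oc x * (1 / \<tau>) + 0)) (\<phi> i)"
        by simp
      also have "\<dots> = l2_inner (dtau \<alpha> \<tau>) (\<phi> i) - l2_inner Oc (\<phi> i) * (1 / \<tau>) - l2_inner (\<lambda>x. 0) (\<phi> i)"
        using elim by (intro coeff_log_expansion c c0 continuous_on_const) auto
      finally have e: "\<tau> * l2_inner (dtau \<alpha> \<tau>) (\<phi> i) - l2_inner Oc (\<phi> i)
          = \<tau> * l2_inner (\<lambda>x. dtau \<alpha> \<tau> x - Oc x / \<tau>) (\<phi> i)"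
        using elim by (simp add: l2_inner_def right_diff_distrib)
      have "\<tau> * \<bar>l2_inner (\<lambda>x. dtau \<alpha> \<tau> x - Oc x / \<tau>) (\<phi> i)\<bar> \<le> \<tau> * (C' * \<bar>\<tau> * \<bar>ln \<tau>\<bar>\<^sup>2\<bar>)"
        using elim by (intro mult_left_mono) auto
      then show ?case
        unfolding e abs_mult using elim by (simp add: power2_eq_square mult_ac)
    qed
    show "((\<lambda>\<tau>. \<tau> * l2_inner (dtau \<alpha> \<tau>) (\<phi> i) - l2_inner Oc (\<phi> i)) \<longlongrightarrow> 0) (at_right 0)"
    proof (rule tendsto_0_at_right_le_sqrt)
      show "eventually (\<lambda>\<tau>. \<bar>\<tau> * l2_inner (dtau \<alpha> \<tau>) (\<phi> i) - l2_inner Oc (\<phi> i)\<bar> \<le> C' * sqrt \<tau>) (at_right 0)"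
        using ev small
      proof eventually_elim
        case (elim \<tau>)
        then have "C' * (\<tau>\<^sup>2 * \<bar>ln \<tau>\<bar>\<^sup>2) \<le> C' * sqrt \<tau>"
          using C'(1) log(1)[of \<tau>] by simp
        then show ?case using elim by linarith
      qed
    qed
    show "((\<lambda>\<tau>. (\<tau> * l2_inner (dtau \<alpha> \<tau>) (\<phi> i) - l2_inner Oc (\<phi> i)) * ln \<tau>) \<longlongrightarrow> 0) (at_right 0)"
    proof (rule tendsto_0_at_right_le_sqrt)
      show "eventually (\<lambda>\<tau>. \<bar>(\<tau> * l2_inner (dtau \<alpha> \<tau>) (\<phi> i) - l2_inner Oc (\<phi> i)) * ln \<tau>\<bar> \<le> C' * sqrt \<tau>) (at_right 0)"
        using ev small
      proof eventually_elim
        case (elim \<tau>)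
        have "\<bar>\<tau> * l2_inner (dtau \<alpha> \<tau>) (\<phi> i) - l2_inner Oc (\<phi> i)\<bar> * \<bar>ln \<tau>\<bar>
            \<le> C' * (\<tau>\<^sup>2 * \<bar>ln \<tau>\<bar>\<^sup>2) * \<bar>ln \<tau>\<bar>"
          using elim(1) by (intro mult_right_mono) auto
        also have "\<dots> = C' * (\<tau>\<^sup>2 * \<bar>ln \<tau>\<bar>\<^sup>2 * \<bar>ln \<tau>\<bar>)" by (simp only: mult.assoc)
        also have "\<dots> \<le> C' * sqrt \<tau>"
          using C'(1) log(2)[of \<tau>] elim(2) by (intro mult_left_mono) auto
        finally show ?case by (simp only: abs_mult)
      qed
    qed
    have "l2_inner (w 0) (\<phi> i) = l2_inner chi0 (\<phi> i)" using w(3) by (intro l2_inner_cong) auto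
    moreover have "eventually (\<lambda>\<tau>. l2_inner (w \<tau>) (\<phi> i) = l2_inner (chi \<tau>) (\<phi> i)) (at_right 0)"
      using small by eventually_elim (intro l2_inner_cong, auto simp: w(2))
    ultimately show "((\<lambda>t. l2_inner (chi t) (\<phi> i)) \<longlongrightarrow> l2_inner chi0 (\<phi> i)) (at_right 0)"
      using coeff_limit_of_C1_time[OF w(1), of i] by (simp add: tendsto_cong)
  qed
qed

lemma sobolev_norm_nonneg: "0 \<le> sobolev_norm \<phi> lam s f" if "smooth_sphere f"
  unfolding sobolev_norm_def by (intro real_sqrt_ge_zero suminf_nonneg sobolev_summable that) simp

text \<open>\<open>mode_const\<close> depends on \<open>q\<close> and \<open>M\<close> only, so one
  \<open>K\<close> serves all modes and all solutions. The last claim allows \<open>K\<close> to be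
  enlarged to the \<open>2 * K\<close> that arises when the first two bounds are added.\<close>

lemma scattering_estimate:
  fixes s :: real
  assumes sol: "smooth_solution \<phi> lam q f1 f2 f3 chi0 Oc h \<alpha> chi"
    and q: "1 \<le> q" and M: "0 \<le> M"
    and f: "\<And>\<tau>. 0 < \<tau> \<Longrightarrow> \<bar>f1 \<tau>\<bar> \<le> M" "\<And>\<tau>. 0 < \<tau> \<Longrightarrow> \<bar>f2 \<tau>\<bar> \<le> M" "\<And>\<tau>. 0 < \<tau> \<Longrightarrow> \<bar>f3 \<tau>\<bar> \<le> M"
  defines "K \<equiv> sqrt (mode_ode.mode_const q M)"
  defines "N \<equiv> \<lambda>t. sobolev_norm \<phi> lam (s + 1/2) (\<alpha> 1) + sobolev_norm \<phi> lam (s - 1/2) (dtau \<alpha> 1)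
      + sobolev_norm \<phi> lam t (chi 1)"
  shows "sobolev_norm \<phi> lam s (\<lambda>x. h x - log_nabla \<phi> lam Oc x) \<le> K * N (s - 1/2)"
    and "sobolev_norm \<phi> lam s Oc \<le> K * N (s - 1/2)"
    and "sobolev_norm \<phi> lam (s + 1/2) chi0 \<le> K * N (s + 1/2)"
    and "0 \<le> K * N t"
proof -
  let ?m = "\<lambda>g i. l2_inner g (\<phi> i)"
  let ?L = "\<lambda>i. 1 + (lam i)\<^sup>2"
  note ode = mode_ode_coeff[OF sol q M f]
  define C where "C = mode_ode.mode_const q M"
  have sm: "smooth_sphere Oc" "smooth_sphere h" "smooth_sphere (\<alpha> 1)" "smooth_sphere (dtau \<alpha> 1)" "smooth_sphere (chi 1)"
  proof -
    have "smooth_spacetime \<alpha>" "smooth_spacetime chi"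
      using sol unfolding smooth_solution_def by blast+
    then show "smooth_sphere (\<alpha> 1)" "smooth_sphere (dtau \<alpha> 1)" "smooth_sphere (chi 1)"
      by (auto intro: smooth_spacetime_slice smooth_spacetime_dtau)
    show "smooth_sphere Oc" "smooth_sphere h"
      using sol unfolding smooth_solution_def by blast+
  qed
  have C: "0 \<le> C"
    using q by (simp add: C_def mode_ode.mode_const_def[OF ode])
  have L: "0 < ?L i" for i using square_plus_1_pos[of "lam i"] by simp
  have L_powr: "?L i powr (s - 1/2) * sqrt (?L i) = ?L i powr s"
    "?L i powr (s - 1/2) * ?L i = ?L i powr (s + 1/2)" for i
  proof -
    have "sqrt (?L i) = ?L i powr (1/2)" "?L i = ?L i powr 1" using L[of i] by (simp_all add: powr_half_sqrt)
    then show "?L i powr (s - 1/2) * sqrt (?L i) = ?L i powr s"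
      "?L i powr (s - 1/2) * ?L i = ?L i powr (s + 1/2)"
      using powr_add[of "?L i" "s - 1/2" "1/2"] powr_add[of "?L i" "s - 1/2" 1]
      by (simp_all add: add.commute)
  qed
  define H where "H i = ?m h i - real (dyadic_index i) * ln 2 * ?m Oc i" for i
  \<comment> \<open>Splitting the integral requires integrability of the \<open>log_nabla\<close>
    term, since a non-integrable function has integral 0 by convention.\<close>
  have H: "?m (\<lambda>x. h x - log_nabla \<phi> lam Oc x) i = H i" for i
  proof -
    have "integrable sphere_measure (\<lambda>x. h x * \<phi> i x)"
      by (intro integrable_sphere_mult smooth_sphere_imp_continuous sm continuous_phi)
    then have "?m (\<lambda>x. h x - log_nabla \<phi> lam Oc x) i = ?m h i - ?m (log_nabla \<phi> lam Oc) i"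
      unfolding l2_inner_def left_diff_distrib
      by (intro Bochner_Integration.integral_diff log_nabla_coeff(1) sm)
    then show ?thesis by (simp add: H_def log_nabla_coeff(2) sm)
  qed
  have HT: "?m h i + ?m Oc i * ln (1 / 2 ^ dyadic_index i) = H i" for i
    by (simp add: H_def ln_div ln_realpow)
  \<comment> \<open>Multiplying the mode estimate by the power \<open>s - 1/2\<close> of
    \<open>1 + (lam i)\<^sup>2\<close> produces order \<open>s\<close> on the left and order
    \<open>s + 1/2\<close> on \<alpha>.\<close>
  have est1: "?L i powr s * ((?m Oc i)\<^sup>2 + (H i)\<^sup>2) \<le> C * (?L i powr (s + 1/2) * (?m (\<alpha> 1) i)\<^sup>2
      + ?L i powr (s - 1/2) * (?m (dtau \<alpha> 1) i)\<^sup>2 + ?L i powr (s - 1/2) * (?m (chi 1) i)\<^sup>2)" for i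
  proof -
    have "?L i powr (s - 1/2) * (sqrt (?L i) * ((?m Oc i)\<^sup>2 + (H i)\<^sup>2))
        \<le> ?L i powr (s - 1/2) * (C * (?L i * (?m (\<alpha> 1) i)\<^sup>2 + (?m (dtau \<alpha> 1) i)\<^sup>2 + (?m (chi 1) i)\<^sup>2))"
      using mode_ode.mode_estimate_1[OF ode, of i] unfolding HT C_def by (intro mult_left_mono) auto
    also have "\<dots> = C * ((?L i powr (s - 1/2) * ?L i) * (?m (\<alpha> 1) i)\<^sup>2
      + ?L i powr (s - 1/2) * (?m (dtau \<alpha> 1) i)\<^sup>2 + ?L i powr (s - 1/2) * (?m (chi 1) i)\<^sup>2)"
      by (simp add: algebra_simps)
    finally show ?thesis unfolding mult.assoc[symmetric] L_powr .
  qed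
  have est2: "?L i powr (s + 1/2) * (?m chi0 i)\<^sup>2 \<le> C * (?L i powr (s + 1/2) * (?m (\<alpha> 1) i)\<^sup>2
      + ?L i powr (s - 1/2) * (?m (dtau \<alpha> 1) i)\<^sup>2 + ?L i powr (s + 1/2) * (?m (chi 1) i)\<^sup>2)" for i
  proof -
    have "?L i powr (s - 1/2) * (?L i * (?m chi0 i)\<^sup>2)
        \<le> ?L i powr (s - 1/2) * (C * (?L i * (?m (\<alpha> 1) i)\<^sup>2 + (?m (dtau \<alpha> 1) i)\<^sup>2 + ?L i * (?m (chi 1) i)\<^sup>2))"
      using mode_ode.mode_estimate_2[OF ode, of i] unfolding C_def by (intro mult_left_mono) auto
    also have "\<dots> = C * ((?L i powr (s - 1/2) * ?L i) * (?m (\<alpha> 1) i)\<^sup>2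
      + ?L i powr (s - 1/2) * (?m (dtau \<alpha> 1) i)\<^sup>2 + (?L i powr (s - 1/2) * ?L i) * (?m (chi 1) i)\<^sup>2)"
      by (simp add: algebra_simps)
    finally show ?thesis unfolding mult.assoc[symmetric] L_powr .
  qed
  have summ: "summable (\<lambda>i. ?L i powr t * (?m g i)\<^sup>2)" if "smooth_sphere g" for g t
    using sobolev_summable[OF that] by simp
  have norm: "sobolev_norm \<phi> lam t g = sqrt (\<Sum>i. ?L i powr t * (?m g i)\<^sup>2)" for t g
    by (simp add: sobolev_norm_def)
  have part: "?L i powr s * x\<^sup>2 \<le> ?L i powr s * (x\<^sup>2 + y\<^sup>2)" "?L i powr s * y\<^sup>2 \<le> ?L i powr s * (x\<^sup>2 + y\<^sup>2)"
    for i and x y :: real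
    by (intro mult_left_mono; simp)+
  show "sobolev_norm \<phi> lam s (\<lambda>x. h x - log_nabla \<phi> lam Oc x) \<le> K * N (s - 1/2)"
    unfolding K_def C_def[symmetric] N_def norm H
    by (rule sqrt_suminf_le[OF _ order_trans[OF part(2) est1]]) (auto intro!: C summ sm)
  show "sobolev_norm \<phi> lam s Oc \<le> K * N (s - 1/2)"
    unfolding K_def C_def[symmetric] N_def norm
    by (rule sqrt_suminf_le[OF _ order_trans[OF part(1) est1]]) (auto intro!: C summ sm)
  show "sobolev_norm \<phi> lam (s + 1/2) chi0 \<le> K * N (s + 1/2)"
    unfolding K_def C_def[symmetric] N_def norm
    by (rule sqrt_suminf_le[OF _ est2]) (auto intro!: C summ sm)
  show "0 \<le> K * N t"
    unfolding K_def C_def[symmetric] N_def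
    by (intro mult_nonneg_nonneg add_nonneg_nonneg sobolev_norm_nonneg sm real_sqrt_ge_zero C)
qed

end

theorem theorem3p3:
  fixes n :: nat and q' s :: real
    and f1 f2 f3 :: "real \<Rightarrow> real"
    and \<phi> :: "nat \<Rightarrow> 'a::euclidean_space \<Rightarrow> real" and lam :: "nat \<Rightarrow> real"
  assumes "n \<ge> 4" and "even n" and "DIM('a) = n + 1"
    and "q' \<ge> 1"
    and "smooth_halfline f1" and "bounded (f1 ` {0..})"
    and "smooth_halfline f2" and "bounded (f2 ` {0..})"
    and "smooth_halfline f3" and "bounded (f3 ` {0..})"
    and "eigenbasis \<phi> lam"
    and "s \<ge> 1"
  shows "\<exists>C. \<forall>chi\<^sub>0 \<O> h \<alpha> chi.
    smooth_solution \<phi> lam q' f1 f2 f3 chi\<^sub>0 \<O> h \<alpha> chi \<longrightarrow>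
      sobolev_norm \<phi> lam s (\<lambda>x. h x - log_nabla \<phi> lam \<O> x) + sobolev_norm \<phi> lam s \<O>
        \<le> C * (sobolev_norm \<phi> lam (s + 1/2) (\<alpha> 1) + sobolev_norm \<phi> lam (s - 1/2) (dtau \<alpha> 1)
               + sobolev_norm \<phi> lam (s - 1/2) (chi 1)) \<and>
      sobolev_norm \<phi> lam (s + 1/2) chi\<^sub>0
        \<le> C * (sobolev_norm \<phi> lam (s + 1/2) (\<alpha> 1) + sobolev_norm \<phi> lam (s - 1/2) (dtau \<alpha> 1)
               + sobolev_norm \<phi> lam (s + 1/2) (chi 1))"
proof -
  interpret laplace_eigenbasis \<phi> lam
    by unfold_locales fact
  have "bounded (f1 ` {0..} \<union> f2 ` {0..} \<union> f3 ` {0..})"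
    using assms by simp
  then obtain M where "0 < M" and M: "\<forall>y\<in>f1 ` {0..} \<union> f2 ` {0..} \<union> f3 ` {0..}. norm y \<le> M"
    unfolding bounded_pos by blast
  then have f: "\<bar>f1 \<tau>\<bar> \<le> M" "\<bar>f2 \<tau>\<bar> \<le> M" "\<bar>f3 \<tau>\<bar> \<le> M" if "0 < \<tau>" for \<tau>
    using that by auto
  let ?K = "sqrt (mode_ode.mode_const q' M)"
  show ?thesis
  proof (intro exI[of _ "2 * ?K"] allI impI)
    fix chi0 Oc h \<alpha> chi
    assume sol: "smooth_solution \<phi> lam q' f1 f2 f3 chi0 Oc h \<alpha> chi"
    note est = scattering_estimate[OF sol \<open>1 \<le> q'\<close> less_imp_le[OF \<open>0 < M\<close>] f, where s = s]
    show "sobolev_norm \<phi> lam s (\<lambda>x. h x - log_nabla \<phi> lam Oc x) + sobolev_norm \<phi> lam s Oc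
        \<le> 2 * ?K * (sobolev_norm \<phi> lam (s + 1/2) (\<alpha> 1) + sobolev_norm \<phi> lam (s - 1/2) (dtau \<alpha> 1)
               + sobolev_norm \<phi> lam (s - 1/2) (chi 1)) \<and>
      sobolev_norm \<phi> lam (s + 1/2) chi0
        \<le> 2 * ?K * (sobolev_norm \<phi> lam (s + 1/2) (\<alpha> 1) + sobolev_norm \<phi> lam (s - 1/2) (dtau \<alpha> 1)
               + sobolev_norm \<phi> lam (s + 1/2) (chi 1))"
      using est(1,2,3) est(4)[of "s + 1/2"] unfolding mult.assoc by linarith
  qed
qed

end
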